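(* Let $M$ be a complete $C^1$ Finsler manifold modeled on a Banach space that admits a $C^1$ Lipschitz bump function, let $H\colon[0,\infty)\times M\times\mathbb{R}\to\mathbb{R}$ be a continuous function satisfying condition (A) (defined in the context), and let $h:M\to\mathbb{R}$ be bounded and continuous. Let $u:[0,\infty)\times M\to\mathbb{R}$ be a viscosity subsolution and $v:[0,\infty)\times M\to\mathbb{R}$ a viscosity supersolution of $$u_t+H(t,x,\|u_x\|_x)=0\quad(t>0),\qquad u(0,x)=h(x).$$ Suppose that for every $T>0$ both $u$ and $v$ are bounded in $[0,T)\times M$, and that for every $(t,x)\in(0,\infty)\times M$ either $u$ or $v$ is Lipschitz in a neighborhood of $(t,x)$. Then $$\inf_{[0,\infty)\times M}(v-u)\ge0.$$
   Context: $C^1$ Finsler manifold (in the sense of Palais): a connected, paracompact $C^1$ Banach manifold $M$ modeled on a Banach space $(X,\|\cdot\|)$, with a continuous map $\|\cdot\|_M:TM\to[0,\infty)$ such that: (P1) for every $x\in M$ the restriction $\|\cdot\|_x$ of $\|\cdot\|_M$ to $T_xM$ is a norm such that for every chart $\varphi:U\to X$ with $x\in U$, the norm $v\in X\mapsto\|d\varphi^{-1}(\varphi(x))(v)\|_x$ is equivalent to $\|\cdot\|$; (P2) for every $x_0\in M$, $\varepsilon>0$ and chart $\varphi:U\to X$ with $x_0\in U$ there is an open neighborhood $W$ of $x_0$ such that for all $x\in W$, $v\in X$, $\frac{1}{1+\varepsilon}\|d\varphi^{-1}(\varphi(x_0))(v)\|_{x_0}\le\|d\varphi^{-1}(\varphi(x))(v)\|_x\le(1+\varepsilon)\|d\varphi^{-1}(\varphi(x_0))(v)\|_{x_0}$.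 Finsler metric: $d(p,q)$ is the infimum of the lengths $\ell(c)=\int_a^b\|c'(t)\|_{c(t)}\,dt$ over piecewise $C^1$ paths $c:[a,b]\to M$ connecting $p$ to $q$. $M$ is complete if $(M,d)$ is complete. On $[0,\infty)\times M$, Lipschitz is with respect to $|t-s|+d(x,y)$. $C^1$ Lipschitz bump function on $X$: a $C^1$, Lipschitz function $b:X\to\mathbb{R}$ with bounded, non-empty support. Sub/superdifferential: for $(t,x)\in(0,\infty)\times M$, $D^-u(t,x)$ (resp. $D^+u(t,x)$) is the set of pairs $(\alpha,\Delta)\in\mathbb{R}\times T_xM^*$ representing $dg(t,x)$ (i.e. $\alpha=g_t(t,x)$, $\Delta=g_x(t,x)$), where $g:(0,\infty)\times M\to\mathbb{R}$ is $C^1$ and $u-g$ attains a local minimum (resp. local maximum) at $(t,x)$. For $\xi\in T_xM^*$, $\|\xi\|_x$ denotes the dual norm $\sup\{|\xi(v)|:v\in T_xM,\ \|v\|_x=1\}$. Viscosity subsolution: $u$ is upper semicontinuous on $[0,\infty)\times M$, $\alpha+H(t,x,\|\Delta\|_x)\le0$ for every $(t,x)\in(0,\infty)\times M$ and $(\alpha,\Delta)\in D^+u(t,x)$, and $u(0,x)\le h(x)$ for every $x\in M$. Viscosity supersolution: $u$ is lower semicontinuous on $[0,\infty)\times M$, $\alpha+H(t,x,\|\Delta\|_x)\ge0$ for every $(t,x)\in(0,\infty)\times M$ and $(\alpha,\Delta)\in D^-u(t,x)$, and $u(0,x)\ge h(x)$ for every $x\in M$. Condition (A): there are a constant $C\ge0$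 and a continuous function $\omega:[0,\infty)\times\mathbb{R}\times\mathbb{R}\to\mathbb{R}$ with $\omega(0,0,0)=0$ such that for all $t_1,t_2\in[0,\infty)$, $x_1,x_2\in M$, $r_1,r_2\in\mathbb{R}$, $|H(t_1,x_1,r_1)-H(t_2,x_2,r_2)|\le\omega(|t_1-t_2|,d(x_1,x_2),r_1-r_2)+C\max\{|r_1|,|r_2|\}(|t_1-t_2|+d(x_1,x_2))$. *)

theory Defs
  imports "HOL-Analysis.Analysis"
begin

text \<open>C1 maps between normed spaces, on an open set \<open>S\<close>; continuity of the derivative is with
  respect to the operator norm.\<close>

definition C1_on :: "'a::real_normed_vector set \<Rightarrow> ('a \<Rightarrow> 'b::real_normed_vector) \<Rightarrow> bool" where
  "C1_on S f \<longleftrightarrow> (\<exists>f' :: 'a \<Rightarrow> ('a \<Rightarrow>\<^sub>L 'b).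
     (\<forall>x\<in>S. (f has_derivative blinfun_apply (f' x)) (at x)) \<and> continuous_on S f')"

definition C1_Lipschitz_bump :: "('x::real_normed_vector \<Rightarrow> real) \<Rightarrow> bool" where
  "C1_Lipschitz_bump b \<longleftrightarrow> C1_on UNIV b \<and> (\<exists>L. L-lipschitz_on UNIV b) \<and>
     bounded (closure {x. b x \<noteq> 0}) \<and> closure {x. b x \<noteq> 0} \<noteq> {}"

definition usc_on :: "'a::topological_space set \<Rightarrow> ('a \<Rightarrow> real) \<Rightarrow> bool" where
  "usc_on S f \<longleftrightarrow> (\<forall>z\<in>S. \<forall>y>f z. \<forall>\<^sub>F w in at z within S. f w < y)"

definition lsc_on :: "'a::topological_space set \<Rightarrow> ('a \<Rightarrow> real) \<Rightarrow> bool" where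
  "lsc_on S f \<longleftrightarrow> (\<forall>z\<in>S. \<forall>y<f z. \<forall>\<^sub>F w in at z within S. y < f w)"

definition paracompact_topology :: "'a topology \<Rightarrow> bool" where
  "paracompact_topology X \<longleftrightarrow> Hausdorff_space X \<and>
     (\<forall>\<U>. (\<forall>U\<in>\<U>. openin X U) \<and> \<Union>\<U> = topspace X \<longrightarrow>
       (\<exists>\<V>. (\<forall>V\<in>\<V>. openin X V) \<and> \<Union>\<V> = topspace X \<and>
            (\<forall>V\<in>\<V>. \<exists>U\<in>\<U>. V \<subseteq> U) \<and> locally_finite_in X \<V>))"


section \<open>C1 Banach manifolds\<close>

text \<open>A chart is a pair \<open>(U, \<phi>)\<close>; the values of \<open>\<phi>\<close> outside \<open>U\<close> are irrelevant. The manifold is the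
  whole type \<open>'m\<close>, with the topology of its type class, and its C1 structure is a maximal atlas.\<close>

type_synonym ('m, 'x) chart = "'m set \<times> ('m \<Rightarrow> 'x)"

definition chart_inv :: "('m, 'x) chart \<Rightarrow> 'x \<Rightarrow> 'm" where
  "chart_inv c = inv_into (fst c) (snd c)"

definition is_chart :: "('m::topological_space, 'x::real_normed_vector) chart \<Rightarrow> bool" where
  "is_chart c \<longleftrightarrow> open (fst c) \<and> open (snd c ` fst c) \<and>
     homeomorphism (fst c) (snd c ` fst c) (snd c) (chart_inv c)"

definition C1_compatible ::
    "('m::topological_space, 'x::real_normed_vector) chart \<Rightarrow> ('m, 'x) chart \<Rightarrow> bool" where
  "C1_compatible c c' \<longleftrightarrow>
     C1_on (snd c ` (fst c \<inter> fst c')) (snd c' \<circ> chart_inv c) \<and>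
     C1_on (snd c' ` (fst c \<inter> fst c')) (snd c \<circ> chart_inv c')"

definition C1_structure :: "('m::topological_space, 'x::real_normed_vector) chart set \<Rightarrow> bool" where
  "C1_structure A \<longleftrightarrow>
     (\<forall>c\<in>A. is_chart c) \<and> (\<Union>c\<in>A. fst c) = UNIV \<and>
     (\<forall>c\<in>A. \<forall>c'\<in>A. C1_compatible c c') \<and>
     (\<forall>c. is_chart c \<and> (\<forall>c'\<in>A. C1_compatible c c') \<longrightarrow> c \<in> A)"

definition charts_at :: "('m, 'x) chart set \<Rightarrow> 'm \<Rightarrow> ('m, 'x) chart set" where
  "charts_at A x = {c\<in>A. x \<in> fst c}"

text \<open>A tangent vector \<open>\<xi>\<close> at \<open>x\<close> is the family of its coordinate vectors in all the charts at \<open>x\<close>,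
  so \<open>\<xi> c\<close> is \<open>d\<phi>(x)(\<xi>)\<close> for \<open>c = (U, \<phi>)\<close>; these transform by the derivatives of the changes of
  coordinates. The vector space operations are pointwise. The off-domain value 0 makes the
  representation unique.\<close>

type_synonym ('m, 'x) tangent = "('m, 'x) chart \<Rightarrow> 'x"

definition tangent_space ::
    "('m, 'x::real_normed_vector) chart set \<Rightarrow> 'm \<Rightarrow> ('m, 'x) tangent set" where
  "tangent_space A x = {\<xi>. (\<forall>c. c \<notin> charts_at A x \<longrightarrow> \<xi> c = 0) \<and>
     (\<forall>c\<in>charts_at A x. \<forall>c'\<in>charts_at A x.
        \<xi> c' = frechet_derivative (snd c' \<circ> chart_inv c) (at (snd c x)) (\<xi> c))}"

text \<open>\<open>tvec A c x v\<close> is the tangent vector \<open>d\<phi>\<inverse>(\<phi>(x))(v)\<close> at \<open>x\<close>, for \<open>c = (U, \<phi>)\<close>.\<close>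

definition tvec ::
    "('m, 'x::real_normed_vector) chart set \<Rightarrow> ('m, 'x) chart \<Rightarrow> 'm \<Rightarrow> 'x \<Rightarrow> ('m, 'x) tangent" where
  "tvec A c x v = (\<lambda>c'. if c' \<in> charts_at A x
      then frechet_derivative (snd c' \<circ> chart_inv c) (at (snd c x)) v else 0)"

definition tangent_bundle ::
    "('m, 'x::real_normed_vector) chart set \<Rightarrow> ('m \<times> ('m, 'x) tangent) set" where
  "tangent_bundle A = Sigma UNIV (tangent_space A)"

text \<open>The topology of the tangent bundle is the final one for the trivializations
  \<open>U \<times> X \<rightarrow> TM\<close>, \<open>(x, v) \<mapsto> (x, d\<phi>\<inverse>(\<phi>(x))(v))\<close>.\<close>

definition tangent_topology ::
    "('m::topological_space, 'x::real_normed_vector) chart set \<Rightarrow> ('m \<times> ('m, 'x) tangent) topology" where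
  "tangent_topology A = topology (\<lambda>V. V \<subseteq> tangent_bundle A \<and>
     (\<forall>c\<in>A. openin (top_of_set (fst c \<times> UNIV)) {(x, v). x \<in> fst c \<and> (x, tvec A c x v) \<in> V}))"

lemma openin_tangent_topology:
  "openin (tangent_topology A) V \<longleftrightarrow> V \<subseteq> tangent_bundle A \<and>
     (\<forall>c\<in>A. openin (top_of_set (fst c \<times> UNIV)) {(x, v). x \<in> fst c \<and> (x, tvec A c x v) \<in> V})"
proof -
  let ?P = "\<lambda>c V. {(x, v). x \<in> fst c \<and> (x, tvec A c x v) \<in> V}"
  have Int: "?P c (V \<inter> W) = ?P c V \<inter> ?P c W" for c V W by auto
  have Un: "?P c (\<Union>\<K>) = (\<Union>V\<in>\<K>. ?P c V)" for c \<K> by auto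
  have "istopology (\<lambda>V. V \<subseteq> tangent_bundle A \<and>
     (\<forall>c\<in>A. openin (top_of_set (fst c \<times> UNIV)) (?P c V)))"
    unfolding istopology_def Int Un by (blast intro: openin_Int openin_Union)
  then show ?thesis by (simp add: tangent_topology_def topology_inverse')
qed


section \<open>Finsler manifolds\<close>

definition tangent_norm_at ::
    "('m, 'x::real_normed_vector) chart set \<Rightarrow> 'm \<Rightarrow> (('m, 'x) tangent \<Rightarrow> real) \<Rightarrow> bool" where
  "tangent_norm_at A x n \<longleftrightarrow>
     (\<forall>\<xi>\<in>tangent_space A x. 0 \<le> n \<xi> \<and> (n \<xi> = 0 \<longleftrightarrow> \<xi> = (\<lambda>_. 0)) \<and>
        (\<forall>a. n (\<lambda>c. a *\<^sub>R \<xi> c) = \<bar>a\<bar> * n \<xi>) \<and>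
        (\<forall>\<eta>\<in>tangent_space A x. n (\<lambda>c. \<xi> c + \<eta> c) \<le> n \<xi> + n \<eta>))"

definition C1_finsler_manifold ::
    "('m::topological_space, 'x::banach) chart set \<Rightarrow> ('m \<Rightarrow> ('m, 'x) tangent \<Rightarrow> real) \<Rightarrow> bool" where
  "C1_finsler_manifold A N \<longleftrightarrow>
     C1_structure A \<and> connected (UNIV :: 'm set) \<and>
     paracompact_topology (euclidean :: 'm topology) \<and>
     continuous_map (tangent_topology A) euclideanreal (\<lambda>(x, \<xi>). N x \<xi>) \<and>
     (\<forall>x. tangent_norm_at A x (N x) \<and>
       (\<forall>c\<in>charts_at A x. \<exists>k>0. \<exists>K>0. \<forall>v.
          k * norm v \<le> N x (tvec A c x v) \<and> N x (tvec A c x v) \<le> K * norm v)) \<and>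
     (\<forall>x0. \<forall>\<epsilon>>0. \<forall>c\<in>charts_at A x0. \<exists>W. open W \<and> x0 \<in> W \<and> W \<subseteq> fst c \<and>
       (\<forall>x\<in>W. \<forall>v. 1 / (1 + \<epsilon>) * N x0 (tvec A c x0 v) \<le> N x (tvec A c x v) \<and>
                   N x (tvec A c x v) \<le> (1 + \<epsilon>) * N x0 (tvec A c x0 v)))"

definition C1_path ::
    "('m::topological_space, 'x::real_normed_vector) chart set \<Rightarrow> real set \<Rightarrow> (real \<Rightarrow> 'm) \<Rightarrow> bool" where
  "C1_path A I \<gamma> \<longleftrightarrow> continuous_on I \<gamma> \<and>
     (\<forall>c\<in>A. \<exists>w. continuous_on {r\<in>I. \<gamma> r \<in> fst c} w \<and>
        (\<forall>r\<in>I. \<gamma> r \<in> fst c \<longrightarrow> ((snd c \<circ> \<gamma>) has_vector_derivative w r) (at r within I)))"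

text \<open>Each piece is C1 up to its endpoints; this is stronger than
  \<^const>\<open>piecewise_C1_differentiable_on\<close>, where the derivative may blow up at the break points.\<close>

definition piecewise_C1_path ::
    "('m::topological_space, 'x::real_normed_vector) chart set \<Rightarrow> real \<Rightarrow> real \<Rightarrow> (real \<Rightarrow> 'm) \<Rightarrow> bool" where
  "piecewise_C1_path A a b \<gamma> \<longleftrightarrow> a < b \<and>
     (\<exists>n. \<exists>s :: nat \<Rightarrow> real. s 0 = a \<and> s n = b \<and>
        (\<forall>i<n. s i < s (Suc i) \<and> C1_path A {s i..s (Suc i)} \<gamma>))"

definition velocity ::
    "('m, 'x::real_normed_vector) chart set \<Rightarrow> (real \<Rightarrow> 'm) \<Rightarrow> real \<Rightarrow> ('m, 'x) tangent" where
  "velocity A \<gamma> t = (\<lambda>c. if c \<in> charts_at A (\<gamma> t)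
      then vector_derivative (snd c \<circ> \<gamma>) (at t) else 0)"

text \<open>The velocity is unspecified at the finitely many break points, which does not affect the
  integral.\<close>

definition path_len ::
    "('m, 'x::real_normed_vector) chart set \<Rightarrow> ('m \<Rightarrow> ('m, 'x) tangent \<Rightarrow> real) \<Rightarrow>
      real \<Rightarrow> real \<Rightarrow> (real \<Rightarrow> 'm) \<Rightarrow> real" where
  "path_len A N a b \<gamma> = integral {a..b} (\<lambda>t. N (\<gamma> t) (velocity A \<gamma> t))"

definition finsler_dist ::
    "('m::topological_space, 'x::real_normed_vector) chart set \<Rightarrow> ('m \<Rightarrow> ('m, 'x) tangent \<Rightarrow> real) \<Rightarrow>
      'm \<Rightarrow> 'm \<Rightarrow> real" where
  "finsler_dist A N p q =
     Inf {path_len A N a b \<gamma> |a b \<gamma>. piecewise_C1_path A a b \<gamma> \<and> \<gamma> a = p \<and> \<gamma> b = q}"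

definition finsler_complete ::
    "('m::topological_space, 'x::real_normed_vector) chart set \<Rightarrow> ('m \<Rightarrow> ('m, 'x) tangent \<Rightarrow> real) \<Rightarrow> bool" where
  "finsler_complete A N \<longleftrightarrow> (\<forall>\<sigma> :: nat \<Rightarrow> 'm.
     (\<forall>e>0. \<exists>k. \<forall>m\<ge>k. \<forall>n\<ge>k. finsler_dist A N (\<sigma> m) (\<sigma> n) < e) \<longrightarrow>
     (\<exists>x. (\<lambda>n. finsler_dist A N (\<sigma> n) x) \<longlonglongrightarrow> 0))"

definition lipschitz_near ::
    "('m::topological_space, 'x::real_normed_vector) chart set \<Rightarrow> ('m \<Rightarrow> ('m, 'x) tangent \<Rightarrow> real) \<Rightarrow>
      (real \<Rightarrow> 'm \<Rightarrow> real) \<Rightarrow> real \<Rightarrow> 'm \<Rightarrow> bool" where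
  "lipschitz_near A N u t x \<longleftrightarrow> (\<exists>W L. open W \<and> (t, x) \<in> W \<and>
     (\<forall>(s, y)\<in>W \<inter> {0..} \<times> UNIV. \<forall>(s', y')\<in>W \<inter> {0..} \<times> UNIV.
        \<bar>u s y - u s' y'\<bar> \<le> L * (\<bar>s - s'\<bar> + finsler_dist A N y y')))"


section \<open>Sub- and superdifferentials, viscosity solutions\<close>

text \<open>Elements of the dual are functionals on the tangent space, \<^const>\<open>undefined\<close> off it; linearity
  and continuity are read in charts, which identify the tangent space with the model space.\<close>

definition cotangent_space ::
    "('m, 'x::real_normed_vector) chart set \<Rightarrow> 'm \<Rightarrow> (('m, 'x) tangent \<Rightarrow> real) set" where
  "cotangent_space A x = {\<Delta>\<in>extensional (tangent_space A x).
     \<forall>c\<in>charts_at A x. bounded_linear (\<lambda>v. \<Delta> (tvec A c x v))}"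

text \<open>The element 0 only matters for the zero-dimensional model space, where there is no unit vector.\<close>

definition dual_norm ::
    "('m, 'x::real_normed_vector) chart set \<Rightarrow> ('m \<Rightarrow> ('m, 'x) tangent \<Rightarrow> real) \<Rightarrow>
      'm \<Rightarrow> (('m, 'x) tangent \<Rightarrow> real) \<Rightarrow> real" where
  "dual_norm A N x \<Delta> = Sup (insert 0 {\<bar>\<Delta> \<xi>\<bar> |\<xi>. \<xi> \<in> tangent_space A x \<and> N x \<xi> = 1})"

text \<open>C1 functions on the product manifold \<open>(0,\<infinity>) \<times> M\<close>.\<close>

definition C1_function ::
    "('m, 'x::real_normed_vector) chart set \<Rightarrow> (real \<Rightarrow> 'm \<Rightarrow> real) \<Rightarrow> bool" where
  "C1_function A g \<longleftrightarrow>
     (\<forall>c\<in>A. C1_on ({0<..} \<times> snd c ` fst c) (\<lambda>(s, y). g s (chart_inv c y)))"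

definition has_mderiv ::
    "('m, 'x::real_normed_vector) chart set \<Rightarrow> ('m \<Rightarrow> real) \<Rightarrow> 'm \<Rightarrow> (('m, 'x) tangent \<Rightarrow> real) \<Rightarrow> bool" where
  "has_mderiv A f x \<Delta> \<longleftrightarrow> \<Delta> \<in> cotangent_space A x \<and>
     (\<forall>c\<in>charts_at A x. ((f \<circ> chart_inv c) has_derivative (\<lambda>v. \<Delta> (tvec A c x v))) (at (snd c x)))"

definition superdifferential ::
    "('m::topological_space, 'x::real_normed_vector) chart set \<Rightarrow> (real \<Rightarrow> 'm \<Rightarrow> real) \<Rightarrow>
      real \<Rightarrow> 'm \<Rightarrow> (real \<times> (('m, 'x) tangent \<Rightarrow> real)) set" where
  "superdifferential A u t x = {(\<alpha>, \<Delta>). \<exists>g. C1_function A g \<and>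
     ((\<lambda>s. g s x) has_real_derivative \<alpha>) (at t) \<and> has_mderiv A (g t) x \<Delta> \<and>
     (\<forall>\<^sub>F (s, y) in nhds (t, x). u s y - g s y \<le> u t x - g t x)}"

definition subdifferential ::
    "('m::topological_space, 'x::real_normed_vector) chart set \<Rightarrow> (real \<Rightarrow> 'm \<Rightarrow> real) \<Rightarrow>
      real \<Rightarrow> 'm \<Rightarrow> (real \<times> (('m, 'x) tangent \<Rightarrow> real)) set" where
  "subdifferential A u t x = {(\<alpha>, \<Delta>). \<exists>g. C1_function A g \<and>
     ((\<lambda>s. g s x) has_real_derivative \<alpha>) (at t) \<and> has_mderiv A (g t) x \<Delta> \<and>
     (\<forall>\<^sub>F (s, y) in nhds (t, x). u t x - g t x \<le> u s y - g s y)}"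

definition viscosity_subsolution ::
    "('m::topological_space, 'x::real_normed_vector) chart set \<Rightarrow> ('m \<Rightarrow> ('m, 'x) tangent \<Rightarrow> real) \<Rightarrow>
      (real \<Rightarrow> 'm \<Rightarrow> real \<Rightarrow> real) \<Rightarrow> ('m \<Rightarrow> real) \<Rightarrow> (real \<Rightarrow> 'm \<Rightarrow> real) \<Rightarrow> bool" where
  "viscosity_subsolution A N H h u \<longleftrightarrow>
     usc_on ({0..} \<times> UNIV) (\<lambda>(t, x). u t x) \<and>
     (\<forall>t>0. \<forall>x. \<forall>(\<alpha>, \<Delta>)\<in>superdifferential A u t x. \<alpha> + H t x (dual_norm A N x \<Delta>) \<le> 0) \<and>
     (\<forall>x. u 0 x \<le> h x)"

definition viscosity_supersolution ::
    "('m::topological_space, 'x::real_normed_vector) chart set \<Rightarrow> ('m \<Rightarrow> ('m, 'x) tangent \<Rightarrow> real) \<Rightarrow>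
      (real \<Rightarrow> 'm \<Rightarrow> real \<Rightarrow> real) \<Rightarrow> ('m \<Rightarrow> real) \<Rightarrow> (real \<Rightarrow> 'm \<Rightarrow> real) \<Rightarrow> bool" where
  "viscosity_supersolution A N H h v \<longleftrightarrow>
     lsc_on ({0..} \<times> UNIV) (\<lambda>(t, x). v t x) \<and>
     (\<forall>t>0. \<forall>x. \<forall>(\<alpha>, \<Delta>)\<in>subdifferential A v t x. \<alpha> + H t x (dual_norm A N x \<Delta>) \<ge> 0) \<and>
     (\<forall>x. v 0 x \<ge> h x)"

definition condition_A ::
    "('m::topological_space, 'x::real_normed_vector) chart set \<Rightarrow> ('m \<Rightarrow> ('m, 'x) tangent \<Rightarrow> real) \<Rightarrow>
      (real \<Rightarrow> 'm \<Rightarrow> real \<Rightarrow> real) \<Rightarrow> bool" where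
  "condition_A A N H \<longleftrightarrow> (\<exists>C\<ge>0. \<exists>\<omega> :: real \<Rightarrow> real \<Rightarrow> real \<Rightarrow> real.
     continuous_on ({0..} \<times> UNIV \<times> UNIV) (\<lambda>(a, b, r). \<omega> a b r) \<and> \<omega> 0 0 0 = 0 \<and>
     (\<forall>t1\<ge>0. \<forall>t2\<ge>0. \<forall>x1 x2 r1 r2.
        \<bar>H t1 x1 r1 - H t2 x2 r2\<bar> \<le>
          \<omega> \<bar>t1 - t2\<bar> (finsler_dist A N x1 x2) (r1 - r2) +
          C * max \<bar>r1\<bar> \<bar>r2\<bar> * (\<bar>t1 - t2\<bar> + finsler_dist A N x1 x2)))"

end

(* If v < u somewhere, add to v - u a function psi(t) with psi' >= delta > 0 that is small at a bad
   point and large at a later time. Since v - u is bounded, Ekeland's principle on the complete metric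
   space [0,T] x M, with a perturbation that is epsilon-Lipschitz for the Finsler metric, yields a
   minimizer (t0,x0) with 0 < t0 < T. In a chart at x0 a fuzzy sum rule then gives
   points close to (t0,x0) at which v and u have a sub- and a superdifferential that nearly agree in the
   space variables and differ by nearly psi' in time. The C1 Lipschitz bump function enters only in this
   local step. The local Lipschitz bound on u or v keeps both differentials bounded, so condition (A)
   makes the difference of the two values of H small, which contradicts psi' >= delta. *)

theory Submission
  imports Defs
begin

section \<open>Continuously differentiable maps\<close>

text \<open>Hence there are two minimizations, one on M with tent functions of the distance and one
  in a chart with smooth bumps. The first leaves a perturbation \<open>g\<close> that is merely
  Lipschitz and so cannot serve as a test function; it becomes a third summand of the fuzzy sum
  rule. That rule needs linear growth at the minimum, which is bought by adding
  \<open>\<epsilon> * q (p - z0)\<close> in the chart. The two differentials are found at different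
  points, hence in different cotangent spaces. Their dual norms are compared through the norm at the
  minimizer, and the (1 + \<eta>)-continuity of the Finsler norm in a chart enters here. The order
  of the constants matters. \<delta> and \<epsilon> are fixed before the minimizer is known, so they
  may not depend on the chart. The Lipschitz constant \<open>L\<close> comes with the minimizer; the
  bound \<Lambda> on the dual norms, the distortion \<eta> and the closeness \<open>e\<close> of the
  points are chosen after it, so that \<open>C * \<Lambda> * (e * M)\<close> is small.\<close>

lemma C1_onI:
  assumes "\<And>x. x \<in> S \<Longrightarrow> (f has_derivative blinfun_apply (f' x)) (at x)"
    "continuous_on S f'"
  shows "C1_on S f"
  using assms unfolding C1_on_def by blast

lemma C1_on_imp_continuous_on: "C1_on S f \<Longrightarrow> continuous_on S f"
  unfolding C1_on_def by (meson continuous_at_imp_continuous_on has_derivative_continuous)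

text \<open>Full derivatives are unique, so all local derivative maps agree with the single one
  built from \<open>frechet_derivative\<close>. This permits gluing a function from two open pieces,
  as needed for test functions extended by zero.\<close>

lemma C1_on_local:
  assumes "\<And>x. x \<in> S \<Longrightarrow> \<exists>T. open T \<and> x \<in> T \<and> C1_on T f"
  shows "C1_on S f"
proof -
  define F where "F x = Blinfun (frechet_derivative f (at x))" for x
  have *: "(f has_derivative blinfun_apply (F x)) (at x) \<and> isCont F x" if x: "x \<in> S" for x
  proof -
    obtain T where T: "open T" "x \<in> T" "C1_on T f" using assms[OF x] by auto
    obtain f' where f': "\<And>x. x \<in> T \<Longrightarrow> (f has_derivative blinfun_apply (f' x)) (at x)"
      "continuous_on T f'" using T(3) unfolding C1_on_def by blast
    have eq: "F y = f' y" if "y \<in> T" for y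
      unfolding F_def frechet_derivative_at[OF f'(1)[OF that], symmetric] by (rule blinfun_apply_inverse)
    have "continuous_on T F" using f'(2) by (rule continuous_on_eq) (simp add: eq)
    then have "isCont F x" using T(2) continuous_on_eq_continuous_at[OF T(1)] by blast
    then show ?thesis using f'(1)[OF T(2)] by (simp only: eq[OF T(2)])
  qed
  show ?thesis
  proof (rule C1_onI)
    show "continuous_on S F" by (rule continuous_at_imp_continuous_on) (simp add: *)
    show "(f has_derivative blinfun_apply (F x)) (at x)" if "x \<in> S" for x
      using *[OF that] by (rule conjunct1)
  qed
qed

lemma C1_on_cong:
  assumes "open S" "\<And>x. x \<in> S \<Longrightarrow> f x = g x" "C1_on S f"
  shows "C1_on S g"
proof -
  obtain f' where f': "\<And>x. x \<in> S \<Longrightarrow> (f has_derivative blinfun_apply (f' x)) (at x)"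
    "continuous_on S f'" using assms(3) unfolding C1_on_def by blast
  show ?thesis
    by (rule C1_onI[OF _ f'(2)])
      (metis assms(1,2) f'(1) has_derivative_transform_within_open)
qed

lemma C1_on_compose:
  assumes "C1_on S f" "C1_on T g" "f ` S \<subseteq> T"
  shows "C1_on S (\<lambda>x. g (f x))"
proof -
  obtain f' where f': "\<And>x. x \<in> S \<Longrightarrow> (f has_derivative blinfun_apply (f' x)) (at x)"
    "continuous_on S f'" using assms(1) unfolding C1_on_def by blast
  obtain g' where g': "\<And>x. x \<in> T \<Longrightarrow> (g has_derivative blinfun_apply (g' x)) (at x)"
    "continuous_on T g'" using assms(2) unfolding C1_on_def by blast
  show ?thesis
  proof (rule C1_onI[of _ _ "\<lambda>x. g' (f x) o\<^sub>L f' x"])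
    fix x assume "x \<in> S"
    then show "((\<lambda>x. g (f x)) has_derivative blinfun_apply (g' (f x) o\<^sub>L f' x)) (at x)"
      using has_derivative_compose[OF f'(1) g'(1)] assms(3) by (auto simp: blinfun_compose.rep_eq o_def)
  next
    show "continuous_on S (\<lambda>x. g' (f x) o\<^sub>L f' x)"
      by (intro continuous_intros f'(2) continuous_on_compose2[OF g'(2) C1_on_imp_continuous_on] assms)
  qed
qed

lemma C1_on_bounded_linear:
  assumes "bounded_linear f" shows "C1_on S f"
  by (rule C1_onI[of _ _ "\<lambda>_. Blinfun f"])
    (auto simp: bounded_linear_Blinfun_apply[OF assms] intro: bounded_linear_imp_has_derivative assms)

lemma C1_on_const: "C1_on S (\<lambda>x. k)"
  by (rule C1_onI[of _ _ "\<lambda>_. 0"]) (auto simp: zero_blinfun.rep_eq)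

lemma C1_on_add:
  assumes "C1_on S f" "C1_on S g"
  shows "C1_on S (\<lambda>x. f x + g x)"
proof -
  obtain f' where f': "\<And>x. x \<in> S \<Longrightarrow> (f has_derivative blinfun_apply (f' x)) (at x)"
    "continuous_on S f'" using assms(1) unfolding C1_on_def by blast
  obtain g' where g': "\<And>x. x \<in> S \<Longrightarrow> (g has_derivative blinfun_apply (g' x)) (at x)"
    "continuous_on S g'" using assms(2) unfolding C1_on_def by blast
  show ?thesis
    by (rule C1_onI[of _ _ "\<lambda>x. f' x + g' x"])
      (auto intro!: continuous_intros f' g' has_derivative_eq_rhs[OF has_derivative_add] simp: blinfun.add_left)
qed

lemma C1_on_diff:
  assumes "C1_on S f" "C1_on S g"
  shows "C1_on S (\<lambda>x. f x - g x :: 'b :: real_normed_vector)"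
proof -
  have "bounded_linear (\<lambda>x :: 'b. - x)" by (intro bounded_linear_minus bounded_linear_ident)
  then have "C1_on S (\<lambda>x. f x + - g x)"
    by (intro C1_on_add assms(1) C1_on_compose[OF assms(2) C1_on_bounded_linear[of _ UNIV]]) auto
  then show ?thesis by simp
qed

lemma C1_on_real:
  fixes g :: "real \<Rightarrow> real"
  assumes "\<And>x. x \<in> S \<Longrightarrow> (g has_real_derivative g' x) (at x)" "continuous_on S g'"
  shows "C1_on S g"
  by (rule C1_onI[of _ _ "\<lambda>x. blinfun_scaleR_left (g' x)"])
    (use assms in \<open>auto simp: has_field_derivative_def mult.commute[of _ "g' _"]
      intro!: bounded_linear.continuous_on[OF bounded_linear_blinfun_scaleR_left]\<close>)

lemma C1_on_Pair:
  assumes "C1_on S f" "C1_on S g"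
  shows "C1_on S (\<lambda>x. (f x, g x))"
proof -
  have l: "bounded_linear (\<lambda>x. (x, 0))" "bounded_linear (\<lambda>y. (0, y))"
    by (auto intro!: bounded_linear_intros bounded_linear_Pair bounded_linear_ident bounded_linear_zero)
  have "C1_on S (\<lambda>x. (f x, 0) + (0, g x))"
    by (intro C1_on_add C1_on_compose[OF assms(1) C1_on_bounded_linear[OF l(1)]]
        C1_on_compose[OF assms(2) C1_on_bounded_linear[OF l(2)]]) auto
  then show ?thesis by simp
qed

lemma C1_on_mult:
  fixes f g :: "'a::real_normed_vector \<Rightarrow> real"
  assumes "C1_on S f" "C1_on S g"
  shows "C1_on S (\<lambda>x. f x * g x)"
proof -
  have "C1_on UNIV (\<lambda>p :: real \<times> real. fst p * snd p)"
  proof (rule C1_onI)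
    show "continuous_on UNIV (\<lambda>p :: real \<times> real. fst p *\<^sub>R Blinfun snd + snd p *\<^sub>R Blinfun fst)"
      by (intro continuous_intros)
    show "((\<lambda>p. fst p * snd p) has_derivative blinfun_apply (fst x *\<^sub>R Blinfun snd + snd x *\<^sub>R Blinfun fst)) (at x)"
      for x :: "real \<times> real"
      by (auto intro!: derivative_eq_intros simp: blinfun.bilinear_simps bounded_linear_Blinfun_apply bounded_linear_fst bounded_linear_snd)
  qed
  from C1_on_compose[OF C1_on_Pair[OF assms] this] show ?thesis by simp
qed

section \<open>Derivatives controlled by increments; series of C1 functions\<close>

text \<open>Along the ray from \<open>z\<close> in direction \<open>h\<close>, homogeneity bounds
  the difference quotients by \<open>q h\<close>, and the bound survives the limit from the
  right.\<close>

lemma has_derivative_bound_homogeneous: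
  fixes G :: "'z::real_normed_vector \<Rightarrow> real"
  assumes D: "(G has_derivative D) (at z)"
    and q: "\<And>t h. 0 < t \<Longrightarrow> q (t *\<^sub>R h) = t * q h"
    and le: "\<forall>\<^sub>F y in nhds z. G y - G z \<le> q (y - z)"
  shows "D h \<le> q h"
proof -
  have lin: "bounded_linear D" using D has_derivative_bounded_linear by blast
  have d: "((\<lambda>t. z + t *\<^sub>R h) has_derivative (\<lambda>t. t *\<^sub>R h)) (at 0)"
    by (auto intro!: derivative_eq_intros)
  have "((\<lambda>t. G (z + t *\<^sub>R h)) has_derivative (\<lambda>t. D (t *\<^sub>R h))) (at 0)"
    using has_derivative_compose[OF d, of G D] D by simp
  then have "((\<lambda>t. G (z + t *\<^sub>R h)) has_real_derivative D h) (at 0)"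
    by (simp add: has_field_derivative_def linear_simps[OF lin] mult.commute[of _ "D h"])
  then have lim: "((\<lambda>t. (G (z + t *\<^sub>R h) - G z) / t) \<longlongrightarrow> D h) (at_right 0)"
    by (auto simp: has_field_derivative_iff intro: filterlim_mono at_le)
  have "((\<lambda>t. z + t *\<^sub>R h) \<longlongrightarrow> z + 0 *\<^sub>R h) (at_right 0)"
    by (intro tendsto_intros)
  then have lim2: "((\<lambda>t. z + t *\<^sub>R h) \<longlongrightarrow> z) (at_right 0)" by simp
  have ev: "\<forall>\<^sub>F t in at_right 0. G (z + t *\<^sub>R h) - G z \<le> q ((z + t *\<^sub>R h) - z)"
    by (rule eventually_compose_filterlim[OF le lim2])
  have "\<forall>\<^sub>F t in at_right (0::real). (G (z + t *\<^sub>R h) - G z) / t \<le> q h"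
    using ev eventually_at_right_less[of 0]
    by eventually_elim (simp add: q divide_le_eq mult.commute)
  then show ?thesis using tendsto_upperbound[OF lim] by simp
qed

text \<open>A one-sided bound on the increments suffices because it applies to \<open>h\<close> and
  to \<open>- h\<close>. In this form a local minimum of w - G passes a Lipschitz bound from w to
  the derivative of the test function G, although w itself need not be differentiable.\<close>

lemma has_derivative_bound_seminorm:
  fixes G :: "'z::real_normed_vector \<Rightarrow> real"
  assumes D: "(G has_derivative D) (at z)"
    and q: "\<And>t h. q (t *\<^sub>R h) = \<bar>t\<bar> * q h"
    and le: "\<forall>\<^sub>F y in nhds z. G y - G z \<le> q (y - z)"
  shows "\<bar>D h\<bar> \<le> q h"
proof -
  have lin: "bounded_linear D" using D has_derivative_bounded_linear by blast
  have "D h \<le> q h" "D (- h) \<le> q (- h)"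
    by (rule has_derivative_bound_homogeneous[OF D _ le]; simp add: q)+
  then show ?thesis using q[of "-1" h] by (simp add: linear_simps[OF lin])
qed

text \<open>The Lipschitz constant of a term bounds the operator norm of its derivative, so the
  M-test makes the series of derivatives converge uniformly in operator norm. This gives both
  termwise differentiation and continuity of the sum of the derivatives.\<close>

lemma C1_on_series:
  fixes f :: "nat \<Rightarrow> 'a::banach \<Rightarrow> real"
  assumes C1: "\<And>n. C1_on UNIV (f n)" and lip: "\<And>n. (M n)-lipschitz_on UNIV (f n)"
    and sM: "summable M" and sf: "\<And>x. summable (\<lambda>n. f n x)"
  shows "C1_on UNIV (\<lambda>x. \<Sum>n. f n x)"
proof -
  have "\<forall>n. \<exists>f'. (\<forall>x. (f n has_derivative blinfun_apply (f' x)) (at x)) \<and> continuous_on UNIV f'"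
    using C1 unfolding C1_on_def by auto
  then obtain f' where f': "\<And>n x. (f n has_derivative blinfun_apply (f' n x)) (at x)"
    and c: "\<And>n. continuous_on UNIV (f' n)" by metis
  have M0: "0 \<le> M n" for n using lip lipschitz_on_nonneg by blast
  have b: "norm (f' n x) \<le> M n" for n x
  proof (rule norm_blinfun_bound[OF M0])
    fix h
    have "\<bar>blinfun_apply (f' n x) h\<bar> \<le> M n * norm h"
    proof (rule has_derivative_bound_seminorm[OF f'])
      show "\<forall>\<^sub>F y in nhds x. f n y - f n x \<le> M n * norm (y - x)"
        using lipschitz_onD[OF lip[of n]]
        by (auto intro!: always_eventually simp: dist_norm dest: abs_le_D1)
    qed auto
    then show "norm (blinfun_apply (f' n x) h) \<le> M n * norm h" by simp
  qed
  have u: "uniform_limit UNIV (\<lambda>n x. \<Sum>i<n. f' i x) (\<lambda>x. \<Sum>i. f' i x) sequentially"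
    using Weierstrass_m_test[of UNIV f' M, OF b sM] by simp
  have cont: "continuous_on UNIV (\<lambda>x. \<Sum>i. f' i x)"
    by (rule uniform_limit_theorem[OF _ u]) (auto intro!: always_eventually continuous_intros c)
  have "\<exists>g. \<forall>x\<in>UNIV. (\<lambda>n. f n x) sums g x \<and>
      (g has_derivative blinfun_apply (\<Sum>i. f' i x)) (at x within UNIV)"
  proof (rule has_derivative_series[where x=0 and f'="\<lambda>n x. blinfun_apply (f' n x)"])
    fix e :: real assume "e > 0"
    then have "\<forall>\<^sub>F n in sequentially. \<forall>x\<in>UNIV. dist (\<Sum>i<n. f' i x) (\<Sum>i. f' i x) < e"
      using u unfolding uniform_limit_iff by blast
    then show "\<forall>\<^sub>F n in sequentially. \<forall>x\<in>UNIV. \<forall>h.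
      norm ((\<Sum>i<n. blinfun_apply (f' i x) h) - blinfun_apply (\<Sum>i. f' i x) h) \<le> e * norm h"
    proof eventually_elim
      case (elim n)
      show ?case
      proof (intro ballI allI)
        fix x h
        have "norm (blinfun_apply ((\<Sum>i<n. f' i x) - (\<Sum>i. f' i x)) h)
            \<le> norm ((\<Sum>i<n. f' i x) - (\<Sum>i. f' i x)) * norm h" by (rule norm_blinfun)
        also have "\<dots> \<le> e * norm h"
          using elim by (intro mult_right_mono) (auto simp: dist_norm less_imp_le)
        finally show "norm ((\<Sum>i<n. blinfun_apply (f' i x) h) - blinfun_apply (\<Sum>i. f' i x) h) \<le> e * norm h"
          by (simp add: blinfun.bilinear_simps)
      qed
    qed
  qed (use f' sf in \<open>auto simp: summable_sums\<close>)
  then obtain g where g: "\<And>x. (\<lambda>n. f n x) sums g x"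
    "\<And>x. (g has_derivative blinfun_apply (\<Sum>i. f' i x)) (at x)" by auto
  have "g = (\<lambda>x. \<Sum>n. f n x)" using g(1) by (auto simp: sums_iff)
  then show ?thesis using g(2) cont by (intro C1_onI[of _ _ "\<lambda>x. \<Sum>i. f' i x"]) auto
qed

section \<open>Bump functions\<close>

text \<open>A given bump may have any sign, height and position. The normalized form, with peak 1 at
  the origin and values in [0,1], can be rescaled and used both as a coupling penalty and as a
  perturbation.\<close>

definition smooth_bump :: "('z::real_normed_vector \<Rightarrow> real) \<Rightarrow> real \<Rightarrow> bool" where
  "smooth_bump B R \<longleftrightarrow> C1_on UNIV B \<and> (\<exists>L. L-lipschitz_on UNIV B) \<and> (\<forall>z. 0 \<le> B z \<and> B z \<le> 1) \<and>
     B 0 = 1 \<and> R > 0 \<and> (\<forall>z. R \<le> norm z \<longrightarrow> B z = 0)"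

lemma smooth_bumpD:
  assumes "smooth_bump B R"
  shows "0 \<le> B x" "B x \<le> 1" "B 0 = 1" "0 < R" "C1_on UNIV B" "R \<le> norm x \<Longrightarrow> B x = 0"
  using assms unfolding smooth_bump_def by blast+

text \<open>Squaring removes the corner of the positive part. The resulting C1 truncation serves the
  bump on the real line and the cut-off of test functions.\<close>

lemma DERIV_square_pos: "((\<lambda>x::real. (max 0 x)\<^sup>2) has_real_derivative 2 * max 0 x) (at x)"
proof -
  consider "x < 0" | "x = 0" | "x > 0" by linarith
  then show ?thesis
  proof cases
    case 1
    have "((\<lambda>x::real. 0) has_real_derivative 0) (at x)" by simp
    then have "((\<lambda>x. (max 0 x)\<^sup>2) has_real_derivative 0) (at x)"
      by (rule has_field_derivative_transform_within_open[where S="{..<0}"]) (use 1 in auto)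
    then show ?thesis using 1 by simp
  next
    case 3
    have "((\<lambda>x::real. x\<^sup>2) has_real_derivative 2 * x) (at x)" by (auto intro!: derivative_eq_intros)
    then have "((\<lambda>x. (max 0 x)\<^sup>2) has_real_derivative 2 * x) (at x)"
      by (rule has_field_derivative_transform_within_open[where S="{0<..}"]) (use 3 in auto)
    then show ?thesis using 3 by simp
  next
    case 2
    have "((\<lambda>h. ((max 0 (0 + h))\<^sup>2 - (max 0 0)\<^sup>2) / h) \<longlongrightarrow> (0::real)) (at 0)"
    proof (rule tendsto_0_le[where K=1])
      show "((\<lambda>h::real. h) \<longlongrightarrow> 0) (at 0)" by (rule tendsto_ident_at)
      show "\<forall>\<^sub>F h::real in at 0. norm (((max 0 (0 + h))\<^sup>2 - (max 0 0)\<^sup>2) / h) \<le> norm h * 1"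
        by (intro always_eventually) (auto simp: max_def power2_eq_square)
    qed
    then show ?thesis using 2 by (simp add: DERIV_def)
  qed
qed

lemma C1_on_square_pos: "C1_on S (\<lambda>x::real. (max 0 x)\<^sup>2)"
  by (rule C1_on_real[OF DERIV_square_pos]) (intro continuous_intros)

text \<open>The local argument runs in \<open>real \<times> 'x\<close>, so the time axis needs its
  own bump. The derivative of the chosen one is -4 t max(0, 1 - t^2), which vanishes for |t| > 1;
  hence the Lipschitz constant 4.\<close>

lemma smooth_bump_real: "\<exists>B :: real \<Rightarrow> real. smooth_bump B 1"
proof -
  define B where "B t = (max 0 (1 - t\<^sup>2))\<^sup>2" for t :: real
  have B': "(B has_real_derivative 2 * max 0 (1 - t\<^sup>2) * (- 2 * t)) (at t)" for t
    unfolding B_def[abs_def]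
    by (rule DERIV_chain2[OF DERIV_square_pos]) (auto intro!: derivative_eq_intros)
  have c: "C1_on UNIV B" by (rule C1_on_real[OF B']) (intro continuous_intros)
  have l: "4-lipschitz_on UNIV B"
  proof (rule lipschitz_onI)
    have "\<bar>2 * max 0 (1 - t\<^sup>2) * (- 2 * t)\<bar> \<le> 4" for t :: real
    proof (cases "\<bar>t\<bar> \<le> 1")
      case True
      then have "max 0 (1 - t\<^sup>2) * \<bar>t\<bar> \<le> 1 * 1" by (intro mult_mono) auto
      then show ?thesis by (simp add: abs_mult)
    next
      case False
      then have "1 - t\<^sup>2 \<le> 0" by (simp add: abs_square_le_1[symmetric] linear)
      then show ?thesis by simp
    qed
    then show "dist (B s) (B t) \<le> 4 * dist s t" for s t
      using field_differentiable_bound[of UNIV B "\<lambda>t. 2 * max 0 (1 - t\<^sup>2) * (- 2 * t)" 4 s t] B'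
      by (auto simp: dist_norm)
  qed simp
  have "smooth_bump B 1"
    unfolding smooth_bump_def
  proof (intro conjI allI impI)
    show "\<exists>L. L-lipschitz_on UNIV B" using l by blast
    fix z :: real
    show "B z \<le> 1" unfolding B_def by (rule power_le_one) auto
    show "B z = 0" if "1 \<le> norm z" using that abs_square_le_1[of z] abs_square_eq_1[of z]
      by (cases "\<bar>z\<bar> = 1") (auto simp: B_def max_def)
  qed (use c in \<open>auto simp: B_def\<close>)
  then show ?thesis by blast
qed

text \<open>The radii add because a pair of norm at least \<open>R + R'\<close> has a component
  beyond its own radius; the Lipschitz constants add because each factor is bounded by 1.\<close>

lemma smooth_bump_Pair:
  fixes B :: "'a::real_normed_vector \<Rightarrow> real" and B' :: "'b::real_normed_vector \<Rightarrow> real"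
  assumes "smooth_bump B R" "smooth_bump B' R'"
  shows "smooth_bump (\<lambda>(x, y). B x * B' y) (R + R')"
proof -
  obtain L L' where L: "L-lipschitz_on UNIV B" "L'-lipschitz_on UNIV B'"
    using assms by (auto simp: smooth_bump_def)
  have b: "0 \<le> B x" "B x \<le> 1" "0 \<le> B' y" "B' y \<le> 1" for x y
    using assms by (auto simp: smooth_bump_def)
  have l: "(L + L')-lipschitz_on UNIV (\<lambda>(x, y). B x * B' y)"
  proof (rule lipschitz_onI)
    show "0 \<le> L + L'" using L lipschitz_on_nonneg by (metis add_nonneg_nonneg)
    fix z w :: "'a \<times> 'b"
    obtain x y x' y' where zw: "z = (x, y)" "w = (x', y')" by (metis surj_pair)
    have "\<bar>B x * B' y - B x' * B' y'\<bar> = \<bar>(B x - B x') * B' y + B x' * (B' y - B' y')\<bar>"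
      by (simp add: algebra_simps)
    also have "\<dots> \<le> \<bar>(B x - B x') * B' y\<bar> + \<bar>B x' * (B' y - B' y')\<bar>" by linarith
    also have "\<dots> \<le> \<bar>B x - B x'\<bar> + \<bar>B' y - B' y'\<bar>"
      using b by (intro add_mono) (auto simp: abs_mult intro: mult_left_le mult_left_le_one_le)
    also have "\<dots> \<le> L * dist x x' + L' * dist y y'"
      using lipschitz_onD[OF L(1)] lipschitz_onD[OF L(2)] by (auto simp: dist_real_def intro!: add_mono)
    also have "\<dots> \<le> L * dist z w + L' * dist z w"
      using dist_fst_le[of z w] dist_snd_le[of z w] lipschitz_on_nonneg[OF L(1)] lipschitz_on_nonneg[OF L(2)]
      by (auto simp: zw intro!: add_mono mult_left_mono)
    finally show "dist (case z of (x, y) \<Rightarrow> B x * B' y) (case w of (x, y) \<Rightarrow> B x * B' y) \<le> (L + L') * dist z w"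
      by (simp add: zw dist_real_def algebra_simps)
  qed
  have "C1_on UNIV (\<lambda>z. B (fst z) * B' (snd z))"
    by (intro C1_on_mult C1_on_compose[OF C1_on_bounded_linear[OF bounded_linear_fst], of UNIV]
      C1_on_compose[OF C1_on_bounded_linear[OF bounded_linear_snd], of UNIV])
      (use assms in \<open>auto simp: smooth_bump_def\<close>)
  moreover have "B x * B' y = 0" if "R + R' \<le> norm (x, y)" for x y
  proof -
    have "R \<le> norm x \<or> R' \<le> norm y" using norm_Pair_le[of x y] that by linarith
    then show ?thesis using assms by (auto simp: smooth_bump_def)
  qed
  ultimately show ?thesis using l assms b
    by (auto simp: smooth_bump_def case_prod_unfold intro: mult_le_one)
qed

lemma smooth_bump_if_C1_Lipschitz_bump:
  fixes b :: "'x::real_normed_vector \<Rightarrow> real"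
  assumes "C1_Lipschitz_bump b"
  shows "\<exists>B R. smooth_bump (B :: 'x \<Rightarrow> real) R"
proof -
  have c1: "C1_on UNIV b" and bd: "bounded {x. b x \<noteq> 0}" and ne: "{x. b x \<noteq> 0} \<noteq> {}"
    using assms bounded_subset[OF _ closure_subset] by (auto simp: C1_Lipschitz_bump_def)
  obtain L where L: "L-lipschitz_on UNIV b" using assms by (auto simp: C1_Lipschitz_bump_def)
  obtain a where a: "b a \<noteq> 0" using ne by auto
  obtain K where K: "\<And>x. b x \<noteq> 0 \<Longrightarrow> norm x \<le> K" using bd by (auto simp: bounded_iff)
  \<comment> \<open>The summand 1 gives a strict inequality: \<open>R \<le> norm x\<close> puts a +
    x strictly beyond \<open>K\<close>, hence where \<open>b\<close> vanishes.\<close>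
  define R where "R = K + norm a + 1"
  have R: "R > 0" using K[OF a] norm_ge_zero[of a] unfolding R_def by linarith
  \<comment> \<open>Recentring at \<open>a\<close> and scaling by pi / (2 b(a)) makes the argument
    of the sine pi / 2 at the origin. The squared sine takes care of sign and height and keeps the
    zeros of \<open>b\<close>.\<close>
  define B where "B x = (sin (pi / 2 / b a * b (a + x)))\<^sup>2" for x
  have sc: "C1_on UNIV (\<lambda>t::real. (sin t)\<^sup>2)"
    by (rule C1_on_real[where g'="\<lambda>t. 2 * sin t * cos t"]) (auto intro!: derivative_eq_intros continuous_intros)
  have "C1_on UNIV (\<lambda>x. b (a + x))"
    by (rule C1_on_compose[OF C1_on_add[OF C1_on_const C1_on_bounded_linear[OF bounded_linear_ident]] c1]) auto
  then have "C1_on UNIV (\<lambda>x. pi / 2 / b a * b (a + x))" by (intro C1_on_mult C1_on_const)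
  then have C: "C1_on UNIV B" unfolding B_def by (rule C1_on_compose[OF _ sc]) auto
  have sl: "\<bar>(sin s)\<^sup>2 - (sin t)\<^sup>2\<bar> \<le> \<bar>s - t\<bar>" for s t :: real
  proof -
    have "(sin s)\<^sup>2 - (sin t)\<^sup>2 = sin (s + t) * sin (s - t)"
    proof -
      have "sin (s + t) * sin (s - t) = (sin s)\<^sup>2 * (cos t)\<^sup>2 - (cos s)\<^sup>2 * (sin t)\<^sup>2"
        by (simp add: sin_add sin_diff power2_eq_square algebra_simps)
      also have "\<dots> = (sin s)\<^sup>2 - (sin t)\<^sup>2" by (simp add: cos_squared_eq algebra_simps)
      finally show ?thesis by simp
    qed
    then have "\<bar>(sin s)\<^sup>2 - (sin t)\<^sup>2\<bar> = \<bar>sin (s + t)\<bar> * \<bar>sin (s - t)\<bar>" by (simp add: abs_mult)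
    also have "\<dots> \<le> 1 * \<bar>s - t\<bar>"
      by (intro mult_mono abs_sin_le_one abs_sin_x_le_abs_x) auto
    finally show ?thesis by simp
  qed
  have L': "(\<bar>pi / 2 / b a\<bar> * L)-lipschitz_on UNIV B"
  proof (rule lipschitz_onI)
    show "0 \<le> \<bar>pi / 2 / b a\<bar> * L" using lipschitz_on_nonneg[OF L] by simp
    fix x y
    have "dist (B x) (B y) \<le> \<bar>pi / 2 / b a * b (a + x) - pi / 2 / b a * b (a + y)\<bar>"
      unfolding B_def dist_real_def by (rule sl)
    also have "\<dots> = \<bar>pi / 2 / b a\<bar> * dist (b (a + x)) (b (a + y))"
      by (simp only: dist_real_def abs_mult[symmetric] right_diff_distrib)
    also have "\<dots> \<le> \<bar>pi / 2 / b a\<bar> * (L * dist (a + x) (a + y))"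
      by (intro mult_left_mono lipschitz_onD[OF L]) auto
    finally show "dist (B x) (B y) \<le> \<bar>pi / 2 / b a\<bar> * L * dist x y" by simp
  qed
  have "B x = 0" if "R \<le> norm x" for x
  proof -
    have "norm x \<le> norm (a + x) + norm a" using norm_triangle_ineq4[of "a + x" a] by simp
    then have "\<not> norm (a + x) \<le> K" using that unfolding R_def by linarith
    then have "b (a + x) = 0" using K by blast
    then show ?thesis by (simp add: B_def)
  qed
  then have "smooth_bump B R"
    using C L' R a by (auto simp: smooth_bump_def B_def abs_square_le_1)
  then show ?thesis by blast
qed

section \<open>Perturbed minimization\<close>

text \<open>The minimization below tests lower semicontinuity only along the one sequence it
  constructs, so the sequential form is enough; it is stable under sums and under composition with
  continuous maps.\<close>

definition seq_lsc :: "'a::topological_space set \<Rightarrow> ('a \<Rightarrow> real) \<Rightarrow> bool" where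
  "seq_lsc S f \<longleftrightarrow> (\<forall>\<sigma> z. (\<forall>n. \<sigma> n \<in> S) \<longrightarrow> z \<in> S \<longrightarrow> \<sigma> \<longlonglongrightarrow> z \<longrightarrow>
     (\<forall>y<f z. \<forall>\<^sub>F n in sequentially. y < f (\<sigma> n)))"

lemma seq_lscD:
  "seq_lsc S f \<Longrightarrow> (\<And>n. \<sigma> n \<in> S) \<Longrightarrow> z \<in> S \<Longrightarrow> \<sigma> \<longlonglongrightarrow> z \<Longrightarrow> y < f z \<Longrightarrow> \<forall>\<^sub>F n in sequentially. y < f (\<sigma> n)"
  unfolding seq_lsc_def by blast

lemma seq_lsc_lsc_on:
  assumes "lsc_on S f" shows "seq_lsc S f"
  unfolding seq_lsc_def
proof (intro allI impI)
  fix \<sigma> z y assume a: "\<forall>n. \<sigma> n \<in> S" "z \<in> S" "\<sigma> \<longlonglongrightarrow> z" "y < f z"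
  then have "\<forall>\<^sub>F w in at z within S. y < f w" using assms by (auto simp: lsc_on_def)
  then obtain U where U: "open U" "z \<in> U" "\<And>w. w \<in> U \<Longrightarrow> w \<noteq> z \<Longrightarrow> w \<in> S \<Longrightarrow> y < f w"
    unfolding eventually_at_topological by blast
  have "\<forall>\<^sub>F n in sequentially. \<sigma> n \<in> U" using a(3) U(1,2) by (rule topological_tendstoD)
  then show "\<forall>\<^sub>F n in sequentially. y < f (\<sigma> n)"
    by eventually_elim (use U(3) a in metis)
qed

lemma seq_lsc_continuous_on:
  assumes "continuous_on S f" shows "seq_lsc S f"
  unfolding seq_lsc_def
proof (intro allI impI)
  fix \<sigma> z y assume a: "\<forall>n. \<sigma> n \<in> S" "z \<in> S" "\<sigma> \<longlonglongrightarrow> z" "y < f z"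
  then have "(\<lambda>n. f (\<sigma> n)) \<longlonglongrightarrow> f z"
    by (intro continuous_on_tendsto_compose[OF assms]) (auto intro: always_eventually)
  then show "\<forall>\<^sub>F n in sequentially. y < f (\<sigma> n)" using a(4) by (rule order_tendstoD)
qed

lemma seq_lsc_add:
  assumes f: "seq_lsc S f" and g: "seq_lsc S g" shows "seq_lsc S (\<lambda>x. f x + g x)"
  unfolding seq_lsc_def
proof (intro allI impI)
  fix \<sigma> z y assume a: "\<forall>n. \<sigma> n \<in> S" "z \<in> S" "\<sigma> \<longlonglongrightarrow> z" "y < f z + g z"
  define r where "r = (f z + g z - y) / 2"
  have "r > 0" using a(4) by (simp add: r_def)
  then have "\<forall>\<^sub>F n in sequentially. f z - r < f (\<sigma> n)" "\<forall>\<^sub>F n in sequentially. g z - r < g (\<sigma> n)"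
    using seq_lscD[OF f _ a(2,3)] seq_lscD[OF g _ a(2,3)] a(1) by auto
  then show "\<forall>\<^sub>F n in sequentially. y < f (\<sigma> n) + g (\<sigma> n)"
    by eventually_elim (simp add: r_def field_simps)
qed

lemma seq_lsc_compose:
  assumes f: "seq_lsc S f" and h: "continuous_on T h" "h ` T \<subseteq> S"
  shows "seq_lsc T (\<lambda>x. f (h x))"
  unfolding seq_lsc_def
proof (intro allI impI)
  fix \<sigma> z y assume a: "\<forall>n. \<sigma> n \<in> T" "z \<in> T" "\<sigma> \<longlonglongrightarrow> z" "y < f (h z)"
  have "(\<lambda>n. h (\<sigma> n)) \<longlonglongrightarrow> h z"
    using a by (intro continuous_on_tendsto_compose[OF h(1)]) (auto intro: always_eventually)
  then show "\<forall>\<^sub>F n in sequentially. y < f (h (\<sigma> n))"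
    using a h(2) by (intro seq_lscD[OF f]) auto
qed

text \<open>Stated for a bare function \<open>d\<close>, because it is applied both to the metric of
  a normed space and to the Finsler distance, which is not the metric of a type class. The
  difference 2 C / 2^m - 2 C / 2^n is the exact sum of the steps from m to n.\<close>

lemma geometric_Cauchy:
  fixes d :: "'a \<Rightarrow> 'a \<Rightarrow> real"
  assumes tri: "\<And>x y z. d x z \<le> d x y + d y z" and refl: "\<And>x. d x x = 0" and sym: "\<And>x y. d x y = d y x"
    and step: "\<And>k. d (\<sigma> k) (\<sigma> (Suc k)) \<le> C / 2 ^ k" and C: "0 \<le> C" and e: "0 < e"
  shows "\<exists>N. \<forall>m\<ge>N. \<forall>n\<ge>N. d (\<sigma> m) (\<sigma> n) < e"
proof -
  obtain N where N: "2 * C / e < 2 ^ N" using real_arch_pow[of 2] by auto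
  have le: "d (\<sigma> m) (\<sigma> n) < e" if "N \<le> m" "m \<le> n" for m n
  proof -
    have "d (\<sigma> m) (\<sigma> n) \<le> 2 * C / 2 ^ m - 2 * C / 2 ^ n"
      using that(2)
    proof (induction n rule: dec_induct)
      case (step n)
      have "d (\<sigma> m) (\<sigma> (Suc n)) \<le> d (\<sigma> m) (\<sigma> n) + C / 2 ^ n"
        using tri[of "\<sigma> m" "\<sigma> (Suc n)" "\<sigma> n"] assms(4)[of n] by linarith
      also have "\<dots> \<le> 2 * C / 2 ^ m - 2 * C / 2 ^ n + C / 2 ^ n" using step.IH by simp
      also have "\<dots> = 2 * C / 2 ^ m - 2 * C / 2 ^ Suc n" by (simp add: field_simps)
      finally show ?case .
    qed (simp add: refl)
    also have "\<dots> \<le> 2 * C / 2 ^ m" using C by simp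
    also have "\<dots> \<le> 2 * C / 2 ^ N" using C that by (intro divide_left_mono) (auto intro: power_increasing)
    also have "\<dots> < e" using N e by (simp add: field_simps)
    finally show ?thesis .
  qed
  then have "d (\<sigma> m) (\<sigma> n) < e" if "N \<le> m" "N \<le> n" for m n
    using that le[of m n] le[of n m] sym[of "\<sigma> m" "\<sigma> n"] by (cases "m \<le> n") auto
  then show ?thesis by blast
qed

text \<open>A topological form of the variational principles of Ekeland (take \<open>\<beta>\<close> to be tent functions)
  and of Deville, Godefroy and Zizler (take \<open>\<beta>\<close> to be \<open>C\<^sup>1\<close> bumps). Subtracting
  \<open>c\<^sub>k \<beta>\<^sub>k\<close> at a point which is \<open>c\<^sub>k\<close>-minimal
  forces the next almost minimal point into the support of \<open>\<beta>\<^sub>k\<close>.\<close>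

lemma perturbed_minimum:
  fixes f :: "'a::topological_space \<Rightarrow> real" and \<beta> :: "nat \<Rightarrow> 'a \<Rightarrow> 'a \<Rightarrow> real"
  assumes ne: "S \<noteq> {}" and lsc: "seq_lsc S f" and bdd: "bdd_below (f ` S)"
    and \<beta>: "\<And>k z y. 0 \<le> \<beta> k z y" "\<And>k z y. \<beta> k z y \<le> 1" "\<And>k z. \<beta> k z z = 1"
    and cont: "\<And>k z. z \<in> S \<Longrightarrow> continuous_on S (\<beta> k z)"
    and conv: "\<And>\<sigma>. (\<And>k. \<sigma> k \<in> S) \<Longrightarrow> (\<And>k. 0 < \<beta> k (\<sigma> k) (\<sigma> (Suc k))) \<Longrightarrow> \<exists>x\<in>S. \<sigma> \<longlonglongrightarrow> x"
    and c: "\<And>k. 0 < c k" "summable c"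
  obtains \<sigma> x where "\<And>k. \<sigma> k \<in> S" "x \<in> S"
    "\<And>y. y \<in> S \<Longrightarrow> f x - (\<Sum>k. c k * \<beta> k (\<sigma> k) x) \<le> f y - (\<Sum>k. c k * \<beta> k (\<sigma> k) y)"
proof -
  \<comment> \<open>The state of the recursion is the function \<open>g\<close> after the
    subtractions made so far, with a point \<open>z\<close> that is \<open>c k\<close>-minimal for
    it. \<open>Q\<close> also asks the new value to lie below the old infimum; this is what forces
    \<beta> to be positive at the next point.\<close>
  define P where "P = (\<lambda>k (g :: 'a \<Rightarrow> real, z). z \<in> S \<and> bdd_below (g ` S) \<and> g z < Inf (g ` S) + c k \<and>
    (k = 0 \<longrightarrow> g = f))"
  define Q where "Q = (\<lambda>k (g :: 'a \<Rightarrow> real, z) (g', z'). g' = (\<lambda>y. g y - c k * \<beta> k z y) \<and> g' z' < Inf (g ` S))"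
  have cb: "0 \<le> c k * \<beta> k z y" "c k * \<beta> k z y \<le> c k" for k z y
    using c(1)[of k] \<beta>(1,2)[of k z y] by (auto simp: mult_left_le)
  have "\<exists>p. P 0 p"
  proof -
    have "Inf (f ` S) < Inf (f ` S) + c 0" using c by simp
    then obtain z where "z \<in> S" "f z < Inf (f ` S) + c 0"
      using cInf_lessD[of "f ` S"] ne by blast
    then show ?thesis using bdd by (intro exI[of _ "(f, z)"]) (simp add: P_def)
  qed
  moreover have "\<exists>p'. P (Suc k) p' \<and> Q k p p'" if Pk: "P k p" for k p
  proof -
    obtain g z where p: "p = (g, z)" by (metis surj_pair)
    have z: "z \<in> S" "bdd_below (g ` S)" "g z < Inf (g ` S) + c k" using Pk by (auto simp: P_def p)
    define g' where "g' = (\<lambda>y. g y - c k * \<beta> k z y)"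
    have "Inf (g ` S) - c k \<le> g' y" if "y \<in> S" for y
      using cINF_lower[OF z(2) that] cb(2)[of k z y] by (simp add: g'_def)
    then have b: "bdd_below (g' ` S)" by (meson bdd_belowI2)
    have "Inf (g' ` S) \<le> g' z" by (rule cINF_lower[OF b z(1)])
    \<comment> \<open>Since \<beta> is 1 at its centre, the subtraction lowers the value at
      \<open>z\<close> by the full \<open>c k\<close>, which is more than its excess over the old
      infimum. Hence a point below that infimum exists.\<close>
    then have "Inf (g' ` S) < Inf (g ` S)" using z(3) by (simp add: g'_def \<beta>)
    then have "Inf (g' ` S) < min (Inf (g ` S)) (Inf (g' ` S) + c (Suc k))" using c by simp
    then obtain z' where "z' \<in> S" "g' z' < min (Inf (g ` S)) (Inf (g' ` S) + c (Suc k))"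
      using cInf_lessD[of "g' ` S"] ne by blast
    then show ?thesis using b
      by (intro exI[of _ "(g', z')"]) (simp add: P_def Q_def p g'_def)
  qed
  ultimately obtain F where F: "\<And>k. P k (F k)" "\<And>k. Q k (F k) (F (Suc k))"
    using dependent_nat_choice[of P Q] by blast
  define g \<sigma> where "g k = fst (F k)" and "\<sigma> k = snd (F k)" for k
  have Feq: "F k = (g k, \<sigma> k)" for k by (simp add: g_def \<sigma>_def)
  have S: "\<sigma> k \<in> S" and bdg: "bdd_below (g k ` S)" and near: "g k (\<sigma> k) < Inf (g k ` S) + c k"
    and g0: "g 0 = f" for k
    using F(1)[of k] F(1)[of 0] unfolding Feq P_def by auto
  have gS: "g (Suc k) = (\<lambda>y. g k y - c k * \<beta> k (\<sigma> k) y)" and dec: "g (Suc k) (\<sigma> (Suc k)) < Inf (g k ` S)" for k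
    using F(2)[of k] unfolding Feq Q_def by auto
  have g: "g k y = f y - (\<Sum>j<k. c j * \<beta> j (\<sigma> j) y)" for k y
    by (induction k) (auto simp: g0 gS)
  have pos: "0 < \<beta> k (\<sigma> k) (\<sigma> (Suc k))" for k
  proof -
    have "g (Suc k) (\<sigma> (Suc k)) < g k (\<sigma> (Suc k))"
      using dec[of k] cINF_lower[OF bdg[of k] S[of "Suc k"]] by linarith
    then have "0 < c k * \<beta> k (\<sigma> k) (\<sigma> (Suc k))" by (simp add: gS)
    then have "\<beta> k (\<sigma> k) (\<sigma> (Suc k)) \<noteq> 0" by auto
    then show ?thesis using \<beta>(1)[of k "\<sigma> k" "\<sigma> (Suc k)"] by (auto simp: less_le)
  qed
  obtain x where x: "x \<in> S" "\<sigma> \<longlonglongrightarrow> x" using conv S pos by blast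
  define p where "p y = (\<Sum>k. c k * \<beta> k (\<sigma> k) y)" for y
  have sm: "summable (\<lambda>k. c k * \<beta> k (\<sigma> k) y)" for y
    by (rule summable_comparison_test'[OF c(2), of 0]) (use cb in auto)
  have u: "uniform_limit S (\<lambda>n y. \<Sum>k<n. c k * \<beta> k (\<sigma> k) y) p sequentially"
    unfolding p_def by (rule Weierstrass_m_test[OF _ c(2)]) (use cb in auto)
  have "continuous_on S p"
    by (rule uniform_limit_theorem[OF _ u]) (auto intro!: always_eventually continuous_intros cont S)
  then have lscG: "seq_lsc S (\<lambda>y. f y + (- p y))"
    by (intro seq_lsc_add lsc seq_lsc_continuous_on continuous_intros)
  have "f x - p x \<le> f y - p y" if y: "y \<in> S" for y
  proof (rule ccontr)
    assume "\<not> f x - p x \<le> f y - p y"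
    then obtain q where q: "f y - p y < q" "q < f x - p x" by (meson dense not_le)
    have ev1: "\<forall>\<^sub>F n in sequentially. q < f (\<sigma> n) + (- p (\<sigma> n))"
      by (rule seq_lscD[OF lscG S x]) (use q in simp)
    \<comment> \<open>The full sum dominates its partial sums, and \<open>\<sigma> n\<close> is
      \<open>c n\<close>-minimal for the partially perturbed function. The right-hand side tends to
      f y - p y < q, while lower semicontinuity keeps the left-hand side above q.\<close>
    have le: "f (\<sigma> n) - p (\<sigma> n) < f y - (\<Sum>j<n. c j * \<beta> j (\<sigma> j) y) + c n" for n
    proof -
      have "(\<Sum>j<n. c j * \<beta> j (\<sigma> j) (\<sigma> n)) \<le> p (\<sigma> n)"
        unfolding p_def by (rule sum_le_suminf[OF sm]) (use cb in auto)
      then have "f (\<sigma> n) - p (\<sigma> n) \<le> g n (\<sigma> n)" by (simp add: g)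
      also have "\<dots> < g n y + c n" using near[of n] cINF_lower[OF bdg[of n] y] by linarith
      finally show ?thesis by (simp add: g)
    qed
    have "(\<lambda>n. f y - (\<Sum>j<n. c j * \<beta> j (\<sigma> j) y) + c n) \<longlonglongrightarrow> f y - p y + 0"
      unfolding p_def by (intro tendsto_intros summable_LIMSEQ sm summable_LIMSEQ_zero c)
    then have "\<forall>\<^sub>F n in sequentially. f y - (\<Sum>j<n. c j * \<beta> j (\<sigma> j) y) + c n < q"
      using q(1) by (intro order_tendstoD) simp_all
    with ev1 have "\<forall>\<^sub>F n in sequentially. False"
    proof eventually_elim
      case (elim n)
      then show ?case using le[of n] by linarith
    qed
    then show False by simp
  qed
  then show ?thesis using that[of \<sigma> x] S x(1) unfolding p_def by blast
qed

section \<open>A fuzzy sum rule\<close>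

lemma C1_on_affine:
  fixes f :: "'b::real_normed_vector \<Rightarrow> 'c::real_normed_vector"
  assumes "C1_on UNIV f" "bounded_linear l" shows "C1_on UNIV (\<lambda>x. f (a + l x))"
  by (rule C1_on_compose[OF C1_on_add[OF C1_on_const C1_on_bounded_linear[OF assms(2)]] assms(1)]) auto

text \<open>Weights a / 4^k against dilations by 2^k: the Lipschitz constants a L / 2^k add up to 2
  a L and the heights to 4 a / 3, while the supports still shrink geometrically. The perturbation is
  therefore small both in value and in derivative.\<close>

lemma smooth_bump_series:
  fixes B :: "'z::banach \<Rightarrow> real"
  assumes B: "smooth_bump B R" and L: "L-lipschitz_on UNIV B" and a: "0 < a"
  shows "C1_on UNIV (\<lambda>z. \<Sum>k. a / 4 ^ k * B (2 ^ k *\<^sub>R (z - \<sigma> k)))" (is "C1_on UNIV ?p")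
    and "(2 * a * L)-lipschitz_on UNIV (\<lambda>z. \<Sum>k. a / 4 ^ k * B (2 ^ k *\<^sub>R (z - \<sigma> k)))"
    and "0 \<le> (\<Sum>k. a / 4 ^ k * B (2 ^ k *\<^sub>R (z - \<sigma> k)))"
    and "(\<Sum>k. a / 4 ^ k * B (2 ^ k *\<^sub>R (z - \<sigma> k))) \<le> 2 * a"
proof -
  have L0: "0 \<le> L" using lipschitz_on_nonneg[OF L] .
  have b: "0 \<le> B x" "B x \<le> 1" for x using smooth_bumpD[OF B] by auto
  define t where "t k z = a / 4 ^ k * B (2 ^ k *\<^sub>R (z - \<sigma> k))" for k z
  have sa: "(\<lambda>k. a / 4 ^ k) sums (a * (4 / 3))"
    using sums_mult[OF geometric_sums[of "1 / 4 :: real"], of a] by (simp add: power_divide)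
  have tb: "0 \<le> t k z" "t k z \<le> a / 4 ^ k" for k z
    using b a mult_left_le[of "B (2 ^ k *\<^sub>R (z - \<sigma> k))" "a / 4 ^ k"] by (auto simp: t_def)
  have st: "summable (\<lambda>k. t k z)" for z
    by (rule summable_comparison_test'[OF sums_summable[OF sa], of 0]) (use tb in auto)
  have lt: "(a * L * (1 / 2) ^ k)-lipschitz_on UNIV (t k)" for k
  proof (rule lipschitz_onI)
    show "0 \<le> a * L * (1 / 2) ^ k" using a L0 by simp
    fix x y
    have "t k x - t k y = a / 4 ^ k * (B (2 ^ k *\<^sub>R (x - \<sigma> k)) - B (2 ^ k *\<^sub>R (y - \<sigma> k)))"
      unfolding t_def by (rule right_diff_distrib[symmetric])
    then have "dist (t k x) (t k y) = a / 4 ^ k * dist (B (2 ^ k *\<^sub>R (x - \<sigma> k))) (B (2 ^ k *\<^sub>R (y - \<sigma> k)))"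
      using a by (simp add: dist_real_def abs_mult)
    also have "\<dots> \<le> a / 4 ^ k * (L * dist (2 ^ k *\<^sub>R (x - \<sigma> k)) (2 ^ k *\<^sub>R (y - \<sigma> k)))"
      using a by (intro mult_left_mono lipschitz_onD[OF L]) auto
    also have "dist (2 ^ k *\<^sub>R (x - \<sigma> k)) (2 ^ k *\<^sub>R (y - \<sigma> k)) = 2 ^ k * dist x y"
      by (simp add: dist_norm flip: scaleR_right_diff_distrib)
    also have "a / 4 ^ k * (L * (2 ^ k * dist x y)) = a * L * (1 / 2) ^ k * dist x y"
      by (simp add: power_divide field_simps flip: power_mult_distrib)
    finally show "dist (t k x) (t k y) \<le> a * L * (1 / 2) ^ k * dist x y" .
  qed
  have sL: "(\<lambda>k. a * L * (1 / 2) ^ k) sums (2 * a * L)"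
    using sums_mult[OF geometric_sums[of "1 / 2 :: real"], of "a * L"] by (simp add: mult_ac)
  have c1: "C1_on UNIV (t k)" for k
  proof -
    have "t k = (\<lambda>z. a / 4 ^ k * B (- (2 ^ k *\<^sub>R \<sigma> k) + 2 ^ k *\<^sub>R z))"
      by (auto simp: t_def scaleR_right_diff_distrib)
    then show ?thesis
      by (simp only:) (intro C1_on_mult C1_on_const C1_on_affine bounded_linear_scaleR_right smooth_bumpD[OF B])
  qed
  have "C1_on UNIV (\<lambda>z. \<Sum>k. t k z)"
    by (rule C1_on_series[OF c1 lt sums_summable[OF sL] st])
  then show "C1_on UNIV ?p" by (simp add: t_def)
  have "(2 * a * L)-lipschitz_on UNIV (\<lambda>z. \<Sum>k. t k z)"
  proof (rule lipschitz_onI)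
    show "0 \<le> 2 * a * L" using a L0 by simp
    fix x y
    have "\<bar>\<Sum>k. t k x - t k y\<bar> \<le> (\<Sum>k. a * L * (1 / 2) ^ k * dist x y)"
    proof (rule norm_suminf_le[of "\<lambda>k. t k x - t k y", unfolded real_norm_def])
      show "\<bar>t k x - t k y\<bar> \<le> a * L * (1 / 2) ^ k * dist x y" for k
        using lipschitz_onD[OF lt, of x y k] by (simp add: dist_real_def)
      show "summable (\<lambda>k. a * L * (1 / 2) ^ k * dist x y)"
        by (rule summable_mult2[OF sums_summable[OF sL]])
    qed
    also have "\<dots> = 2 * a * L * dist x y"
      using sums_unique[OF sums_mult2[OF sL, of "dist x y"]] by simp
    finally show "dist (\<Sum>k. t k x) (\<Sum>k. t k y) \<le> 2 * a * L * dist x y"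
      by (simp add: dist_real_def suminf_diff[OF st st, symmetric])
  qed
  then show "(2 * a * L)-lipschitz_on UNIV ?p" by (simp add: t_def)
  show "0 \<le> ?p z" using suminf_nonneg[OF st] tb by (simp add: t_def)
  have "(\<Sum>k. t k z) \<le> a * (4 / 3)"
    using suminf_le[OF _ st sums_summable[OF sa]] tb sums_unique[OF sa] by metis
  then show "?p z \<le> 2 * a" using a by (simp add: t_def)
qed

text \<open>The three variables are decoupled by the penalties \<open>M * (1 - B (s *\<^sub>R (x - y)))\<close>, which force
  them to be close together. The penalties are constant along the diagonal, so only the small
  perturbation contributes to the sum of the three derivatives.\<close>

lemma fuzzy_sum_rule:
  fixes f1 f2 g :: "'z::banach \<Rightarrow> real"
  assumes B: "smooth_bump (B :: 'z \<Rightarrow> real) R" and \<rho>: "0 < \<rho>" and \<kappa>: "0 < \<kappa>" and e: "0 < e"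
    and f1: "L1-lipschitz_on (cball z0 \<rho>) f1" and g: "Lg-lipschitz_on (cball z0 \<rho>) g"
    and f2: "seq_lsc (cball z0 \<rho>) f2"
    and grow: "\<And>z. z \<in> cball z0 \<rho> \<Longrightarrow> f1 z0 + f2 z0 + g z0 + \<kappa> * norm (z - z0) \<le> f1 z + f2 z + g z"
  obtains z1 z2 z3 G1 G2 G3 P1 P2 P3 where
    "z1 \<in> ball z0 e" "z2 \<in> ball z0 e" "z3 \<in> ball z0 e"
    "C1_on UNIV G1" "C1_on UNIV G2" "C1_on UNIV G3"
    "(G1 has_derivative P1) (at z1)" "(G2 has_derivative P2) (at z2)" "(G3 has_derivative P3) (at z3)"
    "\<forall>\<^sub>F z in nhds z1. f1 z1 - G1 z1 \<le> f1 z - G1 z"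
    "\<forall>\<^sub>F z in nhds z2. f2 z2 - G2 z2 \<le> f2 z - G2 z"
    "\<forall>\<^sub>F z in nhds z3. g z3 - G3 z3 \<le> g z - G3 z"
    "\<And>h. \<bar>P1 h + P2 h + P3 h\<bar> \<le> e * norm h"
proof -
  define m where "m = f1 z0 + f2 z0 + g z0"
  define K where "K = cball z0 \<rho>"
  define S where "S = K \<times> K \<times> K"
  define \<epsilon> where "\<epsilon> = min e \<rho>"
  have \<epsilon>: "0 < \<epsilon>" "\<epsilon> \<le> e" "\<epsilon> \<le> \<rho>" using e \<rho> by (auto simp: \<epsilon>_def)
  have L0: "0 \<le> L1" "0 \<le> Lg" using f1 g lipschitz_on_nonneg by auto
  have z0: "z0 \<in> K" using \<rho> by (simp add: K_def)
  have b: "0 \<le> B x" "B x \<le> 1" "B 0 = 1" and R: "0 < R" and Bz: "R \<le> norm x \<Longrightarrow> B x = 0" and BC1: "C1_on UNIV B" for x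
    using smooth_bumpD[OF B] by auto
  define F where "F = (\<lambda>(z1, z2, z3). f1 z1 + f2 z2 + g z3)"
  \<comment> \<open>\<open>f1\<close> and \<open>g\<close> are moved to the point \<open>z2\<close>,
    where the growth hypothesis applies. Only these two functions are moved, which is why lower
    semicontinuity of \<open>f2\<close> is enough.\<close>
  have low: "m + \<kappa> * norm (z2 - z0) - L1 * norm (z1 - z2) - Lg * norm (z2 - z3) \<le> F (z1, z2, z3)"
    if "z1 \<in> K" "z2 \<in> K" "z3 \<in> K" for z1 z2 z3
  proof -
    have "\<bar>f1 z1 - f1 z2\<bar> \<le> L1 * norm (z1 - z2)" "\<bar>g z2 - g z3\<bar> \<le> Lg * norm (z2 - z3)"
      using lipschitz_onD[OF f1] lipschitz_onD[OF g] that by (auto simp: K_def dist_norm)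
    then show ?thesis using grow[of z2] that(2) unfolding F_def m_def K_def by auto
  qed
  have low2: "m - L1 * (2 * \<rho>) - Lg * (2 * \<rho>) \<le> F (z1, z2, z3)"
    if K: "z1 \<in> K" "z2 \<in> K" "z3 \<in> K" for z1 z2 z3
  proof -
    have "dist z1 z2 \<le> 2 * \<rho>" "dist z2 z3 \<le> 2 * \<rho>"
      using K dist_triangle3[of z1 z2 z0] dist_triangle3[of z2 z3 z0] by (auto simp: K_def)
    then have "L1 * norm (z1 - z2) \<le> L1 * (2 * \<rho>)" "Lg * norm (z2 - z3) \<le> Lg * (2 * \<rho>)"
      using L0 by (auto simp: dist_norm intro!: mult_left_mono)
    moreover have "0 \<le> \<kappa> * norm (z2 - z0)" using \<kappa> by simp
    ultimately show ?thesis using low[OF K] by linarith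
  qed
  \<comment> \<open>By \<open>low2\<close>, \<open>F\<close> can fall below \<open>m\<close> by at
    most M - 1. A single fully active penalty therefore costs more than can be gained, even with the
    perturbation, whose total is at most 2 a \<le> 1/2.\<close>
  define M where "M = (L1 + Lg) * (2 * \<rho>) + 1"
  have M: "M \<ge> 1" using L0 \<rho> by (simp add: M_def)
  \<comment> \<open>Coupling radius. Separations below \<open>r\<close> gain at most (L1 + Lg) r
    \<le> \<kappa> \<epsilon> / 8, one half of the budget \<kappa> \<epsilon> / 4 that keeps
    \<open>z2\<close> within \<epsilon> / 4 of \<open>z0\<close>; the other half is left to 2
    a.\<close>
  define r where "r = min (\<epsilon> / 4) (\<kappa> * \<epsilon> / (8 * (L1 + Lg + 1)))"
  have r: "0 < r" "r \<le> \<epsilon> / 4" "(L1 + Lg) * r \<le> \<kappa> * \<epsilon> / 8"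
  proof -
    show "0 < r" using L0 \<epsilon> \<kappa> by (auto simp: r_def)
    show "r \<le> \<epsilon> / 4" unfolding r_def by (rule min.cobounded1)
    have "(L1 + Lg) * r \<le> (L1 + Lg + 1) * (\<kappa> * \<epsilon> / (8 * (L1 + Lg + 1)))"
      using L0 \<open>0 < r\<close> by (intro mult_mono) (auto simp: r_def)
    also have "\<dots> = \<kappa> * \<epsilon> / 8" using L0 by (simp add: field_simps)
    finally show "(L1 + Lg) * r \<le> \<kappa> * \<epsilon> / 8" .
  qed
  define s where "s = R / r"
  have s: "0 < s" using r R by (simp add: s_def)
  have near: "norm x < r" if "B (s *\<^sub>R x) \<noteq> 0" for x
  proof -
    have "norm (s *\<^sub>R x) < R" using that Bz not_le by blast
    then show ?thesis using s r R by (simp add: s_def field_simps)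
  qed
  define T where "T = (\<lambda>(z1, z2, z3). M * (1 - B (s *\<^sub>R (z1 - z2))) + M * (1 - B (s *\<^sub>R (z2 - z3))))"
  have T0: "0 \<le> T w" for w using b M by (auto simp: T_def case_prod_unfold)
  define B3 where "B3 = (\<lambda>(x, w). B x * (\<lambda>(y, z). B y * B z) w)"
  have B3: "smooth_bump B3 (R + (R + R))"
    unfolding B3_def by (intro smooth_bump_Pair B)
  have B3b: "0 \<le> B3 x" "B3 x \<le> 1" "B3 0 = 1" and B3z: "R + (R + R) \<le> norm x \<Longrightarrow> B3 x = 0"
    and B3C1: "C1_on UNIV B3" for x
    by (fact smooth_bumpD[OF B3])+
  obtain L3 where L3: "L3-lipschitz_on UNIV B3" using B3 by (auto simp: smooth_bump_def)
  have L30: "0 \<le> L3" using lipschitz_on_nonneg[OF L3] .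
  \<comment> \<open>The three bounds serve the comparison with \<open>M\<close>, the localization
    near \<open>z0\<close>, and the derivative along the diagonal: the latter is at most 3 times the
    Lipschitz constant 2 a L3, because (h, h, h) has norm at most 3 times that of h.\<close>
  define a where "a = min (1 / 4) (min (\<kappa> * \<epsilon> / 16) (e / (6 * (L3 + 1))))"
  have a: "0 < a" "a \<le> 1 / 4" "a \<le> \<kappa> * \<epsilon> / 16" "2 * a * L3 * 3 \<le> e"
  proof -
    show "0 < a" using \<kappa> \<epsilon> e L30 by (auto simp: a_def)
    show "a \<le> 1 / 4" "a \<le> \<kappa> * \<epsilon> / 16" unfolding a_def by linarith+
    have "a * (6 * (L3 + 1)) \<le> e / (6 * (L3 + 1)) * (6 * (L3 + 1))"
      using L30 by (intro mult_right_mono) (auto simp: a_def)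
    also have "\<dots> = e" using L30 by simp
    finally have "6 * a * L3 + 6 * a \<le> e" by (simp add: algebra_simps)
    then show "2 * a * L3 * 3 \<le> e" using \<open>0 < a\<close> by simp
  qed
  have lsc: "seq_lsc S (\<lambda>w. F w + T w)"
  proof -
    have 1: "seq_lsc S (\<lambda>w. f1 (fst w))"
      by (rule seq_lsc_compose[OF seq_lsc_continuous_on[OF lipschitz_on_continuous_on[OF f1]]])
        (auto simp: S_def K_def intro!: continuous_intros)
    have 2: "seq_lsc S (\<lambda>w. f2 (fst (snd w)))"
      by (rule seq_lsc_compose[OF f2]) (auto simp: S_def K_def intro!: continuous_intros)
    have 3: "seq_lsc S (\<lambda>w. g (snd (snd w)))"
      by (rule seq_lsc_compose[OF seq_lsc_continuous_on[OF lipschitz_on_continuous_on[OF g]]])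
        (auto simp: S_def K_def intro!: continuous_intros)
    have "continuous_on S T" unfolding T_def case_prod_unfold
      by (intro continuous_intros continuous_on_compose2[OF C1_on_imp_continuous_on[OF BC1]]) auto
    then show ?thesis
      using seq_lsc_add[OF seq_lsc_add[OF seq_lsc_add[OF 1 2] 3] seq_lsc_continuous_on, of T]
      by (simp add: F_def case_prod_unfold)
  qed
  have bdd: "bdd_below ((\<lambda>w. F w + T w) ` S)"
  proof (rule bdd_belowI2)
    fix w assume w: "w \<in> S"
    then show "m - L1 * (2 * \<rho>) - Lg * (2 * \<rho>) \<le> F w + T w"
      using low2[of "fst w" "fst (snd w)" "snd (snd w)"] T0[of w] by (auto simp: S_def)
  qed
  have conv: "\<exists>x\<in>S. \<sigma> \<longlonglongrightarrow> x"
    if "\<And>k. \<sigma> k \<in> S" "\<And>k. 0 < B3 (2 ^ k *\<^sub>R (\<sigma> (Suc k) - \<sigma> k))" for \<sigma> :: "nat \<Rightarrow> 'z \<times> 'z \<times> 'z"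
  proof -
    have step: "dist (\<sigma> k) (\<sigma> (Suc k)) \<le> 3 * R / 2 ^ k" for k
    proof -
      have "norm (2 ^ k *\<^sub>R (\<sigma> (Suc k) - \<sigma> k)) < R + (R + R)"
        using that(2)[of k] B3z not_le by (metis less_irrefl)
      then have "2 ^ k * dist (\<sigma> k) (\<sigma> (Suc k)) \<le> 3 * R"
        by (simp only: norm_scaleR) (simp add: dist_norm norm_minus_commute)
      then show ?thesis by (simp add: field_simps)
    qed
    have "Cauchy \<sigma>"
      unfolding Cauchy_def
      using geometric_Cauchy[where d=dist and \<sigma>=\<sigma>, OF dist_triangle dist_self dist_commute step] R by simp
    then obtain x where x: "\<sigma> \<longlonglongrightarrow> x" using Cauchy_convergent convergent_def by blast
    have "closed S" unfolding S_def K_def by (intro closed_Times closed_cball)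
    then show ?thesis using x that(1) closed_sequentially by blast
  qed
  obtain \<sigma> x where \<sigma>: "\<And>k. \<sigma> k \<in> S" and x: "x \<in> S" and
    min: "\<And>y. y \<in> S \<Longrightarrow> F x + T x - (\<Sum>k. a / 4 ^ k * B3 (2 ^ k *\<^sub>R (x - \<sigma> k)))
        \<le> F y + T y - (\<Sum>k. a / 4 ^ k * B3 (2 ^ k *\<^sub>R (y - \<sigma> k)))"
  proof (rule perturbed_minimum[of S "\<lambda>w. F w + T w" "\<lambda>k z y. B3 (2 ^ k *\<^sub>R (y - z))" "\<lambda>k. a / 4 ^ k"])
    show "S \<noteq> {}" using z0 by (auto simp: S_def)
    show "continuous_on S (\<lambda>y. B3 (2 ^ k *\<^sub>R (y - z)))" for k z
      by (intro continuous_intros continuous_on_compose2[OF C1_on_imp_continuous_on[OF B3C1]]) auto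
    show "summable (\<lambda>k. a / 4 ^ k)"
      using summable_mult[OF summable_geometric[of "1 / 4 :: real"], of a] by (simp add: power_divide)
  qed (use lsc bdd conv B3b a in auto)
  define p where "p w = (\<Sum>k. a / 4 ^ k * B3 (2 ^ k *\<^sub>R (w - \<sigma> k)))" for w
  note series = smooth_bump_series[OF B3 L3 a(1), where \<sigma>=\<sigma>, folded p_def]
  \<comment> \<open>Now \<open>F - \<Theta>\<close> is minimal at \<open>x\<close> and \<Theta> is
    C1. Freezing two of the three components of \<open>x\<close> turns \<Theta> into the three test
    functions.\<close>
  define \<Theta> where "\<Theta> w = p w - T w" for w
  have min: "F x - \<Theta> x \<le> F y - \<Theta> y" if "y \<in> S" for y
    using min[OF that] by (simp add: \<Theta>_def p_def algebra_simps)
  obtain z1 z2 z3 where xeq: "x = (z1, z2, z3)" by (metis surj_pair)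
  have zK: "z1 \<in> K" "z2 \<in> K" "z3 \<in> K" using x by (auto simp: S_def xeq)
  \<comment> \<open>The competitor is the diagonal point over \<open>z0\<close>, where both
    penalties vanish.\<close>
  have val: "F x + T x \<le> m + 2 * a"
  proof -
    have "(z0, z0, z0) \<in> S" using z0 by (simp add: S_def)
    from min[OF this] have "F x + T x \<le> m + p x - p (z0, z0, z0)"
      by (simp add: \<Theta>_def F_def T_def m_def b)
    then show ?thesis using series(3)[of "(z0, z0, z0)"] series(4)[of x] by linarith
  qed
  have TM: "T x < M" using val low2[OF zK] a(2) unfolding M_def xeq by (simp add: algebra_simps)
  have "B (s *\<^sub>R (z1 - z2)) \<noteq> 0"
  proof
    assume "B (s *\<^sub>R (z1 - z2)) = 0"
    moreover have "0 \<le> M * (1 - B (s *\<^sub>R (z2 - z3)))" using M b by simp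
    ultimately show False using TM by (simp add: T_def xeq)
  qed
  then have d12: "norm (z1 - z2) < r" by (rule near)
  have "B (s *\<^sub>R (z2 - z3)) \<noteq> 0"
  proof
    assume "B (s *\<^sub>R (z2 - z3)) = 0"
    moreover have "0 \<le> M * (1 - B (s *\<^sub>R (z1 - z2)))" using M b by simp
    ultimately show False using TM by (simp add: T_def xeq)
  qed
  then have d23: "norm (z2 - z3) < r" by (rule near)
  have "L1 * norm (z1 - z2) \<le> L1 * r" "Lg * norm (z2 - z3) \<le> Lg * r"
    using d12 d23 L0 by (auto intro!: mult_left_mono)
  then have "\<kappa> * norm (z2 - z0) \<le> (L1 + Lg) * r + 2 * a"
    using val low[OF zK] T0[of x] unfolding xeq by (simp add: algebra_simps)
  also have "\<dots> \<le> \<kappa> * (\<epsilon> / 4)" using r a by simp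
  finally have d2: "norm (z2 - z0) \<le> \<epsilon> / 4" using \<kappa> by simp
  have d: "z1 \<in> ball z0 \<epsilon>" "z2 \<in> ball z0 \<epsilon>" "z3 \<in> ball z0 \<epsilon>"
  proof -
    show "z2 \<in> ball z0 \<epsilon>" using d2 \<epsilon> by (simp add: dist_norm norm_minus_commute)
    have "norm (z1 - z0) \<le> norm (z1 - z2) + norm (z2 - z0)" using norm_triangle_ineq[of "z1 - z2" "z2 - z0"] by simp
    then show "z1 \<in> ball z0 \<epsilon>" using d12 d2 r(2) \<epsilon> by (simp add: dist_norm norm_minus_commute)
    have "norm (z3 - z0) \<le> norm (z2 - z3) + norm (z2 - z0)"
      using norm_triangle_ineq[of "z3 - z2" "z2 - z0"] by (simp add: norm_minus_commute)
    then show "z3 \<in> ball z0 \<epsilon>" using d23 d2 r(2) \<epsilon> by (simp add: dist_norm norm_minus_commute)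
  qed
  have C1T: "C1_on UNIV T"
  proof -
    have l: "bounded_linear (\<lambda>w. s *\<^sub>R (fst w - fst (snd w)) :: 'z)"
      "bounded_linear (\<lambda>w. s *\<^sub>R (fst (snd w) - snd (snd w)) :: 'z)"
      for dummy :: "'z \<times> 'z \<times> 'z"
      by (intro bounded_linear_intros bounded_linear_compose[OF bounded_linear_fst bounded_linear_snd]
        bounded_linear_compose[OF bounded_linear_snd bounded_linear_snd] bounded_linear_fst)+
    show ?thesis
      unfolding T_def case_prod_unfold
      using C1_on_affine[OF BC1 l(1), of 0] C1_on_affine[OF BC1 l(2), of 0]
      by (auto intro!: C1_on_add C1_on_mult C1_on_diff C1_on_const)
  qed
  have C1\<Theta>: "C1_on UNIV \<Theta>" unfolding \<Theta>_def[abs_def] by (intro C1_on_diff series C1T)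
  then obtain D where D: "(\<Theta> has_derivative D) (at x)" unfolding C1_on_def by blast
  interpret D: bounded_linear D using D has_derivative_bounded_linear by blast
  have i: "bounded_linear (\<lambda>h::'z. (h, 0::'z, 0::'z))" "bounded_linear (\<lambda>h::'z. (0::'z, h, 0::'z))"
    "bounded_linear (\<lambda>h::'z. (0::'z, 0::'z, h))" "bounded_linear (\<lambda>h::'z. (h, h, h))"
    by (intro bounded_linear_Pair bounded_linear_ident bounded_linear_zero)+
  have der: "((\<lambda>h. \<Theta> (v + l h)) has_derivative (\<lambda>h. D (l h))) (at y)"
    if "bounded_linear l" "v + l y = x" for l v and y :: 'z
  proof -
    have "((\<lambda>h. v + l h) has_derivative l) (at y)"
      using has_derivative_add[OF has_derivative_const bounded_linear_imp_has_derivative[OF that(1)]] by simp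
    from has_derivative_compose[OF this, of \<Theta> D] show ?thesis using D that by simp
  qed
  \<comment> \<open>The minimum is taken over a product of closed balls. The three points lie in the
    open ball, so varying one of them slightly stays admissible.\<close>
  have loc: "\<forall>\<^sub>F z in nhds zi. z \<in> K" if "zi \<in> ball z0 \<epsilon>" for zi
    using that \<epsilon> unfolding K_def
    by (intro eventually_nhds[THEN iffD2] exI[of _ "ball z0 \<epsilon>"]) auto
  show ?thesis
  proof (rule that[where ?z1.0=z1 and ?z2.0=z2 and ?z3.0=z3 and ?G1.0="\<lambda>h. \<Theta> ((0, z2, z3) + (h, 0, 0))" and
      ?G2.0="\<lambda>h. \<Theta> ((z1, 0, z3) + (0, h, 0))" and ?G3.0="\<lambda>h. \<Theta> ((z1, z2, 0) + (0, 0, h))"])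
    show "z1 \<in> ball z0 e" "z2 \<in> ball z0 e" "z3 \<in> ball z0 e" using d \<epsilon> by auto
    show "((\<lambda>h. \<Theta> ((0, z2, z3) + (h, 0, 0))) has_derivative (\<lambda>h. D (h, 0, 0))) (at z1)"
      by (rule der[OF i(1)]) (simp add: xeq)
    show "((\<lambda>h. \<Theta> ((z1, 0, z3) + (0, h, 0))) has_derivative (\<lambda>h. D (0, h, 0))) (at z2)"
      by (rule der[OF i(2)]) (simp add: xeq)
    show "((\<lambda>h. \<Theta> ((z1, z2, 0) + (0, 0, h))) has_derivative (\<lambda>h. D (0, 0, h))) (at z3)"
      by (rule der[OF i(3)]) (simp add: xeq)
    show "\<forall>\<^sub>F z in nhds z1. f1 z1 - \<Theta> ((0, z2, z3) + (z1, 0, 0)) \<le> f1 z - \<Theta> ((0, z2, z3) + (z, 0, 0))"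
      using loc[OF d(1)]
    proof eventually_elim
      case (elim z)
      then show ?case using min[of "(z, z2, z3)"] zK by (simp add: S_def F_def xeq)
    qed
    show "\<forall>\<^sub>F z in nhds z2. f2 z2 - \<Theta> ((z1, 0, z3) + (0, z2, 0)) \<le> f2 z - \<Theta> ((z1, 0, z3) + (0, z, 0))"
      using loc[OF d(2)]
    proof eventually_elim
      case (elim z)
      then show ?case using min[of "(z1, z, z3)"] zK by (simp add: S_def F_def xeq)
    qed
    show "\<forall>\<^sub>F z in nhds z3. g z3 - \<Theta> ((z1, z2, 0) + (0, 0, z3)) \<le> g z - \<Theta> ((z1, z2, 0) + (0, 0, z))"
      using loc[OF d(3)]
    proof eventually_elim
      case (elim z)
      then show ?case using min[of "(z1, z2, z)"] zK by (simp add: S_def F_def xeq)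
    qed
    fix h
    have "D (h, 0, 0) + D (0, h, 0) + D (0, 0, h) = D (h, h, h)"
      by (simp flip: D.add)
    moreover have "\<bar>D (h, h, h)\<bar> \<le> e * norm h"
    proof (rule has_derivative_bound_seminorm[OF der[OF i(4), of x 0]])
      show "\<forall>\<^sub>F y in nhds 0. \<Theta> (x + (y, y, y)) - \<Theta> (x + (0, 0, 0)) \<le> e * norm (y - 0)"
      proof (intro always_eventually allI)
        fix y
        have "\<Theta> (x + (y, y, y)) - \<Theta> (x + (0, 0, 0)) = p (x + (y, y, y)) - p x"
          by (simp add: \<Theta>_def T_def xeq flip: zero_prod_def)
        also have "\<dots> \<le> 2 * a * L3 * dist (x + (y, y, y)) x"
          using lipschitz_onD[OF series(2), of "x + (y, y, y)" x] by (simp add: dist_real_def)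
        also have "dist (x + (y, y, y)) x \<le> 3 * norm y"
          using norm_Pair_le[of y "(y, y)"] norm_Pair_le[of y y] by (simp add: dist_norm)
        then have "2 * a * L3 * dist (x + (y, y, y)) x \<le> 2 * a * L3 * (3 * norm y)"
          using a L30 by (intro mult_left_mono) auto
        also have "\<dots> = (2 * a * L3 * 3) * norm y" by simp
        also have "\<dots> \<le> e * norm y" using a(4) by (intro mult_right_mono) auto
        finally show "\<Theta> (x + (y, y, y)) - \<Theta> (x + (0, 0, 0)) \<le> e * norm (y - 0)" by simp
      qed
    qed (auto simp: zero_prod_def[symmetric])
    ultimately show "\<bar>D (h, 0, 0) + D (0, h, 0) + D (0, 0, h)\<bar> \<le> e * norm h" by simp
  qed (intro C1_on_affine[OF C1\<Theta>] i)+
qed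

section \<open>Finsler manifolds\<close>

lemma velocity_cong:
  assumes "\<forall>\<^sub>F r in nhds t. \<gamma> r = \<gamma>' r"
  shows "velocity A \<gamma> t = velocity A \<gamma>' t"
proof -
  have 1: "\<gamma> t = \<gamma>' t" using assms by (rule eventually_nhds_x_imp_x)
  have 2: "vector_derivative (snd c \<circ> \<gamma>) (at t) = vector_derivative (snd c \<circ> \<gamma>') (at t)" for c
    by (rule vector_derivative_cong_eq) (use assms in \<open>auto elim!: eventually_mono\<close>)
  show ?thesis unfolding velocity_def by (rule ext) (simp only: 1 2)
qed

lemma C1_path_cong:
  assumes "C1_path A I \<gamma>" "\<And>r. r \<in> I \<Longrightarrow> \<gamma> r = \<gamma>' r"
  shows "C1_path A I \<gamma>'"
  unfolding C1_path_def
proof (intro conjI ballI)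
  show "continuous_on I \<gamma>'" using assms by (simp add: C1_path_def cong: continuous_on_cong)
  fix c assume "c \<in> A"
  then obtain w where w: "continuous_on {r \<in> I. \<gamma> r \<in> fst c} w"
    "\<And>r. r \<in> I \<Longrightarrow> \<gamma> r \<in> fst c \<Longrightarrow> ((snd c \<circ> \<gamma>) has_vector_derivative w r) (at r within I)"
    using assms(1) unfolding C1_path_def by blast
  have "{r \<in> I. \<gamma>' r \<in> fst c} = {r \<in> I. \<gamma> r \<in> fst c}" using assms(2) by auto
  moreover have "((snd c \<circ> \<gamma>') has_vector_derivative w r) (at r within I)" if "r \<in> I" "\<gamma>' r \<in> fst c" for r
    by (rule has_vector_derivative_transform[OF that(1) _ w(2)]) (use that assms(2) in auto)
  ultimately show "\<exists>w. continuous_on {r \<in> I. \<gamma>' r \<in> fst c} w \<and>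
      (\<forall>r\<in>I. \<gamma>' r \<in> fst c \<longrightarrow> ((snd c \<circ> \<gamma>') has_vector_derivative w r) (at r within I))"
    using w(1) by auto
qed

text \<open>Slope 1 shifts a path before concatenation and slope -1 reverses it. Writing the new
  domain as a preimage treats both orientations at once.\<close>

lemma C1_path_affine:
  fixes m k :: real
  assumes "C1_path A I \<gamma>" "m \<noteq> 0"
  shows "C1_path A ((\<lambda>t. m * t + k) -` I) (\<lambda>t. \<gamma> (m * t + k))"
  unfolding C1_path_def
proof (intro conjI ballI)
  let ?l = "\<lambda>t. m * t + k" and ?J = "(\<lambda>t. m * t + k) -` I"
  show "continuous_on ?J (\<lambda>t. \<gamma> (?l t))"
    using assms(1) unfolding C1_path_def
    by (intro continuous_on_compose2[of I \<gamma> _ ?l]) (auto intro!: continuous_intros)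
  fix c assume "c \<in> A"
  then obtain w where w: "continuous_on {r \<in> I. \<gamma> r \<in> fst c} w"
    "\<And>r. r \<in> I \<Longrightarrow> \<gamma> r \<in> fst c \<Longrightarrow> ((snd c \<circ> \<gamma>) has_vector_derivative w r) (at r within I)"
    using assms(1) unfolding C1_path_def by blast
  show "\<exists>w. continuous_on {r \<in> ?J. \<gamma> (?l r) \<in> fst c} w \<and>
      (\<forall>r\<in>?J. \<gamma> (?l r) \<in> fst c \<longrightarrow> ((snd c \<circ> (\<lambda>t. \<gamma> (?l t))) has_vector_derivative w r) (at r within ?J))"
  proof (intro exI[of _ "\<lambda>r. m *\<^sub>R w (?l r)"] conjI ballI impI)
    show "continuous_on {r \<in> ?J. \<gamma> (?l r) \<in> fst c} (\<lambda>r. m *\<^sub>R w (?l r))"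
      by (intro continuous_intros continuous_on_compose2[OF w(1)]) auto
    fix r assume r: "r \<in> ?J" "\<gamma> (?l r) \<in> fst c"
    have l: "(?l has_vector_derivative m) (at r within ?J)"
      by (auto intro!: derivative_eq_intros simp: has_real_derivative_iff_has_vector_derivative[symmetric])
    have "((snd c \<circ> \<gamma>) has_vector_derivative w (?l r)) (at (?l r) within ?l ` ?J)"
      by (rule has_vector_derivative_within_subset[OF w(2)]) (use r in auto)
    from vector_diff_chain_within[OF l this]
    show "((snd c \<circ> (\<lambda>t. \<gamma> (?l t))) has_vector_derivative m *\<^sub>R w (?l r)) (at r within ?J)"
      by (simp add: o_def)
  qed
qed

lemma mono_upto:
  fixes s :: "nat \<Rightarrow> 'a::preorder"
  assumes "\<And>i. i < n \<Longrightarrow> s i \<le> s (Suc i)" "i \<le> j" "j \<le> n"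
  shows "s i \<le> s j"
  using assms(2,3)
proof (induction j rule: dec_induct)
  case (step k)
  then show ?case using assms(1)[of k] order_trans[of "s i" "s k" "s (Suc k)"] by simp
qed simp

locale finsler =
  fixes A :: "('m::t2_space, 'x::banach) chart set" and N :: "'m \<Rightarrow> ('m, 'x) tangent \<Rightarrow> real"
  assumes finsler: "C1_finsler_manifold A N"
begin

abbreviation nrm :: "('m, 'x) chart \<Rightarrow> 'm \<Rightarrow> 'x \<Rightarrow> real" where
  "nrm c x v \<equiv> N x (tvec A c x v)"

abbreviation trans_deriv :: "('m, 'x) chart \<Rightarrow> ('m, 'x) chart \<Rightarrow> 'm \<Rightarrow> 'x \<Rightarrow> 'x" where
  "trans_deriv c c' x \<equiv> frechet_derivative (snd c' \<circ> chart_inv c) (at (snd c x))"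

section \<open>Charts, transition maps and tangent vectors\<close>

lemma atlas: "C1_structure A"
  using finsler by (simp add: C1_finsler_manifold_def)

lemma charts_at_iff: "c \<in> charts_at A x \<longleftrightarrow> c \<in> A \<and> x \<in> fst c"
  by (simp add: charts_at_def)

lemma chart_ex: obtains c where "c \<in> charts_at A x"
  using atlas unfolding C1_structure_def charts_at_def by blast

lemma chart:
  assumes "c \<in> A"
  shows "open (fst c)" "open (snd c ` fst c)" "continuous_on (fst c) (snd c)"
    "continuous_on (snd c ` fst c) (chart_inv c)"
    "x \<in> fst c \<Longrightarrow> chart_inv c (snd c x) = x"
    "y \<in> snd c ` fst c \<Longrightarrow> snd c (chart_inv c y) = y"
    "y \<in> snd c ` fst c \<Longrightarrow> chart_inv c y \<in> fst c"
  using atlas assms unfolding C1_structure_def is_chart_def homeomorphism_def by auto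

lemma chart_isCont:
  assumes "c \<in> charts_at A x" shows "isCont (snd c) x"
  using assms continuous_on_eq_continuous_at[OF chart(1)] chart(3) unfolding charts_at_iff by blast

lemma chart_open_image:
  assumes "c \<in> A" "open W" "W \<subseteq> fst c" shows "open (snd c ` W)"
proof -
  have "snd c ` W = snd c ` fst c \<inter> chart_inv c -` W"
    using assms chart(5,6,7)[OF assms(1)] by force
  moreover have "open (snd c ` fst c \<inter> chart_inv c -` W)"
    using continuous_open_preimage[OF chart(4,2)[OF assms(1)] assms(2)] .
  ultimately show ?thesis by simp
qed

lemma transition_C1:
  assumes "c \<in> A" "c' \<in> A"
  shows "C1_on (snd c ` (fst c \<inter> fst c')) (snd c' \<circ> chart_inv c)"
  using atlas assms unfolding C1_structure_def C1_compatible_def by blast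

lemma transition_deriv:
  assumes "c \<in> charts_at A x" "c' \<in> charts_at A x"
  shows "((snd c' \<circ> chart_inv c) has_derivative trans_deriv c c' x) (at (snd c x))"
proof -
  have "snd c x \<in> snd c ` (fst c \<inter> fst c')" using assms by (auto simp: charts_at_iff)
  then have "\<exists>D. ((snd c' \<circ> chart_inv c) has_derivative D) (at (snd c x))"
    using transition_C1[of c c'] assms unfolding C1_on_def charts_at_iff by blast
  then show ?thesis using frechet_derivative_works differentiable_def by blast
qed

lemma transition_bounded_linear:
  assumes "c \<in> charts_at A x" "c' \<in> charts_at A x"
  shows "bounded_linear (trans_deriv c c' x)"
  using transition_deriv[OF assms] has_derivative_bounded_linear by blast

lemma transition_id:
  assumes "c \<in> charts_at A x" shows "trans_deriv c c x v = v"
proof -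
  have c: "c \<in> A" "x \<in> fst c" using assms by (auto simp: charts_at_iff)
  have "((\<lambda>y. y) has_derivative (\<lambda>v. v)) (at (snd c x))" by simp
  then have "((snd c \<circ> chart_inv c) has_derivative (\<lambda>v. v)) (at (snd c x))"
    by (rule has_derivative_transform_within_open[OF _ chart(2)[OF c(1)]]) (use c chart(6) in auto)
  then show ?thesis using has_derivative_unique[OF transition_deriv[OF assms assms]] by metis
qed

text \<open>The chain rule on the overlap of the first two domains. This cocycle identity is what
  makes \<open>tvec\<close> a compatible family of coordinates, that is, a tangent vector.\<close>

lemma transition_comp:
  assumes "c \<in> charts_at A x" "c' \<in> charts_at A x" "c'' \<in> charts_at A x"
  shows "trans_deriv c' c'' x (trans_deriv c c' x v) = trans_deriv c c'' x v"
proof -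
  have c: "c \<in> A" "x \<in> fst c" "c' \<in> A" "x \<in> fst c'" "c'' \<in> A" "x \<in> fst c''" using assms by (auto simp: charts_at_iff)
  have x: "(snd c' \<circ> chart_inv c) (snd c x) = snd c' x" using chart(5)[OF c(1,2)] by simp
  have "((\<lambda>y. (snd c'' \<circ> chart_inv c') ((snd c' \<circ> chart_inv c) y)) has_derivative
      (\<lambda>v. trans_deriv c' c'' x (trans_deriv c c' x v))) (at (snd c x))"
    by (rule has_derivative_compose[OF transition_deriv[OF assms(1,2)]])
      (simp only: x transition_deriv[OF assms(2,3)])
  then have "((snd c'' \<circ> chart_inv c) has_derivative
      (\<lambda>v. trans_deriv c' c'' x (trans_deriv c c' x v))) (at (snd c x))"
  proof (rule has_derivative_transform_within_open)
    show "open (snd c ` (fst c \<inter> fst c'))" using c by (intro chart_open_image) (auto intro: chart)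
    show "snd c x \<in> snd c ` (fst c \<inter> fst c')" using c by auto
  qed (use c chart(5)[OF c(1)] chart(5)[OF c(3)] in auto)
  then show ?thesis using has_derivative_unique[OF transition_deriv[OF assms(1,3)]] by metis
qed

lemma tvec_apply: "c' \<in> charts_at A x \<Longrightarrow> tvec A c x v c' = trans_deriv c c' x v"
  by (simp add: tvec_def)

lemma tvec_in: "c \<in> charts_at A x \<Longrightarrow> tvec A c x v \<in> tangent_space A x"
  unfolding tangent_space_def by (simp add: tvec_apply transition_comp) (simp add: tvec_def)

text \<open>One coordinate determines the whole family, so statements about tangent vectors reduce
  to vectors of the model space in a chosen chart.\<close>

lemma tangent_eq_tvec:
  assumes "\<xi> \<in> tangent_space A x" "c \<in> charts_at A x" shows "\<xi> = tvec A c x (\<xi> c)"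
proof
  fix c' show "\<xi> c' = tvec A c x (\<xi> c) c'"
  proof (cases "c' \<in> charts_at A x")
    case True
    then have "\<xi> c' = trans_deriv c c' x (\<xi> c)"
      using assms unfolding tangent_space_def by blast
    then show ?thesis using True by (simp only: tvec_apply)
  next
    case False
    then have "\<xi> c' = 0" using assms(1) unfolding tangent_space_def by blast
    then show ?thesis using False by (simp add: tvec_def)
  qed
qed

lemma tvec_scaleR: "c \<in> charts_at A x \<Longrightarrow> tvec A c x (a *\<^sub>R v) = (\<lambda>c'. a *\<^sub>R tvec A c x v c')"
  using transition_bounded_linear[of c x] by (auto simp: tvec_def linear_simps)

lemma tvec_add: "c \<in> charts_at A x \<Longrightarrow> tvec A c x (v + w) = (\<lambda>c'. tvec A c x v c' + tvec A c x w c')"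
  using transition_bounded_linear[of c x] by (auto simp: tvec_def linear_simps)

section \<open>The tangent norms in coordinates\<close>

lemma tangent_norm: "tangent_norm_at A x (N x)"
  using finsler by (simp add: C1_finsler_manifold_def)

lemma N_nonneg: "\<xi> \<in> tangent_space A x \<Longrightarrow> 0 \<le> N x \<xi>"
  using tangent_norm[of x] unfolding tangent_norm_at_def by blast

lemma N_uminus: "\<xi> \<in> tangent_space A x \<Longrightarrow> N x (\<lambda>c. - \<xi> c) = N x \<xi>"
proof -
  assume "\<xi> \<in> tangent_space A x"
  then have "N x (\<lambda>c. (- 1) *\<^sub>R \<xi> c) = \<bar>- 1\<bar> * N x \<xi>"
    using tangent_norm[of x] unfolding tangent_norm_at_def by blast
  then show ?thesis by simp
qed

lemma nrm_nonneg: "c \<in> charts_at A x \<Longrightarrow> 0 \<le> nrm c x v"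
  by (intro N_nonneg tvec_in)

lemma nrm_scaleR: "c \<in> charts_at A x \<Longrightarrow> nrm c x (a *\<^sub>R v) = \<bar>a\<bar> * nrm c x v"
  using tangent_norm[of x] tvec_in[of c x v] by (simp add: tvec_scaleR tangent_norm_at_def)

lemma nrm_add: "c \<in> charts_at A x \<Longrightarrow> nrm c x (v + w) \<le> nrm c x v + nrm c x w"
  using tangent_norm[of x] tvec_in[of c x] by (simp add: tvec_add tangent_norm_at_def)

lemma nrm_minus_commute: "c \<in> charts_at A x \<Longrightarrow> nrm c x (v - w) = nrm c x (w - v)"
  using nrm_scaleR[of c x "-1" "v - w"] by simp

lemma nrm_equiv:
  assumes "c \<in> charts_at A x"
  obtains k K where "0 < k" "0 < K" "\<And>v. k * norm v \<le> nrm c x v" "\<And>v. nrm c x v \<le> K * norm v"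
  using finsler assms unfolding C1_finsler_manifold_def by metis

text \<open>In the final topology of the tangent bundle, openness means openness of the preimages
  under all trivializations; continuity of the Finsler norm is pulled back through one of them. The
  lemma serves the integrability of speeds.\<close>

lemma nrm_continuous:
  assumes "c \<in> A" shows "continuous_on (fst c \<times> UNIV) (\<lambda>(x, v). nrm c x v)"
  unfolding continuous_openin_preimage_eq
proof (intro allI impI)
  fix T :: "real set" assume T: "open T"
  have "tangent_bundle A \<inter> {p. (case p of (x, \<xi>) \<Rightarrow> N x \<xi>) \<in> T} =
      {p \<in> topspace (tangent_topology A). (case p of (x, \<xi>) \<Rightarrow> N x \<xi>) \<in> T}"
  proof -
    have "openin (tangent_topology A) (tangent_bundle A)"
    proof -
      have "{(x, v). x \<in> fst c \<and> (x, tvec A c x v) \<in> tangent_bundle A} = fst c \<times> UNIV" if "c \<in> A" for c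
        using that by (auto simp: tangent_bundle_def charts_at_iff intro!: tvec_in)
      then show ?thesis by (auto simp: openin_tangent_topology)
    qed
    moreover have "topspace (tangent_topology A) \<subseteq> tangent_bundle A"
      using openin_tangent_topology[of A "topspace (tangent_topology A)"] by simp
    ultimately have "topspace (tangent_topology A) = tangent_bundle A"
      using openin_subset by blast
    then show ?thesis by auto
  qed
  moreover have "openin (tangent_topology A) {p \<in> topspace (tangent_topology A). (case p of (x, \<xi>) \<Rightarrow> N x \<xi>) \<in> T}"
    using finsler T unfolding C1_finsler_manifold_def by (intro openin_continuous_map_preimage) auto
  ultimately have "openin (top_of_set (fst c \<times> UNIV))
      {(x, v). x \<in> fst c \<and> (x, tvec A c x v) \<in> tangent_bundle A \<inter> {p. (case p of (x, \<xi>) \<Rightarrow> N x \<xi>) \<in> T}}"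
    using assms by (simp add: openin_tangent_topology)
  moreover have "{(x, v). x \<in> fst c \<and> (x, tvec A c x v) \<in> tangent_bundle A \<inter> {p. (case p of (x, \<xi>) \<Rightarrow> N x \<xi>) \<in> T}}
      = fst c \<times> UNIV \<inter> (\<lambda>(x, v). nrm c x v) -` T"
    using assms by (auto simp: tangent_bundle_def charts_at_iff intro!: tvec_in)
  ultimately show "openin (top_of_set (fst c \<times> UNIV)) (fst c \<times> UNIV \<inter> (\<lambda>(x, v). nrm c x v) -` T)" by simp
qed

subsection \<open>Paths and their lengths\<close>

abbreviation speed :: "(real \<Rightarrow> 'm) \<Rightarrow> real \<Rightarrow> real" where
  "speed \<gamma> t \<equiv> N (\<gamma> t) (velocity A \<gamma> t)"

text \<open>\<open>velocity\<close> is unspecified where the path is not differentiable. This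
  predicate singles out the times at which the coordinate derivatives exist and fit together to a
  tangent vector. A piecewise C1 path has at most finitely many other times, which integrals
  ignore.\<close>

definition regular_at :: "(real \<Rightarrow> 'm) \<Rightarrow> real \<Rightarrow> bool" where
  "regular_at \<gamma> t \<longleftrightarrow> (\<forall>c\<in>charts_at A (\<gamma> t).
     ((snd c \<circ> \<gamma>) has_vector_derivative velocity A \<gamma> t c) (at t) \<and>
     velocity A \<gamma> t = tvec A c (\<gamma> t) (velocity A \<gamma> t c))"

lemma regular_at_velocity_in: "regular_at \<gamma> t \<Longrightarrow> velocity A \<gamma> t \<in> tangent_space A (\<gamma> t)"
  by (metis chart_ex regular_at_def tvec_in)

lemma C1_path_regular:
  assumes "C1_path A {a..b} \<gamma>" "t \<in> {a<..<b}" shows "regular_at \<gamma> t"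
  unfolding regular_at_def
proof (intro ballI conjI)
  fix c assume c: "c \<in> charts_at A (\<gamma> t)"
  have vd: "((snd c \<circ> \<gamma>) has_vector_derivative velocity A \<gamma> t c) (at t)" if "c \<in> charts_at A (\<gamma> t)" for c
  proof -
    have "\<exists>w. ((snd c \<circ> \<gamma>) has_vector_derivative w) (at t within {a..b})"
      using assms that unfolding C1_path_def charts_at_iff
      by (metis atLeastAtMost_iff greaterThanLessThan_iff less_imp_le)
    moreover have "at t within {a..b} = at t" using assms(2) by (intro at_within_interior) auto
    ultimately have "((snd c \<circ> \<gamma>) has_vector_derivative vector_derivative (snd c \<circ> \<gamma>) (at t)) (at t)"
      using vector_derivative_at by metis
    then show ?thesis using that by (simp add: velocity_def)
  qed
  then show "((snd c \<circ> \<gamma>) has_vector_derivative velocity A \<gamma> t c) (at t)" using c .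
  have cA: "c \<in> A" "\<gamma> t \<in> fst c" using c by (auto simp: charts_at_iff)
  have "continuous_on {a..b} \<gamma>" using assms(1) by (simp add: C1_path_def)
  then have "isCont \<gamma> t"
    by (rule continuous_on_interior) (use assms(2) in simp)
  then have "\<forall>\<^sub>F r in nhds t. \<gamma> r \<in> fst c"
    using cA chart(1)[OF cA(1)] by (simp add: continuous_at_open eventually_nhds)
  then obtain J where J: "open J" "t \<in> J" "\<And>r. r \<in> J \<Longrightarrow> \<gamma> r \<in> fst c"
    unfolding eventually_nhds by blast
  show "velocity A \<gamma> t = tvec A c (\<gamma> t) (velocity A \<gamma> t c)"
  proof
    fix c'
    show "velocity A \<gamma> t c' = tvec A c (\<gamma> t) (velocity A \<gamma> t c) c'"
    proof (cases "c' \<in> charts_at A (\<gamma> t)")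
      case True
      have "((snd c' \<circ> chart_inv c \<circ> (snd c \<circ> \<gamma>)) has_vector_derivative
          trans_deriv c c' (\<gamma> t) (velocity A \<gamma> t c)) (at t)"
        by (rule vector_derivative_diff_chain_within[OF vd[OF c]])
          (subst o_apply, rule has_derivative_at_withinI[OF transition_deriv[OF c True]])
      then have "((snd c' \<circ> \<gamma>) has_vector_derivative trans_deriv c c' (\<gamma> t) (velocity A \<gamma> t c)) (at t)"
        by (rule has_vector_derivative_transform_within_open[OF _ J(1,2)]) (use J(3) chart(5)[OF cA(1)] in auto)
      from vector_derivative_unique_at[OF vd[OF True] this]
      show ?thesis by (simp only: tvec_apply[OF True])
    next
      case False
      then show ?thesis by (simp add: velocity_def tvec_def)
    qed
  qed
qed

text \<open>Near each time the path stays in one chart domain, where the speed agrees with a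
  continuous function of the point and the coordinate derivative. The endpoints are excepted: the
  path supplies one-sided derivatives there, while \<open>velocity\<close> asks for a two-sided
  one.\<close>

lemma C1_path_speed_integrable:
  assumes "C1_path A {a..b} \<gamma>" shows "speed \<gamma> integrable_on {a..b}"
proof (rule integrable_on_little_subintervals[where 'b=real, unfolded cbox_interval], intro ballI)
  fix x assume x: "x \<in> {a..b}"
  obtain c where c: "c \<in> charts_at A (\<gamma> x)" using chart_ex by blast
  then have cA: "c \<in> A" "\<gamma> x \<in> fst c" by (auto simp: charts_at_iff)
  have cont: "continuous_on {a..b} \<gamma>" using assms by (simp add: C1_path_def)
  obtain w where w: "continuous_on {r \<in> {a..b}. \<gamma> r \<in> fst c} w"
    "\<And>r. r \<in> {a..b} \<Longrightarrow> \<gamma> r \<in> fst c \<Longrightarrow> ((snd c \<circ> \<gamma>) has_vector_derivative w r) (at r within {a..b})"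
    using assms cA unfolding C1_path_def by blast
  have "openin (top_of_set {a..b}) ({a..b} \<inter> \<gamma> -` fst c)"
    using cont chart(1)[OF cA(1)] continuous_openin_preimage_gen by blast
  then obtain d where d: "d > 0" "\<forall>r\<in>{a..b}. dist r x < d \<longrightarrow> r \<in> {a..b} \<inter> \<gamma> -` fst c"
    using x cA unfolding openin_euclidean_subtopology_iff by blast
  have d2: "\<gamma> r \<in> fst c" if "r \<in> {a..b}" "r \<in> ball x d" for r
    using d(2) that by (simp add: dist_commute)
  have "speed \<gamma> integrable_on {u..v}" if "{u..v} \<subseteq> ball x d" "{u..v} \<subseteq> {a..b}" for u v
  proof -
    have sub: "{u..v} \<subseteq> {r \<in> {a..b}. \<gamma> r \<in> fst c}" using d2 that by blast
    have "continuous_on {u..v} (\<lambda>t. (\<gamma> t, w t))"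
      by (intro continuous_on_Pair continuous_on_subset[OF cont that(2)] continuous_on_subset[OF w(1) sub])
    from continuous_on_compose2[OF nrm_continuous[OF cA(1)] this]
    have "continuous_on {u..v} (\<lambda>t. nrm c (\<gamma> t) (w t))" using sub by auto
    then have "(\<lambda>t. nrm c (\<gamma> t) (w t)) integrable_on {u..v}"
      by (rule integrable_continuous_interval)
    moreover have "speed \<gamma> t = nrm c (\<gamma> t) (w t)" if t: "t \<in> {u..v} - {a, b}" for t
    proof -
      have t': "t \<in> {a<..<b}" "t \<in> {a..b}" "\<gamma> t \<in> fst c" using t sub by (auto simp: subset_iff less_le)
      have ct: "c \<in> charts_at A (\<gamma> t)" using t' cA by (simp add: charts_at_iff)
      have "at t within {a..b} = at t" using t'(1) by (intro at_within_interior) auto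
      then have "((snd c \<circ> \<gamma>) has_vector_derivative w t) (at t)" using w(2)[OF t'(2,3)] by simp
      then have "velocity A \<gamma> t c = w t" using ct by (simp add: velocity_def vector_derivative_at)
      then show ?thesis using C1_path_regular[OF assms t'(1)] ct unfolding regular_at_def by metis
    qed
    ultimately show ?thesis using integrable_spike_finite[of "{a, b}" "{u..v}" "speed \<gamma>" "\<lambda>t. nrm c (\<gamma> t) (w t)"] by blast
  qed
  then show "\<exists>d>0. \<forall>u v. x \<in> {u..v} \<and> {u..v} \<subseteq> ball x d \<and> {u..v} \<subseteq> {a..b} \<longrightarrow> speed \<gamma> integrable_on {u..v}"
    using d(1) by blast
qed

lemma partition_path:
  assumes "\<And>i. i < n \<Longrightarrow> s i < s (Suc i) \<and> C1_path A {s i..s (Suc i)} \<gamma>"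
  shows "s 0 \<le> s n \<and> continuous_on {s 0..s n} \<gamma> \<and> speed \<gamma> integrable_on {s 0..s n} \<and>
    (\<forall>t\<in>{s 0..s n} - s ` {..n}. regular_at \<gamma> t)"
  using assms
proof (induction n)
  case 0
  then show ?case using integrable_on_refl[of "speed \<gamma>" "s 0"] by simp
next
  case (Suc n)
  then have IH: "s 0 \<le> s n" "continuous_on {s 0..s n} \<gamma>" "speed \<gamma> integrable_on {s 0..s n}"
    "\<And>t. t \<in> {s 0..s n} - s ` {..n} \<Longrightarrow> regular_at \<gamma> t" by auto
  have n: "s n < s (Suc n)" "C1_path A {s n..s (Suc n)} \<gamma>" using Suc.prems[of n] by auto
  have un: "{s 0..s (Suc n)} = {s 0..s n} \<union> {s n..s (Suc n)}" using IH(1) n(1) by auto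
  have "continuous_on {s 0..s (Suc n)} \<gamma>"
    unfolding un by (rule continuous_on_closed_Un) (use IH n in \<open>auto simp: C1_path_def\<close>)
  moreover have "speed \<gamma> integrable_on {s 0..s (Suc n)}"
    by (rule Henstock_Kurzweil_Integration.integrable_combine[OF IH(1) less_imp_le[OF n(1)] IH(3) C1_path_speed_integrable[OF n(2)]])
  moreover have "regular_at \<gamma> t" if "t \<in> {s 0..s (Suc n)} - s ` {..Suc n}" for t
  proof (cases "t \<le> s n")
    case True
    then show ?thesis using that by (intro IH(4)) auto
  next
    case False
    have "t \<noteq> s (Suc n)" using that by auto
    then show ?thesis using False that by (intro C1_path_regular[OF n(2)]) auto
  qed
  ultimately show ?case using IH(1) n(1) by auto
qed

lemma piecewise_C1_path:
  assumes "piecewise_C1_path A a b \<gamma>"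
  shows "a < b" "continuous_on {a..b} \<gamma>" "speed \<gamma> integrable_on {a..b}"
    "\<exists>S. finite S \<and> a \<in> S \<and> b \<in> S \<and> (\<forall>t\<in>{a..b} - S. regular_at \<gamma> t)"
proof -
  obtain n and s :: "nat \<Rightarrow> real" where s: "s 0 = a" "s n = b"
    "\<And>i. i < n \<Longrightarrow> s i < s (Suc i) \<and> C1_path A {s i..s (Suc i)} \<gamma>" and ab: "a < b"
    using assms unfolding piecewise_C1_path_def by blast
  note * = partition_path[of n s, OF s(3), unfolded s(1,2)]
  show "a < b" by (rule ab)
  show "continuous_on {a..b} \<gamma>" "speed \<gamma> integrable_on {a..b}" using * by auto
  have "finite (s ` {..n}) \<and> a \<in> s ` {..n} \<and> b \<in> s ` {..n} \<and> (\<forall>t\<in>{a..b} - s ` {..n}. regular_at \<gamma> t)"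
    using * s(1,2) by auto
  then show "\<exists>S. finite S \<and> a \<in> S \<and> b \<in> S \<and> (\<forall>t\<in>{a..b} - S. regular_at \<gamma> t)" by blast
qed

section \<open>Lengths under reversal, shift and concatenation\<close>

lemma path_len_nonneg:
  assumes "piecewise_C1_path A a b \<gamma>" shows "0 \<le> path_len A N a b \<gamma>"
proof -
  obtain S where S: "finite S" "\<And>t. t \<in> {a..b} - S \<Longrightarrow> regular_at \<gamma> t"
    using piecewise_C1_path(4)[OF assms] by blast
  let ?f = "\<lambda>t. if t \<in> S then 0 else speed \<gamma> t"
  have "path_len A N a b \<gamma> = integral {a..b} ?f"
    unfolding path_len_def by (rule integral_spike[of S]) (use S(1) in auto)
  moreover have "0 \<le> integral {a..b} ?f"
    by (rule integral_nonneg)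
      (use S piecewise_C1_path(3)[OF assms] in \<open>auto intro!: N_nonneg regular_at_velocity_in intro: integrable_spike_finite[of S _ _ "speed \<gamma>"]\<close>)
  ultimately show ?thesis by simp
qed

text \<open>The values \<open>l\<close> are those whose infimum is the Finsler distance. Carrying
  the length as an argument turns reversal and concatenation into symmetry and transitivity of a
  relation.\<close>

definition joins :: "'m \<Rightarrow> 'm \<Rightarrow> real \<Rightarrow> bool" where
  "joins p q l \<longleftrightarrow> (\<exists>a b \<gamma>. piecewise_C1_path A a b \<gamma> \<and> \<gamma> a = p \<and> \<gamma> b = q \<and> l = path_len A N a b \<gamma>)"

lemma finsler_dist_eq: "finsler_dist A N p q = Inf {l. joins p q l}"
  unfolding finsler_dist_def joins_def by (rule arg_cong[where f=Inf]) blast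

lemma joins_nonneg: "joins p q l \<Longrightarrow> 0 \<le> l"
  using path_len_nonneg by (auto simp: joins_def)

lemma velocity_affine:
  assumes "regular_at \<gamma> (m * t + k)"
  shows "velocity A (\<lambda>t. \<gamma> (m * t + k)) t = (\<lambda>c. m *\<^sub>R velocity A \<gamma> (m * t + k) c)"
proof
  fix c
  show "velocity A (\<lambda>t. \<gamma> (m * t + k)) t c = m *\<^sub>R velocity A \<gamma> (m * t + k) c"
  proof (cases "c \<in> charts_at A (\<gamma> (m * t + k))")
    case True
    have "((\<lambda>t. m * t + k) has_vector_derivative m) (at t)"
      by (auto intro!: derivative_eq_intros simp: has_real_derivative_iff_has_vector_derivative[symmetric])
    from vector_diff_chain_at[OF this, of "snd c \<circ> \<gamma>" "velocity A \<gamma> (m * t + k) c"]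
    have "((snd c \<circ> (\<lambda>t. \<gamma> (m * t + k))) has_vector_derivative m *\<^sub>R velocity A \<gamma> (m * t + k) c) (at t)"
      using assms True by (simp add: regular_at_def o_def)
    then show ?thesis using True by (simp add: velocity_def vector_derivative_at)
  qed (simp add: velocity_def)
qed

text \<open>A change of variables in the integral; for slope -1 the velocity changes sign, which the
  norm does not see. The finitely many preimages of irregular times are discarded.\<close>

lemma path_len_affine:
  assumes \<gamma>: "piecewise_C1_path A a b \<gamma>" and m: "\<bar>m\<bar> = 1" and ab: "(\<lambda>t. m * t + k) -` {a..b} = {a'..b'}"
  shows "path_len A N a' b' (\<lambda>t. \<gamma> (m * t + k)) = path_len A N a b \<gamma>"
proof -
  have m1: "m = 1 \<or> m = - 1" using m by linarith
  obtain S where S: "finite S" "\<And>t. t \<in> {a..b} - S \<Longrightarrow> regular_at \<gamma> t"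
    using piecewise_C1_path(4)[OF \<gamma>] by blast
  have "(speed \<gamma> has_integral path_len A N a b \<gamma>) (cbox a b)"
    unfolding path_len_def using piecewise_C1_path(3)[OF \<gamma>] by (simp add: integrable_integral)
  from has_integral_affinity[OF this, of m k]
  have "((\<lambda>t. speed \<gamma> (m * t + k)) has_integral path_len A N a b \<gamma>) ((\<lambda>x. (1 / m) * x + - ((1 / m) * k)) ` {a..b})"
    using m m1 by auto
  moreover have "(\<lambda>x. (1 / m) * x + - ((1 / m) * k)) ` {a..b} = {a'..b'}"
    unfolding ab[symmetric] using m1 by (force simp: image_iff)
  ultimately have "integral {a'..b'} (\<lambda>t. speed \<gamma> (m * t + k)) = path_len A N a b \<gamma>" by (simp add: integral_unique)
  moreover have "path_len A N a' b' (\<lambda>t. \<gamma> (m * t + k)) = integral {a'..b'} (\<lambda>t. speed \<gamma> (m * t + k))"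
    unfolding path_len_def
  proof (rule integral_spike[of "(\<lambda>t. m * (t - k)) ` S"])
    show "negligible ((\<lambda>t. m * (t - k)) ` S)" using S(1) by auto
    fix t assume t: "t \<in> {a'..b'} - (\<lambda>t. m * (t - k)) ` S"
    have "t = m * (m * t + k - k)" using m1 by auto
    then have "m * t + k \<notin> S" using t by blast
    then have reg: "regular_at \<gamma> (m * t + k)" using t ab by (intro S(2)) auto
    show "speed \<gamma> (m * t + k) = speed (\<lambda>t. \<gamma> (m * t + k)) t"
      using m1 velocity_affine[OF reg] N_uminus[OF regular_at_velocity_in[OF reg]] by auto
  qed
  ultimately show ?thesis by simp
qed

lemma joins_sym:
  assumes "joins p q l" shows "joins q p l"
proof -
  obtain a b \<gamma> where \<gamma>: "piecewise_C1_path A a b \<gamma>" "\<gamma> a = p" "\<gamma> b = q" "l = path_len A N a b \<gamma>"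
    using assms by (auto simp: joins_def)
  obtain n and s :: "nat \<Rightarrow> real" where s: "s 0 = a" "s n = b"
    "\<And>i. i < n \<Longrightarrow> s i < s (Suc i) \<and> C1_path A {s i..s (Suc i)} \<gamma>" and ab: "a < b"
    using \<gamma>(1) unfolding piecewise_C1_path_def by blast
  let ?g = "\<lambda>t. \<gamma> (- 1 * t + 0)"
  have "piecewise_C1_path A (- b) (- a) ?g"
    unfolding piecewise_C1_path_def
  proof (intro conjI exI[of _ n] exI[of _ "\<lambda>i. - s (n - i)"] allI impI)
    fix i assume i: "i < n"
    have ni: "n - i = Suc (n - Suc i)" using i by auto
    have *: "s (n - Suc i) < s (n - i)" "C1_path A {s (n - Suc i)..s (n - i)} \<gamma>"
      using s(3)[of "n - Suc i"] i unfolding ni by auto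
    show "- s (n - i) < - s (n - Suc i)" using * by simp
    have "(\<lambda>t. - 1 * t + 0) -` {s (n - Suc i)..s (n - i)} = {- s (n - i)..- s (n - Suc i)}" by auto
    then show "C1_path A {- s (n - i)..- s (n - Suc i)} ?g"
      using C1_path_affine[OF *(2), of "-1" 0] by simp
  qed (use s ab in auto)
  moreover have "path_len A N (- b) (- a) ?g = l"
    unfolding \<gamma>(4) by (rule path_len_affine[OF \<gamma>(1)]) auto
  moreover have "?g (- b) = q" "?g (- a) = p" using \<gamma> by auto
  ultimately show ?thesis unfolding joins_def by blast
qed

lemma joins_shift:
  assumes "piecewise_C1_path A a b \<gamma>"
  shows "piecewise_C1_path A (a - k) (b - k) (\<lambda>t. \<gamma> (t + k))"
    "path_len A N (a - k) (b - k) (\<lambda>t. \<gamma> (t + k)) = path_len A N a b \<gamma>"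
proof -
  obtain n and s :: "nat \<Rightarrow> real" where s: "s 0 = a" "s n = b"
    "\<And>i. i < n \<Longrightarrow> s i < s (Suc i) \<and> C1_path A {s i..s (Suc i)} \<gamma>" and ab: "a < b"
    using assms unfolding piecewise_C1_path_def by blast
  show "piecewise_C1_path A (a - k) (b - k) (\<lambda>t. \<gamma> (t + k))"
    unfolding piecewise_C1_path_def
  proof (intro conjI exI[of _ n] exI[of _ "\<lambda>i. s i - k"] allI impI)
    fix i assume i: "i < n"
    show "s i - k < s (Suc i) - k" using s(3)[OF i] by simp
    have "(\<lambda>t. 1 * t + k) -` {s i..s (Suc i)} = {s i - k..s (Suc i) - k}" by auto
    then show "C1_path A {s i - k..s (Suc i) - k} (\<lambda>t. \<gamma> (t + k))"
      using C1_path_affine[of A "{s i..s (Suc i)}" \<gamma> 1 k] s(3)[OF i] by simp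
  qed (use s ab in auto)
  show "path_len A N (a - k) (b - k) (\<lambda>t. \<gamma> (t + k)) = path_len A N a b \<gamma>"
    using path_len_affine[OF assms, of 1 k "a - k" "b - k"] by force
qed

text \<open>The second path is shifted to start at time \<open>b\<close> and the partitions are
  joined at index \<open>n\<close>, where both prescriptions agree. Away from \<open>b\<close> the
  new path coincides locally with one of the old ones, hence so does its velocity.\<close>

lemma joins_trans:
  assumes "joins p q l" "joins q r l'" shows "joins p r (l + l')"
proof -
  obtain a b \<gamma> where \<gamma>: "piecewise_C1_path A a b \<gamma>" "\<gamma> a = p" "\<gamma> b = q" "l = path_len A N a b \<gamma>"
    using assms by (auto simp: joins_def)
  obtain a0 b0 \<gamma>0 where \<gamma>0: "piecewise_C1_path A a0 b0 \<gamma>0" "\<gamma>0 a0 = q" "\<gamma>0 b0 = r" "l' = path_len A N a0 b0 \<gamma>0"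
    using assms by (auto simp: joins_def)
  define \<gamma>' e where "\<gamma>' = (\<lambda>t. \<gamma>0 (t + (a0 - b)))" and "e = b0 - (a0 - b)"
  have \<gamma>': "piecewise_C1_path A b e \<gamma>'" "\<gamma>' b = q" "\<gamma>' e = r" "l' = path_len A N b e \<gamma>'"
    using joins_shift[OF \<gamma>0(1), of "a0 - b"] \<gamma>0 by (auto simp: \<gamma>'_def e_def)
  define \<delta> where "\<delta> t = (if t \<le> b then \<gamma> t else \<gamma>' t)" for t
  have \<delta>: "t \<le> b \<Longrightarrow> \<delta> t = \<gamma> t" "b \<le> t \<Longrightarrow> \<delta> t = \<gamma>' t" for t
    using \<gamma> \<gamma>' by (auto simp: \<delta>_def)
  obtain n and s :: "nat \<Rightarrow> real" where s: "s 0 = a" "s n = b"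
    "\<And>i. i < n \<Longrightarrow> s i < s (Suc i) \<and> C1_path A {s i..s (Suc i)} \<gamma>" and ab: "a < b"
    using \<gamma>(1) unfolding piecewise_C1_path_def by blast
  obtain n' and s' :: "nat \<Rightarrow> real" where s': "s' 0 = b" "s' n' = e"
    "\<And>i. i < n' \<Longrightarrow> s' i < s' (Suc i) \<and> C1_path A {s' i..s' (Suc i)} \<gamma>'" and be: "b < e"
    using \<gamma>'(1) unfolding piecewise_C1_path_def by blast
  have mono: "s i \<le> s j" if "i \<le> j" "j \<le> n" for i j
    by (rule mono_upto[OF _ that]) (use s(3) in force)
  have mono': "s' i \<le> s' j" if "i \<le> j" "j \<le> n'" for i j
    by (rule mono_upto[OF _ that]) (use s'(3) in force)
  define \<sigma> where "\<sigma> i = (if i \<le> n then s i else s' (i - n))" for i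
  have \<sigma>: "i \<le> n \<Longrightarrow> \<sigma> i = s i" "n \<le> i \<Longrightarrow> \<sigma> i = s' (i - n)" for i
    using s s' by (auto simp: \<sigma>_def)
  have pw: "piecewise_C1_path A a e \<delta>"
    unfolding piecewise_C1_path_def
  proof (intro conjI exI[of _ "n + n'"] exI[of _ \<sigma>] allI impI)
    fix i assume i: "i < n + n'"
    have "\<sigma> i < \<sigma> (Suc i) \<and> C1_path A {\<sigma> i..\<sigma> (Suc i)} \<delta>"
    proof (cases "i < n")
      case True
      then have "\<sigma> i = s i" "\<sigma> (Suc i) = s (Suc i)" by (auto simp: \<sigma>)
      moreover have "C1_path A {s i..s (Suc i)} \<delta>"
        by (rule C1_path_cong[of _ _ \<gamma>]) (use s(3)[OF True] mono[of "Suc i" n] True \<delta> s(2) in auto)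
      ultimately show ?thesis using s(3)[OF True] by simp
    next
      case False
      then have eq: "\<sigma> i = s' (i - n)" "\<sigma> (Suc i) = s' (Suc (i - n))" by (auto simp: \<sigma> Suc_diff_le)
      have in': "i - n < n'" using False i by auto
      have "C1_path A {s' (i - n)..s' (Suc (i - n))} \<delta>"
        by (rule C1_path_cong[of _ _ \<gamma>']) (use s'(3)[OF in'] mono'[of 0 "i - n"] in' \<delta> s'(1) in auto)
      then show ?thesis using s'(3)[OF in'] eq by simp
    qed
    then show "\<sigma> i < \<sigma> (Suc i)" "C1_path A {\<sigma> i..\<sigma> (Suc i)} \<delta>" by auto
  qed (use ab be s s' \<sigma> in auto)
  have "path_len A N a e \<delta> = integral {a..b} (speed \<delta>) + integral {b..e} (speed \<delta>)"
    unfolding path_len_def using piecewise_C1_path(3)[OF pw] ab be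
    by (intro Henstock_Kurzweil_Integration.integral_combine[symmetric]) auto
  also have "integral {a..b} (speed \<delta>) = l"
    unfolding \<gamma>(4) path_len_def
  proof (rule integral_spike[of "{b}"])
    fix t assume t: "t \<in> {a..b} - {b}"
    then have "\<forall>\<^sub>F r in nhds t. r < b" by (intro eventually_nhds[THEN iffD2] exI[of _ "{..<b}"]) auto
    then have "\<forall>\<^sub>F r in nhds t. \<delta> r = \<gamma> r" by eventually_elim (simp add: \<delta>)
    from velocity_cong[OF this, of A] show "speed \<gamma> t = speed \<delta> t" using t by (simp add: \<delta>)
  qed simp
  also have "integral {b..e} (speed \<delta>) = l'"
    unfolding \<gamma>'(4) path_len_def
  proof (rule integral_spike[of "{b}"])
    fix t assume t: "t \<in> {b..e} - {b}"
    then have "\<forall>\<^sub>F r in nhds t. b < r" by (intro eventually_nhds[THEN iffD2] exI[of _ "{b<..}"]) auto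
    then have "\<forall>\<^sub>F r in nhds t. \<delta> r = \<gamma>' r" by eventually_elim (simp add: \<delta>)
    from velocity_cong[OF this, of A] show "speed \<gamma>' t = speed \<delta> t" using t by (simp add: \<delta>)
  qed simp
  finally have "path_len A N a e \<delta> = l + l'" .
  moreover have "\<delta> a = p" "\<delta> e = r" using \<gamma> \<gamma>' ab be \<delta> by auto
  ultimately show ?thesis unfolding joins_def using pw by metis
qed


section \<open>Path lengths compared with coordinate norms\<close>

text \<open>A straight segment in the chart has constant coordinate velocity \<open>y' - y\<close>,
  so the bound on that vector along \<open>S\<close> bounds its speed. Upper estimates of the
  distance in a chart come from these paths.\<close>

lemma joins_line:
  assumes c: "c \<in> A" and S: "convex S" "S \<subseteq> snd c ` fst c" and y: "y \<in> S" "y' \<in> S"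
    and le: "\<And>z. z \<in> S \<Longrightarrow> nrm c (chart_inv c z) (y' - y) \<le> l"
  shows "\<exists>l'\<le>l. joins (chart_inv c y) (chart_inv c y') l'"
proof -
  define L where "L t = y + t *\<^sub>R (y' - y)" for t :: real
  define \<gamma> where "\<gamma> t = chart_inv c (L t)" for t
  have LS: "L t \<in> S" if "t \<in> {0..1}" for t
  proof -
    have "L t = (1 - t) *\<^sub>R y + t *\<^sub>R y'" by (simp add: L_def algebra_simps)
    then show ?thesis using convexD_alt[OF S(1) y, of t] that by simp
  qed
  have LU: "L t \<in> snd c ` fst c" if "t \<in> {0..1}" for t using LS[OF that] S(2) by blast
  have \<gamma>U: "\<gamma> t \<in> fst c" if "t \<in> {0..1}" for t
    unfolding \<gamma>_def by (rule chart(7)[OF c LU[OF that]])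
  have L\<gamma>: "snd c (\<gamma> t) = L t" if "t \<in> {0..1}" for t
    unfolding \<gamma>_def by (rule chart(6)[OF c LU[OF that]])
  have Ld: "(L has_vector_derivative (y' - y)) (at t within T)" for t T
    unfolding L_def[abs_def] by (auto intro!: derivative_eq_intros simp: has_vector_derivative_def)
  have cL: "continuous_on T L" for T unfolding L_def[abs_def] by (intro continuous_intros)
  have path: "C1_path A {0..1} \<gamma>"
    unfolding C1_path_def
  proof (intro conjI ballI)
    show "continuous_on {0..1} \<gamma>"
      unfolding \<gamma>_def[abs_def] using LU by (intro continuous_on_compose2[OF chart(4)[OF c] cL]) blast
    fix c' assume c': "c' \<in> A"
    let ?V = "snd c ` (fst c \<inter> fst c')" and ?F = "snd c' \<circ> chart_inv c"
    obtain F' where F': "\<And>x. x \<in> ?V \<Longrightarrow> (?F has_derivative blinfun_apply (F' x)) (at x)"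
      "continuous_on ?V F'" using transition_C1[OF c c'] unfolding C1_on_def by blast
    have V: "L r \<in> ?V" if "r \<in> {0..1}" "\<gamma> r \<in> fst c'" for r
      using \<gamma>U[OF that(1)] that(2) L\<gamma>[OF that(1), symmetric] by blast
    show "\<exists>w. continuous_on {r \<in> {0..1}. \<gamma> r \<in> fst c'} w \<and>
       (\<forall>r\<in>{0..1}. \<gamma> r \<in> fst c' \<longrightarrow> ((snd c' \<circ> \<gamma>) has_vector_derivative w r) (at r within {0..1}))"
    proof (intro exI[of _ "\<lambda>r. blinfun_apply (F' (L r)) (y' - y)"] conjI ballI impI)
      show "continuous_on {r \<in> {0..1}. \<gamma> r \<in> fst c'} (\<lambda>r. blinfun_apply (F' (L r)) (y' - y))"
        by (intro continuous_intros continuous_on_compose2[OF F'(2) cL]) (use V in blast)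
      fix r :: real assume r: "r \<in> {0..1}" "\<gamma> r \<in> fst c'"
      have "((?F \<circ> L) has_vector_derivative blinfun_apply (F' (L r)) (y' - y)) (at r within {0..1})"
        by (rule vector_derivative_diff_chain_within[OF Ld has_derivative_at_withinI[OF F'(1)[OF V[OF r]]]])
      moreover have "?F \<circ> L = snd c' \<circ> \<gamma>" by (auto simp: \<gamma>_def)
      ultimately show "((snd c' \<circ> \<gamma>) has_vector_derivative blinfun_apply (F' (L r)) (y' - y)) (at r within {0..1})"
        by simp
    qed
  qed
  have pw: "piecewise_C1_path A 0 1 \<gamma>"
    unfolding piecewise_C1_path_def using path
    by (intro conjI exI[of _ "1::nat"] exI[of _ "real"]) auto
  have "speed \<gamma> t \<le> l" if t: "t \<in> {0<..<1}" for t
  proof -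
    have t': "t \<in> {0..1}" using t by auto
    have ct: "c \<in> charts_at A (\<gamma> t)" using \<gamma>U[OF t'] c by (simp add: charts_at_iff)
    have reg: "regular_at \<gamma> t" by (rule C1_path_regular[OF path t])
    have "((snd c \<circ> \<gamma>) has_vector_derivative (y' - y)) (at t)"
      by (rule has_vector_derivative_transform_within_open[OF Ld open_greaterThanLessThan t]) (use L\<gamma> in auto)
    then have "velocity A \<gamma> t c = y' - y"
      using reg ct unfolding regular_at_def by (meson vector_derivative_unique_at)
    then have "speed \<gamma> t = nrm c (\<gamma> t) (y' - y)"
      using reg ct unfolding regular_at_def by metis
    then show ?thesis using le[OF LS[OF t']] by (simp add: \<gamma>_def)
  qed
  then have *: "(if t \<in> {0, 1} then l else speed \<gamma> t) \<le> l" if "t \<in> {0..1}" for t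
    using that by (auto simp: less_le)
  have int: "(\<lambda>t. if t \<in> {0, 1} then l else speed \<gamma> t) integrable_on {0..1}"
    by (rule integrable_spike_finite[of "{0, 1}" _ _ "speed \<gamma>"]) (use piecewise_C1_path(3)[OF pw] in auto)
  have "path_len A N 0 1 \<gamma> = integral {0..1} (\<lambda>t. if t \<in> {0, 1} then l else speed \<gamma> t)"
    unfolding path_len_def by (rule integral_spike[of "{0, 1}"]) auto
  also have "\<dots> \<le> integral {0..1} (\<lambda>t::real. l)"
    by (rule integral_le[OF int]) (use * in auto)
  finally have "path_len A N 0 1 \<gamma> \<le> l" by simp
  moreover have "joins (chart_inv c y) (chart_inv c y') (path_len A N 0 1 \<gamma>)"
  proof -
    have "\<gamma> 0 = chart_inv c y" "\<gamma> 1 = chart_inv c y'" by (simp_all add: \<gamma>_def L_def)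
    then show ?thesis unfolding joins_def using pw by blast
  qed
  ultimately show ?thesis by blast
qed

text \<open>The fundamental theorem, with finitely many exceptional times, expresses the
  displacement by the coordinate velocity, and the speed dominates \<open>k\<close> times the norm
  of that velocity. This is the source of lower bounds on lengths.\<close>

lemma chart_displacement:
  assumes \<gamma>: "piecewise_C1_path A a b \<gamma>" and c: "c \<in> A" and st: "a \<le> s" "s \<le> t" "t \<le> b"
    and U: "\<And>r. r \<in> {s..t} \<Longrightarrow> \<gamma> r \<in> fst c" and k: "0 < k"
    and le: "\<And>r v. r \<in> {s..t} \<Longrightarrow> k * norm v \<le> nrm c (\<gamma> r) v"
  shows "k * norm (snd c (\<gamma> t) - snd c (\<gamma> s)) \<le> integral {s..t} (speed \<gamma>)"
proof -
  obtain S where S: "finite S" "\<And>t. t \<in> {a..b} - S \<Longrightarrow> regular_at \<gamma> t"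
    using piecewise_C1_path(4)[OF \<gamma>] by blast
  have sub: "{s..t} \<subseteq> {a..b}" using st by auto
  have ct: "c \<in> charts_at A (\<gamma> r)" if "r \<in> {s..t}" for r using U[OF that] c by (simp add: charts_at_iff)
  define f where "f r = (if r \<in> S then 0 else velocity A \<gamma> r c)" for r
  define g where "g r = (if r \<in> S then 0 else speed \<gamma> r)" for r
  have "((\<lambda>r. velocity A \<gamma> r c) has_integral ((snd c \<circ> \<gamma>) t - (snd c \<circ> \<gamma>) s)) {s..t}"
  proof (rule fundamental_theorem_of_calculus_interior_strong[OF S(1) st(2)])
    fix r assume r: "r \<in> {s<..<t} - S"
    then have "r \<in> {a..b} - S" "r \<in> {s..t}" using st by auto
    then show "((snd c \<circ> \<gamma>) has_vector_derivative velocity A \<gamma> r c) (at r)"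
      using S(2) ct unfolding regular_at_def by blast
  next
    show "continuous_on {s..t} (snd c \<circ> \<gamma>)"
      using continuous_on_subset[OF piecewise_C1_path(2)[OF \<gamma>] sub] U
      by (intro continuous_on_compose continuous_on_subset[OF chart(3)[OF c]]) auto
  qed
  then have f: "(f has_integral ((snd c \<circ> \<gamma>) t - (snd c \<circ> \<gamma>) s)) {s..t}"
    by (rule has_integral_spike_finite[OF S(1), rotated]) (simp add: f_def)
  have "speed \<gamma> integrable_on {s..t}"
    using integrable_on_subinterval[OF piecewise_C1_path(3)[OF \<gamma>] sub] .
  then have "(speed \<gamma> has_integral integral {s..t} (speed \<gamma>)) {s..t}" by (rule integrable_integral)
  then have g: "(g has_integral integral {s..t} (speed \<gamma>)) {s..t}"
    by (rule has_integral_spike_finite[OF S(1), rotated]) (simp add: g_def)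
  have kf: "((\<lambda>r. k *\<^sub>R f r) has_integral k *\<^sub>R ((snd c \<circ> \<gamma>) t - (snd c \<circ> \<gamma>) s)) {s..t}"
    by (rule has_integral_cmul[OF f])
  have "norm (k *\<^sub>R f r) \<le> g r" if r: "r \<in> {s..t}" for r
  proof (cases "r \<in> S")
    case False
    then have "velocity A \<gamma> r = tvec A c (\<gamma> r) (velocity A \<gamma> r c)"
      using S(2)[of r] ct[OF r] sub r unfolding regular_at_def by blast
    then show ?thesis using le[OF r, of "velocity A \<gamma> r c"] k False by (simp add: f_def g_def)
  qed (simp add: f_def g_def)
  then have "norm (integral {s..t} (\<lambda>r. k *\<^sub>R f r)) \<le> integral {s..t} g"
    using kf g by (intro Henstock_Kurzweil_Integration.integral_norm_bound_integral) auto
  then show ?thesis using integral_unique[OF kf] integral_unique[OF g] k by simp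
qed

text \<open>The length bound makes the chart image of the path Cauchy up to the first exit time, so by completeness
  of the model space the path cannot leave the chart domain while its image stays inside the ball.\<close>

lemma joins_escape:
  assumes c: "c \<in> charts_at A x0" and k: "0 < k" and \<rho>: "0 < \<rho>" "ball (snd c x0) \<rho> \<subseteq> snd c ` fst c"
    and le: "\<And>y v. y \<in> ball (snd c x0) \<rho> \<Longrightarrow> k * norm v \<le> nrm c (chart_inv c y) v"
    and j: "joins x0 x l" "l < k * \<rho>"
  shows "x \<in> fst c \<and> snd c x \<in> ball (snd c x0) \<rho>"
proof -
  have cA: "c \<in> A" "x0 \<in> fst c" using c by (auto simp: charts_at_iff)
  obtain a b \<gamma> where \<gamma>: "piecewise_C1_path A a b \<gamma>" "\<gamma> a = x0" "\<gamma> b = x" "l = path_len A N a b \<gamma>"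
    using j(1) by (auto simp: joins_def)
  note pw = piecewise_C1_path[OF \<gamma>(1)]
  define W where "W = {z \<in> fst c. snd c z \<in> ball (snd c x0) \<rho>}"
  have "W = fst c \<inter> snd c -` ball (snd c x0) \<rho>" by (auto simp: W_def)
  then have oW: "open W" using continuous_open_preimage[OF chart(3,1)[OF cA(1)] open_ball] by simp
  have "\<gamma> b \<in> W"
  proof (rule ccontr)
    assume nb: "\<gamma> b \<notin> W"
    \<comment> \<open>\<open>E\<close> collects the times at which the path is outside
      \<open>W\<close>. It is compact, and its least element \<tau> is the first exit time.\<close>
    define E where "E = {a..b} \<inter> \<gamma> -` (- W)"
    have "closed E" unfolding E_def using oW
      by (intro continuous_closed_preimage pw) auto
    moreover have "bounded E" unfolding E_def by (rule bounded_subset[of "{a..b}"]) auto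
    moreover have "b \<in> E" using nb pw(1) by (simp add: E_def)
    ultimately obtain \<tau> where \<tau>: "\<tau> \<in> E" "\<And>t. t \<in> E \<Longrightarrow> \<tau> \<le> t"
      using compact_attains_inf[of E] compact_eq_bounded_closed[of E] by blast
    have "\<tau> \<noteq> a" using \<tau>(1) \<gamma>(2) cA \<rho> by (auto simp: E_def W_def)
    then have ab: "a < \<tau>" "\<tau> \<le> b" using \<tau>(1) by (auto simp: E_def)
    have inW: "\<gamma> t \<in> W" if "a \<le> t" "t < \<tau>" for t
      using \<tau>(2)[of t] that ab by (force simp: E_def)
    define F where "F t = integral {a..t} (speed \<gamma>)" for t
    have disp: "k * norm (snd c (\<gamma> t) - snd c (\<gamma> s)) \<le> F t - F s" if "a \<le> s" "s \<le> t" "t < \<tau>" for s t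
    proof -
      have "k * norm (snd c (\<gamma> t) - snd c (\<gamma> s)) \<le> integral {s..t} (speed \<gamma>)"
      proof (rule chart_displacement[OF \<gamma>(1) cA(1) that(1,2) _ _ k])
        show "t \<le> b" using that ab by simp
        fix r assume r: "r \<in> {s..t}"
        then have rW: "\<gamma> r \<in> W" using inW that by simp
        then show "\<gamma> r \<in> fst c" by (simp add: W_def)
        show "k * norm v \<le> nrm c (\<gamma> r) v" for v
          using le[of "snd c (\<gamma> r)" v] rW chart(5)[OF cA(1), of "\<gamma> r"] by (simp add: W_def)
      qed
      moreover have "F s + integral {s..t} (speed \<gamma>) = F t"
        unfolding F_def using that ab
        by (intro Henstock_Kurzweil_Integration.integral_combine integrable_on_subinterval[OF pw(3)]) auto
      ultimately show ?thesis by simp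
    qed
    have Fl: "F t \<le> l" if "a \<le> t" "t \<le> b" for t
    proof -
      obtain S where S: "finite S" "\<And>t. t \<in> {a..b} - S \<Longrightarrow> regular_at \<gamma> t" using pw(4) by blast
      let ?g = "\<lambda>r. if r \<in> S then 0 else speed \<gamma> r"
      have it: "?g integrable_on {a..b}"
        by (rule integrable_spike_finite[OF S(1) _ pw(3)]) simp
      have "F t = integral {a..t} ?g"
        unfolding F_def by (rule integral_spike[of S]) (use S(1) in auto)
      also have "\<dots> \<le> integral {a..b} ?g"
        using that S(2) by (intro integral_subset_le integrable_on_subinterval[OF it] it)
          (auto intro!: N_nonneg regular_at_velocity_in)
      also have "\<dots> = l" unfolding \<gamma>(4) path_len_def by (rule integral_spike[of S]) (use S(1) in auto)
      finally show ?thesis .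
    qed
    \<comment> \<open>Times increasing to \<tau>: the displacement estimate is available only
      strictly before the exit, so the position at \<tau> has to be reached as a limit.\<close>
    define t where "t n = \<tau> - (\<tau> - a) / real (Suc n)" for n
    have t: "a \<le> t n" "t n < \<tau>" "t n \<le> b" for n
    proof -
      have "(\<tau> - a) / real (Suc n) \<le> (\<tau> - a) / 1" using ab by (intro divide_left_mono) auto
      then show "a \<le> t n" by (simp add: t_def)
      show "t n < \<tau>" using ab by (simp add: t_def)
      then show "t n \<le> b" using ab by simp
    qed
    have mono: "t m \<le> t n" if "m \<le> n" for m n
      unfolding t_def using that ab by (intro diff_left_mono divide_left_mono) auto
    have "t \<longlonglongrightarrow> \<tau> - 0"
      unfolding t_def by (intro tendsto_diff tendsto_const LIMSEQ_Suc[OF lim_const_over_n])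
    then have tl: "t \<longlonglongrightarrow> \<tau>" by simp
    have "continuous_on {a..b} F" unfolding F_def by (rule indefinite_integral_continuous_1[OF pw(3)])
    then have "(\<lambda>n. F (t n)) \<longlonglongrightarrow> F \<tau>"
      by (rule continuous_on_tendsto_compose[OF _ tl]) (use t ab in auto)
    then have CF: "Cauchy (\<lambda>n. F (t n))" by (rule LIMSEQ_imp_Cauchy)
    have "Cauchy (\<lambda>n. snd c (\<gamma> (t n)))"
    proof (rule CauchyI')
      fix e :: real assume "0 < e"
      then obtain M where M: "\<And>m n. m \<ge> M \<Longrightarrow> n \<ge> M \<Longrightarrow> dist (F (t m)) (F (t n)) < k * e"
        using CF k unfolding Cauchy_def by (metis mult_pos_pos)
      have "dist (snd c (\<gamma> (t m))) (snd c (\<gamma> (t n))) < e" if "m \<ge> M" "m < n" for m n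
      proof -
        have "k * dist (snd c (\<gamma> (t m))) (snd c (\<gamma> (t n))) \<le> F (t n) - F (t m)"
          using disp[OF t(1) mono t(2), of m n] that by (simp add: dist_norm norm_minus_commute)
        also have "\<dots> < k * e" using M[of m n] that by (simp add: dist_real_def abs_if split: if_splits)
        finally show ?thesis using k by simp
      qed
      then show "\<exists>M. \<forall>m\<ge>M. \<forall>n>m. dist (snd c (\<gamma> (t m))) (snd c (\<gamma> (t n))) < e" by blast
    qed
    then obtain y where y: "(\<lambda>n. snd c (\<gamma> (t n))) \<longlonglongrightarrow> y" using Cauchy_convergent convergent_def by blast
    have "norm (snd c (\<gamma> (t n)) - snd c x0) \<le> l / k" for n
    proof -
      have "k * norm (snd c (\<gamma> (t n)) - snd c x0) \<le> F (t n) - F a"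
        using disp[of a "t n"] t \<gamma>(2) by simp
      also have "\<dots> \<le> l" using Fl[of "t n"] t by (simp add: F_def)
      finally show ?thesis using k by (simp add: field_simps)
    qed
    moreover have "(\<lambda>n. norm (snd c (\<gamma> (t n)) - snd c x0)) \<longlonglongrightarrow> norm (y - snd c x0)"
      by (intro tendsto_intros y)
    ultimately have "norm (y - snd c x0) \<le> l / k"
      by (intro LIMSEQ_le_const2) auto
    \<comment> \<open>Only a weak inequality survives the limit; the strict bound on
      \<open>l\<close> keeps the limit point inside the open ball.\<close>
    moreover have "l / k < \<rho>" using j(2) k by (simp add: pos_divide_less_eq mult.commute)
    ultimately have yb: "y \<in> ball (snd c x0) \<rho>" by (simp add: dist_norm norm_minus_commute)
    then have yU: "y \<in> snd c ` fst c" using \<rho> by blast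
    have "(\<lambda>n. chart_inv c (snd c (\<gamma> (t n)))) \<longlonglongrightarrow> chart_inv c y"
    proof (rule continuous_on_tendsto_compose[OF chart(4)[OF cA(1)] y yU])
      show "\<forall>\<^sub>F n in sequentially. snd c (\<gamma> (t n)) \<in> snd c ` fst c"
        using inW[OF t(1,2)] by (auto simp: W_def)
    qed
    moreover have "chart_inv c (snd c (\<gamma> (t n))) = \<gamma> (t n)" for n
      using inW[OF t(1,2), of n] chart(5)[OF cA(1)] by (simp add: W_def)
    ultimately have 1: "(\<lambda>n. \<gamma> (t n)) \<longlonglongrightarrow> chart_inv c y" by simp
    have 2: "(\<lambda>n. \<gamma> (t n)) \<longlonglongrightarrow> \<gamma> \<tau>"
      by (rule continuous_on_tendsto_compose[OF pw(2) tl]) (use t ab in auto)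
    have "\<gamma> \<tau> = chart_inv c y" using LIMSEQ_unique[OF 2 1] .
    then have "\<gamma> \<tau> \<in> W" using chart(6,7)[OF cA(1) yU] yb by (simp add: W_def)
    then show False using \<tau>(1) by (simp add: E_def)
  qed
  then show ?thesis using \<gamma>(3) by (simp add: W_def)
qed

subsection \<open>The Finsler distance\<close>

abbreviation d :: "'m \<Rightarrow> 'm \<Rightarrow> real" where "d \<equiv> finsler_dist A N"

lemma d_le: "joins p q l \<Longrightarrow> d p q \<le> l"
  unfolding finsler_dist_eq by (rule cInf_lower) (auto intro!: bdd_belowI[of _ 0] joins_nonneg)

text \<open>The neighbourhood from (P2) is shrunk to a coordinate ball, whose convexity allows
  segments between any two of its points. All chart estimates for the distance start here, with
  \<eta> = 1 where the constant is immaterial.\<close>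

lemma chart_ball:
  assumes c: "c \<in> charts_at A x0" and \<eta>: "0 < \<eta>"
  obtains \<rho> where "0 < \<rho>" "ball (snd c x0) \<rho> \<subseteq> snd c ` fst c"
    "\<And>y v. y \<in> ball (snd c x0) \<rho> \<Longrightarrow> nrm c x0 v \<le> (1 + \<eta>) * nrm c (chart_inv c y) v"
    "\<And>y v. y \<in> ball (snd c x0) \<rho> \<Longrightarrow> nrm c (chart_inv c y) v \<le> (1 + \<eta>) * nrm c x0 v"
    "\<And>y y'. y \<in> ball (snd c x0) \<rho> \<Longrightarrow> y' \<in> ball (snd c x0) \<rho> \<Longrightarrow> \<exists>l. joins (chart_inv c y) (chart_inv c y') l"
    "\<And>y y'. y \<in> ball (snd c x0) \<rho> \<Longrightarrow> y' \<in> ball (snd c x0) \<rho> \<Longrightarrow>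
      d (chart_inv c y) (chart_inv c y') \<le> (1 + \<eta>) * nrm c x0 (y' - y)"
proof -
  have cA: "c \<in> A" "x0 \<in> fst c" using c by (auto simp: charts_at_iff)
  obtain W where W: "open W" "x0 \<in> W" "W \<subseteq> fst c"
    "\<And>x v. x \<in> W \<Longrightarrow> 1 / (1 + \<eta>) * nrm c x0 v \<le> nrm c x v"
    "\<And>x v. x \<in> W \<Longrightarrow> nrm c x v \<le> (1 + \<eta>) * nrm c x0 v"
    using finsler c \<eta> unfolding C1_finsler_manifold_def by metis
  have "open (snd c ` W)" by (rule chart_open_image[OF cA(1) W(1,3)])
  then obtain \<rho> where \<rho>: "0 < \<rho>" "ball (snd c x0) \<rho> \<subseteq> snd c ` W"
    using W(2) by (meson imageI open_contains_ball_eq)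
  have inW: "chart_inv c y \<in> W" if "y \<in> ball (snd c x0) \<rho>" for y
    using \<rho>(2) that W(3) chart(5)[OF cA(1)] by force
  have sub: "ball (snd c x0) \<rho> \<subseteq> snd c ` fst c" using \<rho>(2) W(3) by blast
  have up: "nrm c (chart_inv c y) v \<le> (1 + \<eta>) * nrm c x0 v" if "y \<in> ball (snd c x0) \<rho>" for y v
    using W(5)[OF inW[OF that]] .
  show ?thesis
  proof (rule that[OF \<rho>(1) sub _ up])
    fix y v assume y: "y \<in> ball (snd c x0) \<rho>"
    show "nrm c x0 v \<le> (1 + \<eta>) * nrm c (chart_inv c y) v"
      using W(4)[OF inW[OF y], of v] \<eta> by (simp add: field_simps)
  next
    fix y y' assume "y \<in> ball (snd c x0) \<rho>" "y' \<in> ball (snd c x0) \<rho>"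
    then have "\<exists>l\<le>(1 + \<eta>) * nrm c x0 (y' - y). joins (chart_inv c y) (chart_inv c y') l"
      by (intro joins_line[OF cA(1) convex_ball sub] up)
    then obtain l where l: "l \<le> (1 + \<eta>) * nrm c x0 (y' - y)" "joins (chart_inv c y) (chart_inv c y') l" by blast
    show "\<exists>l. joins (chart_inv c y) (chart_inv c y') l" using l(2) by blast
    show "d (chart_inv c y) (chart_inv c y') \<le> (1 + \<eta>) * nrm c x0 (y' - y)" using d_le[OF l(2)] l(1) by linarith
  qed
qed

text \<open>The set of points reachable from \<open>p\<close> and its complement are both open,
  because every point is joined to a whole neighbourhood; M is connected. Without such a path the
  infimum defining the distance would be that of an empty set.\<close>

lemma joins_ex: "\<exists>l. joins p q l"
proof -
  define R where "R = {q. \<exists>l. joins p q l}"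
  have nbhd: "\<exists>W. open W \<and> q \<in> W \<and> (\<forall>z\<in>W. \<exists>l. joins q z l)" for q
  proof -
    obtain c where c: "c \<in> charts_at A q" using chart_ex by blast
    then have cA: "c \<in> A" "q \<in> fst c" by (auto simp: charts_at_iff)
    obtain \<rho> where \<rho>: "0 < \<rho>"
      "\<And>y y'. y \<in> ball (snd c q) \<rho> \<Longrightarrow> y' \<in> ball (snd c q) \<rho> \<Longrightarrow> \<exists>l. joins (chart_inv c y) (chart_inv c y') l"
      using chart_ball[OF c zero_less_one] by metis
    have "open (fst c \<inter> snd c -` ball (snd c q) \<rho>)"
      by (rule continuous_open_preimage[OF chart(3,1)[OF cA(1)] open_ball])
    moreover have "\<exists>l. joins q z l" if "z \<in> fst c \<inter> snd c -` ball (snd c q) \<rho>" for z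
      using \<rho>(2)[of "snd c q" "snd c z"] that \<rho>(1) chart(5)[OF cA(1)] cA(2) by auto
    ultimately show ?thesis using cA(2) \<rho>(1)
      by (intro exI[of _ "fst c \<inter> snd c -` ball (snd c q) \<rho>"]) auto
  qed
  have "open R"
  proof (rule topological_space_class.openI)
    fix q assume "q \<in> R"
    then obtain l where l: "joins p q l" by (auto simp: R_def)
    obtain W where W: "open W" "q \<in> W" "\<forall>z\<in>W. \<exists>l. joins q z l" using nbhd by blast
    have "W \<subseteq> R"
    proof
      fix z assume "z \<in> W"
      then obtain l' where "joins q z l'" using W(3) by blast
      from joins_trans[OF l this] show "z \<in> R" by (auto simp: R_def)
    qed
    then show "\<exists>T. open T \<and> q \<in> T \<and> T \<subseteq> R" using W by blast
  qed
  moreover have "open (- R)"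
  proof (rule topological_space_class.openI)
    fix q assume "q \<in> - R"
    then have q: "\<not> joins p q l" for l by (auto simp: R_def)
    obtain W where W: "open W" "q \<in> W" "\<forall>z\<in>W. \<exists>l. joins q z l" using nbhd by blast
    have "W \<subseteq> - R"
    proof
      fix z assume "z \<in> W"
      then obtain l' where l': "joins z q l'" using W(3) joins_sym by blast
      have "\<not> joins p z l" for l using joins_trans[OF _ l', of p l] q by blast
      then show "z \<in> - R" by (auto simp: R_def)
    qed
    then show "\<exists>T. open T \<and> q \<in> T \<and> T \<subseteq> - R" using W by blast
  qed
  moreover have "p \<in> R" using nbhd[of p] unfolding R_def by blast
  moreover have "connected (UNIV :: 'm set)" using finsler by (simp add: C1_finsler_manifold_def)
  ultimately have "R = UNIV"
    unfolding connected_clopen by (auto simp: closed_def)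
  then show ?thesis by (auto simp: R_def)
qed

section \<open>The Finsler distance as a metric for the manifold topology\<close>

lemma d_less: assumes "d p q < e" obtains l where "joins p q l" "l < e"
  using cInf_lessD[of "{l. joins p q l}" e] joins_ex assms unfolding finsler_dist_eq by blast

lemma d_nonneg: "0 \<le> d p q"
  unfolding finsler_dist_eq by (rule cInf_greatest) (use joins_ex joins_nonneg in auto)

lemma d_sym: "d p q = d q p"
proof -
  have "{l. joins p q l} = {l. joins q p l}" using joins_sym by blast
  then show ?thesis by (simp only: finsler_dist_eq)
qed

lemma d_triangle: "d p r \<le> d p q + d q r"
proof (rule field_le_epsilon)
  fix e :: real assume "0 < e"
  then obtain l l' where "joins p q l" "l < d p q + e / 2" "joins q r l'" "l' < d q r + e / 2"
    using d_less[of p q "d p q + e / 2"] d_less[of q r "d q r + e / 2"] by (metis half_gt_zero less_add_same_cancel1)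
  then show "d p r \<le> d p q + d q r + e" using d_le[OF joins_trans, of p q l r l'] by linarith
qed

lemma d_diff_le: "\<bar>d p x - d p y\<bar> \<le> d x y"
  using d_triangle[of p x y] d_triangle[of p y x] d_sym[of x y] by linarith

text \<open>In a small coordinate ball the norms are at least k / 2 times the model norm, since they
  differ from the norm at \<open>x0\<close> by a factor of at most 2. A path shorter than k / 2
  times the radius therefore cannot escape.\<close>

lemma dist_small:
  assumes c: "c \<in> charts_at A x0" and \<rho>: "0 < \<rho>"
  obtains s where "0 < s" "\<And>x. d x0 x < s \<Longrightarrow> x \<in> fst c \<and> snd c x \<in> ball (snd c x0) \<rho>"
proof -
  obtain k where k: "0 < k" "\<And>v. k * norm v \<le> nrm c x0 v" using nrm_equiv[OF c] by metis
  obtain \<rho>' where \<rho>': "0 < \<rho>'" "ball (snd c x0) \<rho>' \<subseteq> snd c ` fst c"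
    "\<And>y v. y \<in> ball (snd c x0) \<rho>' \<Longrightarrow> nrm c x0 v \<le> (1 + 1) * nrm c (chart_inv c y) v"
    using chart_ball[OF c zero_less_one] by metis
  define r where "r = min \<rho> \<rho>'"
  have r: "0 < r" "ball (snd c x0) r \<subseteq> ball (snd c x0) \<rho>" "ball (snd c x0) r \<subseteq> ball (snd c x0) \<rho>'"
    using \<rho> \<rho>'(1) by (auto simp: r_def)
  show ?thesis
  proof (rule that[of "k / 2 * r"])
    show "0 < k / 2 * r" using k r by simp
    fix x assume "d x0 x < k / 2 * r"
    then obtain l where l: "joins x0 x l" "l < k / 2 * r" using d_less by blast
    have "x \<in> fst c \<and> snd c x \<in> ball (snd c x0) r"
    proof (rule joins_escape[OF c _ r(1) _ _ l])
      show "k / 2 * norm v \<le> nrm c (chart_inv c y) v" if "y \<in> ball (snd c x0) r" for y v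
        using k(2)[of v] \<rho>'(3)[of y v] that r(3) by fastforce
    qed (use k r \<rho>' in auto)
    then show "x \<in> fst c \<and> snd c x \<in> ball (snd c x0) \<rho>" using r(2) by blast
  qed
qed

text \<open>Injectivity of the chart carries the coordinate statement back to M. Together with
  \<open>d_continuous\<close> this identifies the two topologies, so that metric completeness
  produces topological limits.\<close>

lemma dist_small_open:
  assumes "open W" "x0 \<in> W"
  obtains s where "0 < s" "\<And>x. d x0 x < s \<Longrightarrow> x \<in> W"
proof -
  obtain c where c: "c \<in> charts_at A x0" using chart_ex by blast
  then have cA: "c \<in> A" "x0 \<in> fst c" by (auto simp: charts_at_iff)
  have "open (snd c ` (fst c \<inter> W))"
    by (rule chart_open_image[OF cA(1)]) (use assms(1) chart(1)[OF cA(1)] in auto)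
  then obtain \<rho> where \<rho>: "0 < \<rho>" "ball (snd c x0) \<rho> \<subseteq> snd c ` (fst c \<inter> W)"
    using assms(2) cA(2) by (meson IntI imageI open_contains_ball_eq)
  obtain s where s: "0 < s" "\<And>x. d x0 x < s \<Longrightarrow> x \<in> fst c \<and> snd c x \<in> ball (snd c x0) \<rho>"
    using dist_small[OF c \<rho>(1)] by metis
  have "x \<in> W" if "d x0 x < s" for x
  proof -
    have x: "x \<in> fst c" "snd c x \<in> snd c ` (fst c \<inter> W)" using s(2)[OF that] \<rho>(2) by auto
    then obtain x' where x': "x' \<in> fst c" "x' \<in> W" "snd c x = snd c x'" by auto
    then have "x = x'" using chart(5)[OF cA(1) x(1)] chart(5)[OF cA(1) x'(1)] by metis
    then show ?thesis using x' by simp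
  qed
  then show ?thesis using that s(1) by blast
qed

text \<open>Paths are defined on intervals of positive length, so the value 0 has to come from an
  actual path: the degenerate segment in a chart.\<close>

lemma d_refl: "d p p = 0"
proof (rule antisym[OF _ d_nonneg])
  obtain c where c: "c \<in> charts_at A p" using chart_ex by blast
  then have cA: "c \<in> A" "p \<in> fst c" by (auto simp: charts_at_iff)
  obtain \<rho> where "0 < \<rho>" "\<And>y y'. y \<in> ball (snd c p) \<rho> \<Longrightarrow> y' \<in> ball (snd c p) \<rho> \<Longrightarrow>
      d (chart_inv c y) (chart_inv c y') \<le> (1 + 1) * nrm c p (y' - y)"
    using chart_ball[OF c zero_less_one] by metis
  then have "d p p \<le> (1 + 1) * nrm c p (snd c p - snd c p)" using chart(5)[OF cA] by (metis centre_in_ball)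
  then show "d p p \<le> 0" using nrm_scaleR[OF c, of 0 0] by simp
qed

lemma d_tendsto_imp:
  assumes "(\<lambda>n. d x (\<sigma> n)) \<longlonglongrightarrow> 0" shows "\<sigma> \<longlonglongrightarrow> x"
proof (rule topological_tendstoI)
  fix W assume "open W" "x \<in> W"
  then obtain s where s: "0 < s" "\<And>y. d x y < s \<Longrightarrow> y \<in> W" using dist_small_open by metis
  have "\<forall>\<^sub>F n in sequentially. d x (\<sigma> n) < s" using order_tendstoD(2)[OF assms s(1)] .
  then show "\<forall>\<^sub>F n in sequentially. \<sigma> n \<in> W" by eventually_elim (rule s(2))
qed

lemma d_continuous: "continuous_on UNIV (d p)"
proof (rule continuous_at_imp_continuous_on, intro ballI)
  fix x
  obtain c where c: "c \<in> charts_at A x" using chart_ex by blast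
  then have cA: "c \<in> A" "x \<in> fst c" by (auto simp: charts_at_iff)
  obtain K where K: "0 < K" "\<And>v. nrm c x v \<le> K * norm v" using nrm_equiv[OF c] by metis
  obtain \<rho> where \<rho>: "0 < \<rho>"
    "\<And>y y'. y \<in> ball (snd c x) \<rho> \<Longrightarrow> y' \<in> ball (snd c x) \<rho> \<Longrightarrow>
      d (chart_inv c y) (chart_inv c y') \<le> (1 + 1) * nrm c x (y' - y)"
    using chart_ball[OF c zero_less_one] by metis
  have le: "norm (d p y - d p x) \<le> 2 * (K * norm (snd c y - snd c x))"
    if y: "y \<in> fst c \<inter> snd c -` ball (snd c x) \<rho>" for y
  proof -
    have "d x y \<le> 2 * nrm c x (snd c y - snd c x)"
      using \<rho>(2)[of "snd c x" "snd c y"] y \<rho>(1) chart(5)[OF cA(1)] cA(2) by simp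
    then show ?thesis using d_diff_le[of p y x] d_sym[of x y] K(2)[of "snd c y - snd c x"] by simp
  qed
  have "open (fst c \<inter> snd c -` ball (snd c x) \<rho>)"
    by (rule continuous_open_preimage[OF chart(3,1)[OF cA(1)] open_ball])
  then have "\<forall>\<^sub>F y in at x. norm (d p y - d p x) \<le> 2 * (K * norm (snd c y - snd c x))"
    unfolding eventually_at_topological using le cA(2) \<rho>(1)
    by (intro exI[of _ "fst c \<inter> snd c -` ball (snd c x) \<rho>"]) auto
  moreover have "((\<lambda>y. 2 * (K * norm (snd c y - snd c x))) \<longlongrightarrow> 0) (at x)"
    using chart_isCont[OF c] unfolding isCont_def by (auto intro!: tendsto_eq_intros)
  ultimately have "((\<lambda>y. d p y - d p x) \<longlongrightarrow> 0) (at x)" by (rule Lim_null_comparison)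
  then show "isCont (d p) x" by (simp add: isCont_def LIM_zero_iff)
qed

subsection \<open>Test functions given in a chart\<close>

text \<open>The covector with coordinate expression \<open>D\<close> in the chart \<open>c\<close>;
  the restriction supplies the off-domain value required by \<open>cotangent_space\<close>.\<close>

definition chart_covector :: "('m, 'x) chart \<Rightarrow> 'm \<Rightarrow> ('x \<Rightarrow> real) \<Rightarrow> ('m, 'x) tangent \<Rightarrow> real" where
  "chart_covector c x D = restrict (\<lambda>\<xi>. D (\<xi> c)) (tangent_space A x)"

lemma chart_covector_tvec:
  assumes "c \<in> charts_at A x" "c' \<in> charts_at A x"
  shows "chart_covector c x D (tvec A c' x v) = D (trans_deriv c' c x v)"
  using assms by (simp add: chart_covector_def tvec_in tvec_apply)

lemma chart_covector_in:
  assumes "c \<in> charts_at A x" "bounded_linear D"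
  shows "chart_covector c x D \<in> cotangent_space A x"
  unfolding cotangent_space_def
proof (intro CollectI conjI ballI)
  show "chart_covector c x D \<in> extensional (tangent_space A x)"
    unfolding chart_covector_def by (rule restrict_extensional)
  fix c' assume c': "c' \<in> charts_at A x"
  show "bounded_linear (\<lambda>v. chart_covector c x D (tvec A c' x v))"
    unfolding chart_covector_tvec[OF assms(1) c']
    by (rule bounded_linear_compose[OF assms(2) transition_bounded_linear[OF c' assms(1)]])
qed

text \<open>Every tangent vector is \<open>tvec\<close> of its coordinate, so the supremum runs over
  the unit vectors of \<open>nrm c x\<close>, and the lower equivalence constant makes it finite.
  The element 0 inside the supremum is why the bound \<open>K\<close> has to be nonnegative.\<close>

lemma dual_norm_bounds:
  assumes c: "c \<in> charts_at A x" and D: "bounded_linear D"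
  shows "0 \<le> dual_norm A N x (chart_covector c x D)"
    and "\<bar>D v\<bar> \<le> dual_norm A N x (chart_covector c x D) * nrm c x v"
    and "0 \<le> K \<Longrightarrow> (\<And>v. \<bar>D v\<bar> \<le> K * nrm c x v) \<Longrightarrow> dual_norm A N x (chart_covector c x D) \<le> K"
proof -
  interpret D: bounded_linear D by (rule D)
  define E where "E = insert 0 {\<bar>D v\<bar> |v. nrm c x v = 1}"
  have eq: "dual_norm A N x (chart_covector c x D) = Sup E"
  proof -
    have "{\<bar>chart_covector c x D \<xi>\<bar> |\<xi>. \<xi> \<in> tangent_space A x \<and> N x \<xi> = 1} = {\<bar>D v\<bar> |v. nrm c x v = 1}"
    proof (intro equalityI subsetI)
      fix r assume "r \<in> {\<bar>chart_covector c x D \<xi>\<bar> |\<xi>. \<xi> \<in> tangent_space A x \<and> N x \<xi> = 1}"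
      then obtain \<xi> where \<xi>: "r = \<bar>chart_covector c x D \<xi>\<bar>" "\<xi> \<in> tangent_space A x" "N x \<xi> = 1" by blast
      then have "nrm c x (\<xi> c) = 1" "r = \<bar>D (\<xi> c)\<bar>"
        using tangent_eq_tvec[OF \<xi>(2) c] by (simp_all add: chart_covector_def)
      then show "r \<in> {\<bar>D v\<bar> |v. nrm c x v = 1}" by blast
    next
      fix r assume "r \<in> {\<bar>D v\<bar> |v. nrm c x v = 1}"
      then obtain v where v: "r = \<bar>D v\<bar>" "nrm c x v = 1" by blast
      then have "r = \<bar>chart_covector c x D (tvec A c x v)\<bar>"
        by (simp add: chart_covector_tvec[OF c c] transition_id[OF c])
      then show "r \<in> {\<bar>chart_covector c x D \<xi>\<bar> |\<xi>. \<xi> \<in> tangent_space A x \<and> N x \<xi> = 1}"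
        using v(2) tvec_in[OF c] by blast
    qed
    then show ?thesis by (simp only: dual_norm_def E_def)
  qed
  obtain k where k: "0 < k" "\<And>v. k * norm v \<le> nrm c x v" using nrm_equiv[OF c] by metis
  have bdd: "bdd_above E"
  proof -
    obtain M where M: "0 \<le> M" "\<And>v. \<bar>D v\<bar> \<le> norm v * M" using D.nonneg_bounded by auto
    have "\<bar>D v\<bar> \<le> M / k" if "nrm c x v = 1" for v
    proof -
      have "norm v \<le> 1 / k" using k(2)[of v] that k(1) by (simp add: field_simps)
      then have "norm v * M \<le> 1 / k * M" using M(1) by (rule mult_right_mono)
      then show ?thesis using M(2)[of v] by simp
    qed
    moreover have "0 \<le> M / k" using M k by simp
    ultimately show ?thesis by (intro bdd_aboveI[of _ "M / k"]) (auto simp: E_def)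
  qed
  show ge0: "0 \<le> dual_norm A N x (chart_covector c x D)"
    unfolding eq by (rule cSup_upper[OF _ bdd]) (simp add: E_def)
  show "\<bar>D v\<bar> \<le> dual_norm A N x (chart_covector c x D) * nrm c x v"
  proof (cases "v = 0")
    case True
    then show ?thesis using ge0 nrm_nonneg[OF c] by (simp add: D.zero)
  next
    case False
    then have n: "0 < nrm c x v" using k(2)[of v] k(1) by (smt (verit) mult_pos_pos zero_less_norm_iff)
    have "nrm c x ((1 / nrm c x v) *\<^sub>R v) = 1" using n by (simp add: nrm_scaleR[OF c])
    then have "\<bar>D ((1 / nrm c x v) *\<^sub>R v)\<bar> \<in> E" unfolding E_def by blast
    then have "\<bar>D ((1 / nrm c x v) *\<^sub>R v)\<bar> \<le> Sup E" by (rule cSup_upper[OF _ bdd])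
    then have "\<bar>D v\<bar> / nrm c x v \<le> Sup E" using n by (simp add: D.scaleR abs_mult)
    then show ?thesis using n by (simp add: eq field_simps)
  qed
  assume K: "0 \<le> K" "\<And>v. \<bar>D v\<bar> \<le> K * nrm c x v"
  show "dual_norm A N x (chart_covector c x D) \<le> K"
    unfolding eq
  proof (rule cSup_least)
    fix r assume "r \<in> E"
    then consider "r = 0" | v where "r = \<bar>D v\<bar>" "nrm c x v = 1" by (auto simp: E_def)
    then show "r \<le> K"
    proof cases
      case (2 v)
      then show ?thesis using K(2)[of v] by simp
    qed (use K in simp)
  qed (simp add: E_def)
qed

text \<open>A function given in a chart is cut off near the point and extended by zero. The
  difficulty is smoothness outside the chart domain: in infinite dimension closed coordinate balls
  are not compact, so it is the Finsler distance that separates the support of the cut-off from the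
  complement of the domain.\<close>

lemma extend_test_function:
  fixes G :: "real \<times> 'x \<Rightarrow> real"
  assumes c: "c \<in> charts_at A x" and B: "smooth_bump (B :: 'x \<Rightarrow> real) R" and G: "C1_on UNIV G"
    and P: "(G has_derivative P) (at (t, snd c x))"
  obtains g where "C1_function A g" "((\<lambda>s. g s x) has_real_derivative P (1, 0)) (at t)"
    "has_mderiv A (g t) x (chart_covector c x (\<lambda>v. P (0, v)))"
    "\<forall>\<^sub>F (s, z) in nhds (t, x). z \<in> fst c \<and> g s z = G (s, snd c z)"
proof -
  have cA: "c \<in> A" "x \<in> fst c" using c by (auto simp: charts_at_iff)
  interpret P: bounded_linear P using P has_derivative_bounded_linear by blast
  obtain K where K: "0 < K" "\<And>v. nrm c x v \<le> K * norm v" using nrm_equiv[OF c] by metis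
  obtain \<rho> where \<rho>: "0 < \<rho>" "ball (snd c x) \<rho> \<subseteq> snd c ` fst c"
    "\<And>y y'. y \<in> ball (snd c x) \<rho> \<Longrightarrow> y' \<in> ball (snd c x) \<rho> \<Longrightarrow>
      d (chart_inv c y) (chart_inv c y') \<le> (1 + 1) * nrm c x (y' - y)"
    using chart_ball[OF c zero_less_one] by metis
  obtain s0 where s0: "0 < s0" "\<And>z. d x z < s0 \<Longrightarrow> z \<in> fst c" using dist_small_open[OF chart(1)[OF cA(1)] cA(2)] by metis
  \<comment> \<open>Coordinate distance below \<open>r\<close> forces Finsler distance at most
    \<open>s0 / 2\<close>, whereas points outside the chart domain are at distance at least
    \<open>s0\<close>.\<close>
  define r where "r = min (\<rho> / 2) (s0 / (4 * K))"
  have r: "0 < r" "r < \<rho>" "2 * K * r \<le> s0 / 2"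
  proof -
    show "0 < r" "r < \<rho>" using \<rho> s0 K by (auto simp: r_def min_def)
    have "2 * K * r \<le> 2 * K * (s0 / (4 * K))" using K by (intro mult_left_mono) (auto simp: r_def)
    then show "2 * K * r \<le> s0 / 2" using K by simp
  qed
  have small: "d x z \<le> s0 / 2" if "z \<in> fst c" "norm (snd c z - snd c x) < r" for z
  proof -
    have "d x z \<le> (1 + 1) * nrm c x (snd c z - snd c x)"
      using \<rho>(3)[of "snd c x" "snd c z"] that r \<rho>(1) chart(5)[OF cA(1)] cA(2)
      by (simp add: dist_norm norm_minus_commute)
    also have "\<dots> \<le> 2 * (K * norm (snd c z - snd c x))" using K(2) by simp
    also have "\<dots> \<le> 2 * (K * r)" using that K by (intro mult_left_mono) auto
    finally show ?thesis using r(3) by simp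
  qed
  have R: "0 < R" by (rule smooth_bumpD[OF B])
  \<comment> \<open>A bump may attain 1 only at its centre and thus need not be a cut-off. This
    expression is 1 wherever the rescaled bump is at least 1/2, a neighbourhood of the centre, and 0
    wherever the bump vanishes.\<close>
  define cut where "cut y = 1 - (max 0 (1 - 2 * B (- ((R / r) *\<^sub>R snd c x) + (R / r) *\<^sub>R y)))\<^sup>2" for y
  have arg: "- ((R / r) *\<^sub>R snd c x) + (R / r) *\<^sub>R y = (R / r) *\<^sub>R (y - snd c x)" for y
    by (simp add: scaleR_right_diff_distrib)
  have cut0: "cut y = 0" if "r \<le> norm (y - snd c x)" for y
  proof -
    have "R / r * r \<le> R / r * norm (y - snd c x)" using that r R by (intro mult_left_mono) auto
    then have "R \<le> norm ((R / r) *\<^sub>R (y - snd c x))" using r R by (simp only: norm_scaleR) simp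
    then have "B ((R / r) *\<^sub>R (y - snd c x)) = 0" by (rule smooth_bumpD[OF B])
    then show ?thesis by (simp only: cut_def arg) simp
  qed
  have C1cut: "C1_on UNIV cut"
  proof -
    have b: "C1_on UNIV (\<lambda>y. 1 - 2 * B (- ((R / r) *\<^sub>R snd c x) + (R / r) *\<^sub>R y))"
      by (intro C1_on_diff C1_on_mult C1_on_const C1_on_affine bounded_linear_scaleR_right smooth_bumpD[OF B])
    show ?thesis unfolding cut_def[abs_def]
      by (intro C1_on_diff C1_on_const C1_on_compose[OF b C1_on_square_pos[of UNIV]]) auto
  qed
  have cut1: "\<forall>\<^sub>F y in nhds (snd c x). cut y = 1"
  proof -
    have "continuous_on UNIV (\<lambda>y. B ((R / r) *\<^sub>R (y - snd c x)))"
      by (intro continuous_intros continuous_on_compose2[OF C1_on_imp_continuous_on[OF smooth_bumpD(5)[OF B]]]) auto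
    then have "((\<lambda>y. B ((R / r) *\<^sub>R (y - snd c x))) \<longlongrightarrow> B ((R / r) *\<^sub>R (snd c x - snd c x))) (nhds (snd c x))"
      unfolding continuous_on_eq_continuous_at[OF open_UNIV] isCont_def tendsto_nhds_iff by blast
    then have "\<forall>\<^sub>F y in nhds (snd c x). 1 / 2 < B ((R / r) *\<^sub>R (y - snd c x))"
      by (rule order_tendstoD) (simp add: smooth_bumpD(3)[OF B])
    then show ?thesis
    proof eventually_elim
      case (elim y)
      then have "max 0 (1 - 2 * B ((R / r) *\<^sub>R (y - snd c x))) = 0" by linarith
      then show ?case by (simp only: cut_def arg) simp
    qed
  qed
  define H where "H p = cut (snd p) * G p" for p
  have C1H: "C1_on UNIV H"
    unfolding H_def[abs_def]
    by (intro C1_on_mult G C1_on_compose[OF C1_on_bounded_linear[OF bounded_linear_snd] C1cut]) auto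
  define g where "g s z = (if z \<in> fst c then H (s, snd c z) else 0)" for s z
  have C1g: "C1_function A g"
    unfolding C1_function_def
  proof (intro ballI C1_on_local)
    fix c' and p :: "real \<times> 'x" assume c': "c' \<in> A" and p: "p \<in> {0<..} \<times> snd c' ` fst c'"
    obtain s z where sz: "p = (s, snd c' z)" "0 < s" "z \<in> fst c'" using p by auto
    show "\<exists>T. open T \<and> p \<in> T \<and> C1_on T (\<lambda>(s, y). g s (chart_inv c' y))"
    proof (cases "z \<in> fst c")
      case True
      let ?V = "snd c' ` (fst c' \<inter> fst c)"
      have V: "open ?V" using chart(1)[OF cA(1)] chart(1)[OF c'] by (intro chart_open_image[OF c']) auto
      have tr: "C1_on ?V (snd c \<circ> chart_inv c')" by (rule transition_C1[OF c' cA(1)])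
      have "C1_on (UNIV \<times> ?V) (\<lambda>q. (fst q, (snd c \<circ> chart_inv c') (snd q)))"
        by (intro C1_on_Pair C1_on_bounded_linear[OF bounded_linear_fst]
          C1_on_compose[OF C1_on_bounded_linear[OF bounded_linear_snd] tr]) auto
      then have "C1_on (UNIV \<times> ?V) (\<lambda>q. H (fst q, (snd c \<circ> chart_inv c') (snd q)))"
        by (rule C1_on_compose[OF _ C1H]) auto
      then have "C1_on (UNIV \<times> ?V) (\<lambda>(s, y). g s (chart_inv c' y))"
        by (rule C1_on_cong[rotated 2]) (use V chart(5)[OF c'] in \<open>auto simp: g_def intro: open_Times\<close>)
      moreover have "open (UNIV \<times> ?V :: (real \<times> 'x) set)" using V by (intro open_Times) auto
      moreover have "p \<in> UNIV \<times> ?V" using True sz by auto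
      ultimately show ?thesis by blast
    next
      case False
      \<comment> \<open>This open set contains every point outside the chart domain and misses the
        support of the cut-off, so the extension vanishes on it.\<close>
      let ?Q = "{z. s0 / 2 < d x z}"
      have Q: "open ?Q" using open_Collect_less[OF continuous_on_const d_continuous] .
      have "s0 \<le> d x z" using s0(2)[of z] False by (meson not_le)
      then have zO: "z \<in> ?Q" using s0 by simp
      let ?V = "snd c' ` (fst c' \<inter> ?Q)"
      have V: "open ?V" using chart(1)[OF c'] Q by (intro chart_open_image[OF c']) auto
      have g0: "g s z = 0" if "z \<in> ?Q" for s z
      proof (cases "z \<in> fst c")
        case True
        then have "r \<le> norm (snd c z - snd c x)" using small[OF True] that by force
        then show ?thesis using cut0 by (simp add: g_def H_def)
      qed (simp add: g_def)
      have "C1_on (UNIV \<times> ?V) (\<lambda>q. 0 :: real)" by (rule C1_on_const)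
      then have "C1_on (UNIV \<times> ?V) (\<lambda>(s, y). g s (chart_inv c' y))"
        by (rule C1_on_cong[rotated 2]) (use V chart(5)[OF c'] g0 in \<open>auto intro: open_Times\<close>)
      moreover have "open (UNIV \<times> ?V :: (real \<times> 'x) set)" using V by (intro open_Times) auto
      moreover have "p \<in> UNIV \<times> ?V" using zO sz by auto
      ultimately show ?thesis by blast
    qed
  qed
  obtain O1 where O1: "open O1" "snd c x \<in> O1" "\<And>y. y \<in> O1 \<Longrightarrow> cut y = 1"
    using cut1 unfolding eventually_nhds by blast
  define Q where "Q = fst c \<inter> snd c -` O1"
  have Q: "open Q" "x \<in> Q" "Q \<subseteq> fst c"
    unfolding Q_def using continuous_open_preimage[OF chart(3,1)[OF cA(1)] O1(1)] O1(2) cA by auto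
  have gG: "g s z = G (s, snd c z)" if "z \<in> Q" for s z
    using that O1(3) by (simp add: g_def H_def Q_def)
  have dt: "((\<lambda>s. g s x) has_real_derivative P (1, 0)) (at t)"
  proof -
    have "((\<lambda>s. (s, snd c x)) has_derivative (\<lambda>h. (h, 0))) (at t)"
      by (intro has_derivative_Pair has_derivative_ident has_derivative_const)
    from has_derivative_compose[OF this P]
    have "((\<lambda>s. G (s, snd c x)) has_derivative (\<lambda>h. P (h, 0))) (at t)" .
    moreover have "(\<lambda>h. P (h, 0)) = (*) (P (1, 0))"
    proof
      fix h
      have "P (h, 0) = P (h *\<^sub>R (1, 0))" by simp
      also have "\<dots> = P (1, 0) * h" by (simp only: P.scaleR) simp
      finally show "P (h, 0) = P (1, 0) * h" .
    qed
    ultimately show ?thesis using gG[OF Q(2)] by (simp add: has_field_derivative_def)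
  qed
  have dx: "has_mderiv A (g t) x (chart_covector c x (\<lambda>v. P (0, v)))"
    unfolding has_mderiv_def
  proof (intro conjI ballI)
    have P0: "bounded_linear (\<lambda>v. P (0, v))"
      by (rule bounded_linear_compose[OF P.bounded_linear_axioms])
        (intro bounded_linear_Pair bounded_linear_zero bounded_linear_ident)
    show "chart_covector c x (\<lambda>v. P (0, v)) \<in> cotangent_space A x"
      by (rule chart_covector_in[OF c P0])
    fix c' assume c': "c' \<in> charts_at A x"
    then have c'A: "c' \<in> A" "x \<in> fst c'" by (auto simp: charts_at_iff)
    have xx: "(snd c \<circ> chart_inv c') (snd c' x) = snd c x" using chart(5)[OF c'A] by simp
    have "((\<lambda>y. (t, (snd c \<circ> chart_inv c') y)) has_derivative (\<lambda>v. (0, trans_deriv c' c x v))) (at (snd c' x))"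
      by (intro has_derivative_Pair has_derivative_const transition_deriv[OF c' c])
    from has_derivative_compose[OF this, of G P]
    have "((\<lambda>y. G (t, (snd c \<circ> chart_inv c') y)) has_derivative (\<lambda>v. P (0, trans_deriv c' c x v))) (at (snd c' x))"
      using P unfolding xx by blast
    then have "((g t \<circ> chart_inv c') has_derivative (\<lambda>v. P (0, trans_deriv c' c x v))) (at (snd c' x))"
    proof (rule has_derivative_transform_within_open)
      show "open (snd c' ` (fst c' \<inter> Q))" using Q(1) chart(1)[OF c'A(1)] by (intro chart_open_image[OF c'A(1)]) auto
      show "snd c' x \<in> snd c' ` (fst c' \<inter> Q)" using c'A Q by auto
    qed (use gG chart(5)[OF c'A(1)] in auto)
    then show "((g t \<circ> chart_inv c') has_derivative (\<lambda>v. chart_covector c x (\<lambda>v. P (0, v)) (tvec A c' x v))) (at (snd c' x))"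
      by (simp only: chart_covector_tvec[OF c c'])
  qed
  have ev: "\<forall>\<^sub>F (s, z) in nhds (t, x). z \<in> fst c \<and> g s z = G (s, snd c z)"
  proof -
    have "open (UNIV \<times> Q :: (real \<times> 'm) set)" using Q(1) by (intro open_Times) auto
    then show ?thesis unfolding eventually_nhds
      using Q gG by (intro exI[of _ "UNIV \<times> Q"]) auto
  qed
  show ?thesis by (rule that[OF C1g dt dx ev])
qed

lemma eventually_chart:
  assumes c: "c \<in> charts_at A x" and ev: "\<forall>\<^sub>F p in nhds (t, snd c x). Q p"
  shows "\<forall>\<^sub>F p in nhds (t, x). Q (fst p, snd c (snd p))"
proof -
  have 1: "filterlim (snd c) (nhds (snd c x)) (nhds x)"
    using chart_isCont[OF c] by (simp add: isCont_def tendsto_nhds_iff)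
  have "((\<lambda>p. snd c (snd p)) \<longlongrightarrow> snd c x) (nhds (t, x))"
    by (rule filterlim_compose[OF 1]) (use tendsto_snd[OF filterlim_ident, of "(t, x)"] in simp)
  moreover have "(fst \<longlongrightarrow> t) (nhds (t, x))" using tendsto_fst[OF filterlim_ident, of "(t, x)"] by simp
  ultimately have "((\<lambda>p. (fst p, snd c (snd p))) \<longlongrightarrow> (t, snd c x)) (nhds (t, x))"
    by (intro tendsto_Pair)
  then show ?thesis by (rule eventually_compose_filterlim[OF ev])
qed

lemma chart_test:
  assumes c: "c \<in> charts_at A x" and B: "smooth_bump (B :: 'x \<Rightarrow> real) R" and G: "C1_on UNIV G"
    and P: "(G has_derivative P) (at (t, snd c x))"
  shows chart_test_superdifferential:
      "(\<forall>\<^sub>F (s, y) in nhds (t, snd c x). u s (chart_inv c y) - G (s, y) \<le> u t x - G (t, snd c x)) \<Longrightarrow>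
        (P (1, 0), chart_covector c x (\<lambda>v. P (0, v))) \<in> superdifferential A u t x"
    and chart_test_subdifferential:
      "(\<forall>\<^sub>F (s, y) in nhds (t, snd c x). u t x - G (t, snd c x) \<le> u s (chart_inv c y) - G (s, y)) \<Longrightarrow>
        (P (1, 0), chart_covector c x (\<lambda>v. P (0, v))) \<in> subdifferential A u t x"
proof -
  have cA: "c \<in> A" using c by (auto simp: charts_at_iff)
  obtain g where g: "C1_function A g" "((\<lambda>s. g s x) has_real_derivative P (1, 0)) (at t)"
    "has_mderiv A (g t) x (chart_covector c x (\<lambda>v. P (0, v)))"
    "\<forall>\<^sub>F (s, z) in nhds (t, x). z \<in> fst c \<and> g s z = G (s, snd c z)"
    using extend_test_function[OF c B G P] by blast
  note gt = eventually_nhds_x_imp_x[OF g(4)]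
  {
    assume "\<forall>\<^sub>F (s, y) in nhds (t, snd c x). u s (chart_inv c y) - G (s, y) \<le> u t x - G (t, snd c x)"
    from eventually_chart[OF c this] g(4)
    have "\<forall>\<^sub>F (s, z) in nhds (t, x). u s z - g s z \<le> u t x - g t x"
      by eventually_elim (use chart(5)[OF cA] gt in \<open>auto simp: case_prod_unfold\<close>)
    then show "(P (1, 0), chart_covector c x (\<lambda>v. P (0, v))) \<in> superdifferential A u t x"
      using g unfolding superdifferential_def by blast
  next
    assume "\<forall>\<^sub>F (s, y) in nhds (t, snd c x). u t x - G (t, snd c x) \<le> u s (chart_inv c y) - G (s, y)"
    from eventually_chart[OF c this] g(4)
    have "\<forall>\<^sub>F (s, z) in nhds (t, x). u t x - g t x \<le> u s z - g s z"
      by eventually_elim (use chart(5)[OF cA] gt in \<open>auto simp: case_prod_unfold\<close>)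
    then show "(P (1, 0), chart_covector c x (\<lambda>v. P (0, v))) \<in> subdifferential A u t x"
      using g unfolding subdifferential_def by blast
  }
qed

text \<open>The covectors live at different points but have coordinates in the same chart. The
  estimate passes through a third norm \<open>n\<close>, in practice the norm at the minimizer,
  which is within the factor 1 + \<eta> of both.\<close>

lemma dual_norm_compare:
  assumes c: "c \<in> charts_at A x1" "c \<in> charts_at A x2" and \<eta>: "0 \<le> \<eta>" and \<kappa>: "0 \<le> \<kappa>"
    and n1: "\<And>v. n v \<le> (1 + \<eta>) * nrm c x1 v" and n2: "\<And>v. nrm c x2 v \<le> (1 + \<eta>) * n v"
    and D: "bounded_linear D1" "bounded_linear D2" "\<And>v. \<bar>D1 v - D2 v\<bar> \<le> \<kappa> * n v"
  shows "dual_norm A N x1 (chart_covector c x1 D1)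
    \<le> (dual_norm A N x2 (chart_covector c x2 D2) * (1 + \<eta>) + \<kappa>) * (1 + \<eta>)"
proof (rule dual_norm_bounds(3)[OF c(1) D(1)])
  define r where "r = dual_norm A N x2 (chart_covector c x2 D2)"
  have r: "0 \<le> r" unfolding r_def by (rule dual_norm_bounds(1)[OF c(2) D(2)])
  then have nn: "0 \<le> r * (1 + \<eta>) + \<kappa>" using \<eta> \<kappa> by simp
  then show "0 \<le> (r * (1 + \<eta>) + \<kappa>) * (1 + \<eta>)" using \<eta> by simp
  fix v
  have "\<bar>D1 v\<bar> \<le> \<bar>D2 v\<bar> + \<kappa> * n v" using D(3)[of v] by linarith
  also have "\<bar>D2 v\<bar> \<le> r * nrm c x2 v" unfolding r_def by (rule dual_norm_bounds(2)[OF c(2) D(2)])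
  also have "r * nrm c x2 v \<le> r * ((1 + \<eta>) * n v)" by (rule mult_left_mono[OF n2 r])
  also have "r * ((1 + \<eta>) * n v) + \<kappa> * n v = (r * (1 + \<eta>) + \<kappa>) * n v" by (simp add: algebra_simps)
  also have "\<dots> \<le> (r * (1 + \<eta>) + \<kappa>) * ((1 + \<eta>) * nrm c x1 v)" by (rule mult_left_mono[OF n1 nn])
  finally show "\<bar>D1 v\<bar> \<le> (r * (1 + \<eta>) + \<kappa>) * (1 + \<eta>) * nrm c x1 v" by (simp add: mult.assoc)
qed

section \<open>The comparison principle\<close>

text \<open>An instance of \<open>perturbed_minimum\<close> with tents of height 1 and slope 2^k,
  weighted by a / 4^k: the slopes add up to 2 a \<le> \<epsilon> and the heights to 4 a / 3 \<le>
  \<tau>. The height bound lets a negative value of \<open>f\<close> persist at the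
  minimizer.\<close>

lemma ekeland:
  fixes f :: "real \<times> 'm \<Rightarrow> real"
  assumes complete: "finsler_complete A N" and lsc: "seq_lsc ({0..T} \<times> UNIV) f"
    and bdd: "bdd_below (f ` ({0..T} \<times> UNIV))" and T: "0 \<le> T" and \<epsilon>: "0 < \<epsilon>" and \<tau>: "0 < \<tau>"
  obtains g t0 x0 where "t0 \<in> {0..T}" "\<And>p. 0 \<le> g p" "\<And>p. g p \<le> \<tau>"
    "\<And>s y s' y'. \<bar>g (s, y) - g (s', y')\<bar> \<le> \<epsilon> * (\<bar>s - s'\<bar> + d y y')"
    "\<And>s y. s \<in> {0..T} \<Longrightarrow> f (t0, x0) - g (t0, x0) \<le> f (s, y) - g (s, y)"
proof -
  define D where "D p r = \<bar>fst p - fst r\<bar> + d (snd p) (snd r)" for p r :: "real \<times> 'm"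
  define a where "a = min (\<epsilon> / 2) (\<tau> / 2)"
  have a: "0 < a" "2 * a \<le> \<epsilon>" "2 * a \<le> \<tau>" using \<epsilon> \<tau> by (auto simp: a_def min_def)
  define \<beta> where "\<beta> k p r = max 0 (1 - 2 ^ k * D p r)" for k :: nat and p r :: "real \<times> 'm"
  let ?S = "{0..T} \<times> (UNIV :: 'm set)"
  have D0: "0 \<le> D p r" for p r by (simp add: D_def d_nonneg)
  have \<beta>b: "0 \<le> \<beta> k p r" "\<beta> k p r \<le> 1" "\<beta> k p p = 1" for k p r
    using D0[of p r] by (auto simp: \<beta>_def) (simp add: D_def d_refl)
  have cont: "continuous_on ?S (\<beta> k p)" for k p
    unfolding \<beta>_def D_def
    by (intro continuous_intros continuous_on_compose2[OF d_continuous]) auto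
  have conv: "\<exists>x\<in>?S. \<sigma> \<longlonglongrightarrow> x" if \<sigma>: "\<And>k. \<sigma> k \<in> ?S" "\<And>k. 0 < \<beta> k (\<sigma> k) (\<sigma> (Suc k))" for \<sigma>
  proof -
    have D: "D (\<sigma> k) (\<sigma> (Suc k)) \<le> 1 / 2 ^ k" for k
    proof -
      have "2 ^ k * D (\<sigma> k) (\<sigma> (Suc k)) < 1" using \<sigma>(2)[of k] by (simp add: \<beta>_def)
      then show ?thesis by (simp add: field_simps)
    qed
    have step: "dist (fst (\<sigma> k)) (fst (\<sigma> (Suc k))) \<le> 1 / 2 ^ k" "d (snd (\<sigma> k)) (snd (\<sigma> (Suc k))) \<le> 1 / 2 ^ k" for k
      using D[of k] d_nonneg[of "snd (\<sigma> k)" "snd (\<sigma> (Suc k))"] by (auto simp: D_def dist_real_def)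
    have "Cauchy (\<lambda>k. fst (\<sigma> k))"
      unfolding Cauchy_def
      using geometric_Cauchy[where d=dist and \<sigma>="\<lambda>k. fst (\<sigma> k)", OF dist_triangle dist_self dist_commute step(1)] by simp
    then obtain t where t: "(\<lambda>k. fst (\<sigma> k)) \<longlonglongrightarrow> t" using Cauchy_convergent convergent_def by blast
    have "fst (\<sigma> k) \<in> {0..T}" for k using \<sigma>(1)[of k] by (simp add: mem_Times_iff)
    then have tT: "t \<in> {0..T}" using closed_sequentially[OF closed_atLeastAtMost _ t] by blast
    have "\<forall>e>0. \<exists>k. \<forall>m\<ge>k. \<forall>n\<ge>k. d (snd (\<sigma> m)) (snd (\<sigma> n)) < e"
      using geometric_Cauchy[where d=d and \<sigma>="\<lambda>k. snd (\<sigma> k)", OF d_triangle d_refl d_sym step(2)] by simp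
    then have "\<exists>x. (\<lambda>n. d (snd (\<sigma> n)) x) \<longlonglongrightarrow> 0"
      using complete[unfolded finsler_complete_def, rule_format, of "\<lambda>k. snd (\<sigma> k)"] by blast
    then obtain x where "(\<lambda>n. d x (snd (\<sigma> n))) \<longlonglongrightarrow> 0" using d_sym by auto
    then have "(\<lambda>n. snd (\<sigma> n)) \<longlonglongrightarrow> x" by (rule d_tendsto_imp)
    from tendsto_Pair[OF t this] have "\<sigma> \<longlonglongrightarrow> (t, x)" by simp
    then show ?thesis using tT by (intro bexI[of _ "(t, x)"]) auto
  qed
  have sa: "(\<lambda>k. a / 4 ^ k) sums (a * (4 / 3))"
    using sums_mult[OF geometric_sums[of "1 / 4 :: real"], of a] by (simp add: power_divide)
  obtain \<sigma> z where \<sigma>: "\<And>k. \<sigma> k \<in> ?S" and z: "z \<in> ?S" and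
    min: "\<And>y. y \<in> ?S \<Longrightarrow> f z - (\<Sum>k. a / 4 ^ k * \<beta> k (\<sigma> k) z) \<le> f y - (\<Sum>k. a / 4 ^ k * \<beta> k (\<sigma> k) y)"
  proof (rule perturbed_minimum[of ?S f \<beta> "\<lambda>k. a / 4 ^ k"])
    show "?S \<noteq> {}" using T by auto
    show "summable (\<lambda>k. a / 4 ^ k)" using sums_summable[OF sa] .
  qed (use lsc bdd \<beta>b cont conv a in auto)
  define g where "g p = (\<Sum>k. a / 4 ^ k * \<beta> k (\<sigma> k) p)" for p
  have tb: "0 \<le> a / 4 ^ k * \<beta> k (\<sigma> k) p" "a / 4 ^ k * \<beta> k (\<sigma> k) p \<le> a / 4 ^ k" for k p
    using a(1) \<beta>b(1,2)[of k "\<sigma> k" p] mult_left_le[of "\<beta> k (\<sigma> k) p" "a / 4 ^ k"] by auto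
  have sg: "summable (\<lambda>k. a / 4 ^ k * \<beta> k (\<sigma> k) p)" for p
  proof (rule summable_comparison_test'[OF sums_summable[OF sa], of 0])
    show "norm (a / 4 ^ k * \<beta> k (\<sigma> k) p) \<le> a / 4 ^ k" for k
      using tb[of k p] by (simp only: real_norm_def abs_of_nonneg)
  qed
  have g0: "0 \<le> g p" for p unfolding g_def by (rule suminf_nonneg[OF sg tb(1)])
  have "g p \<le> a * (4 / 3)" for p
    unfolding g_def sums_unique[OF sa] by (rule suminf_le[OF tb(2) sg sums_summable[OF sa]])
  then have g1: "g p \<le> \<tau>" for p using a(1,3) order_trans[of "g p" "a * (4 / 3)" \<tau>] by simp
  have sL: "(\<lambda>k. a * (1 / 2) ^ k) sums (2 * a)"
    using sums_mult[OF geometric_sums[of "1 / 2 :: real"], of a] by (simp add: mult_ac)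
  have lip: "\<bar>g p - g r\<bar> \<le> \<epsilon> * D p r" for p r
  proof -
    have tl: "\<bar>a / 4 ^ k * \<beta> k (\<sigma> k) p - a / 4 ^ k * \<beta> k (\<sigma> k) r\<bar> \<le> a * (1 / 2) ^ k * D p r" for k
    proof -
      have "\<bar>D (\<sigma> k) p - D (\<sigma> k) r\<bar> \<le> D p r"
        using d_diff_le[of "snd (\<sigma> k)" "snd p" "snd r"] unfolding D_def by linarith
      then have "2 ^ k * \<bar>D (\<sigma> k) p - D (\<sigma> k) r\<bar> \<le> 2 ^ k * D p r" by (intro mult_left_mono) auto
      then have "\<bar>2 ^ k * D (\<sigma> k) p - 2 ^ k * D (\<sigma> k) r\<bar> \<le> 2 ^ k * D p r"
        by (simp add: abs_mult flip: right_diff_distrib)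
      then have "\<bar>\<beta> k (\<sigma> k) p - \<beta> k (\<sigma> k) r\<bar> \<le> 2 ^ k * D p r" unfolding \<beta>_def by linarith
      then have "a / 4 ^ k * \<bar>\<beta> k (\<sigma> k) p - \<beta> k (\<sigma> k) r\<bar> \<le> a / 4 ^ k * (2 ^ k * D p r)"
        using a(1) by (intro mult_left_mono) auto
      moreover have "a / 4 ^ k * (2 ^ k * D p r) = a * (1 / 2) ^ k * D p r"
        by (simp add: power_divide field_simps flip: power_mult_distrib)
      moreover have "a / 4 ^ k * \<bar>\<beta> k (\<sigma> k) p - \<beta> k (\<sigma> k) r\<bar> = \<bar>a / 4 ^ k * \<beta> k (\<sigma> k) p - a / 4 ^ k * \<beta> k (\<sigma> k) r\<bar>"
        using a(1) by (simp only: right_diff_distrib[symmetric] abs_mult) simp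
      ultimately show ?thesis by simp
    qed
    have "\<bar>\<Sum>k. a / 4 ^ k * \<beta> k (\<sigma> k) p - a / 4 ^ k * \<beta> k (\<sigma> k) r\<bar> \<le> (\<Sum>k. a * (1 / 2) ^ k * D p r)"
      by (rule norm_suminf_le[where f="\<lambda>k. a / 4 ^ k * \<beta> k (\<sigma> k) p - a / 4 ^ k * \<beta> k (\<sigma> k) r", unfolded real_norm_def,
          OF tl summable_mult2[OF sums_summable[OF sL]]])
    also have "\<dots> = 2 * a * D p r" using sums_unique[OF sums_mult2[OF sL, of "D p r"]] by simp
    also have "\<dots> \<le> \<epsilon> * D p r" using a(2) D0 by (rule mult_right_mono)
    finally show ?thesis unfolding g_def suminf_diff[OF sg sg] .
  qed
  show ?thesis
  proof (rule that[of "fst z" g "snd z"])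
    show "\<bar>g (s, y) - g (s', y')\<bar> \<le> \<epsilon> * (\<bar>s - s'\<bar> + d y y')" for s y s' y'
      using lip[of "(s, y)" "(s', y')"] by (simp add: D_def)
    show "f (fst z, snd z) - g (fst z, snd z) \<le> f (s, y) - g (s, y)" if "s \<in> {0..T}" for s y
      using min[of "(s, y)"] that by (simp add: g_def)
  qed (use z g0 g1 in auto)
qed


lemma comparison:
  fixes H :: "real \<Rightarrow> 'm \<Rightarrow> real \<Rightarrow> real" and u v :: "real \<Rightarrow> 'm \<Rightarrow> real"
  assumes complete: "finsler_complete A N" and B: "smooth_bump (B :: 'x \<Rightarrow> real) R"
    and H: "condition_A A N H"
    and u: "viscosity_subsolution A N H h u" and v: "viscosity_supersolution A N H h v"
    and bdd: "\<And>T. T > 0 \<Longrightarrow> bounded ((\<lambda>(t, x). u t x) ` ({0..<T} \<times> UNIV)) \<and>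
               bounded ((\<lambda>(t, x). v t x) ` ({0..<T} \<times> UNIV))"
    and lip: "\<And>t x. t > 0 \<Longrightarrow> lipschitz_near A N u t x \<or> lipschitz_near A N v t x"
    and t1: "0 \<le> t1"
  shows "u t1 x1 \<le> v t1 x1"
proof (rule ccontr)
  assume "\<not> u t1 x1 \<le> v t1 x1"
  \<comment> \<open>Half of the gap: at the bad point v - u is -2 \<theta> and \<psi> adds \<theta>,
    so -\<theta> remains.\<close>
  define \<theta> where "\<theta> = (u t1 x1 - v t1 x1) / 2"
  have \<theta>: "0 < \<theta>" using \<open>\<not> u t1 x1 \<le> v t1 x1\<close> by (simp add: \<theta>_def)
  have init: "u 0 x \<le> v 0 x" for x
    using u v unfolding viscosity_subsolution_def viscosity_supersolution_def by (meson order_trans)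
  define T where "T = t1 + 1"
  have T: "t1 < T" "0 < T" using t1 by (auto simp: T_def)
  obtain Bu Bv where Bu: "\<And>s y. 0 \<le> s \<Longrightarrow> s \<le> T \<Longrightarrow> \<bar>u s y\<bar> \<le> Bu"
    and Bv: "\<And>s y. 0 \<le> s \<Longrightarrow> s \<le> T \<Longrightarrow> \<bar>v s y\<bar> \<le> Bv"
  proof -
    \<comment> \<open>Boundedness is known on half-open time intervals; enlarging \<open>T\<close>
      by 1 covers the closed interval [0,T].\<close>
    obtain Bu where "\<forall>z\<in>(\<lambda>(t, x). u t x) ` ({0..<T + 1} \<times> UNIV). norm z \<le> Bu"
      using bdd[of "T + 1"] T unfolding bounded_iff by auto
    moreover obtain Bv where "\<forall>z\<in>(\<lambda>(t, x). v t x) ` ({0..<T + 1} \<times> UNIV). norm z \<le> Bv"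
      using bdd[of "T + 1"] T unfolding bounded_iff by auto
    ultimately show ?thesis by (intro that[of Bu Bv]) auto
  qed
  define b where "b = Bu + Bv"
  have b0: "0 \<le> b" using Bu[of 0 x1] Bv[of 0 x1] T by (simp add: b_def)
  \<comment> \<open>Since T - t1 = 1, this rate gives \<psi>(T) = b + 2 \<theta>, which exceeds the
    bound \<open>b\<close> on |v - u|.\<close>
  define K where "K = ln (b / \<theta> + 2)"
  have b\<theta>: "0 \<le> b / \<theta>" using b0 \<theta> by simp
  have K: "0 < K" unfolding K_def by (rule ln_gt_zero) (use b\<theta> in linarith)
  define \<psi> where "\<psi> s = \<theta> * exp (K * (s - t1))" for s
  have \<psi>pos: "0 < \<psi> s" for s using \<theta> by (simp add: \<psi>_def)
  have \<psi>1: "\<psi> t1 = \<theta>" by (simp add: \<psi>_def)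
  have \<psi>T: "b < \<psi> T"
  proof -
    have "exp K = b / \<theta> + 2" unfolding K_def using b0 \<theta> by (intro exp_ln) (simp add: add_nonneg_pos)
    then show ?thesis using \<theta> by (simp add: \<psi>_def T_def algebra_simps)
  qed
  have \<psi>d: "(\<psi> has_real_derivative K * \<psi> s) (at s within X)" for s X
    unfolding \<psi>_def[abs_def] by (auto intro!: derivative_eq_intros)
  \<comment> \<open>\<psi> solves \<psi>' = K \<psi> and is increasing, so the derivative at time 0
    is a lower bound for it at all later times.\<close>
  define \<delta> where "\<delta> = K * \<psi> 0"
  have \<delta>: "0 < \<delta>" using K \<psi>pos by (simp add: \<delta>_def)
  have \<psi>mono: "\<psi> s \<le> \<psi> s'" if "s \<le> s'" for s s' using that \<theta> K by (simp add: \<psi>_def)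
  obtain C \<omega> where C: "0 \<le> C" and \<omega>: "continuous_on ({0..} \<times> UNIV \<times> UNIV) (\<lambda>(a, b, r). \<omega> a b r)" "\<omega> 0 0 0 = (0::real)"
    and HA: "\<forall>t1\<ge>0. \<forall>t2\<ge>0. \<forall>x1 x2 r1 r2. \<bar>H t1 x1 r1 - H t2 x2 r2\<bar> \<le>
      \<omega> \<bar>t1 - t2\<bar> (d x1 x2) (r1 - r2) + C * max \<bar>r1\<bar> \<bar>r2\<bar> * (\<bar>t1 - t2\<bar> + d x1 x2)"
    using H unfolding condition_A_def by blast
  obtain e0 where e0: "0 < e0" "\<And>a b r. 0 \<le> a \<Longrightarrow> \<bar>a\<bar> < e0 \<Longrightarrow> \<bar>b\<bar> < e0 \<Longrightarrow> \<bar>r\<bar> < e0 \<Longrightarrow> \<omega> a b r < \<delta> / 4"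
  proof -
    obtain e1 where e1: "0 < e1" "\<And>p. p \<in> {0..} \<times> UNIV \<times> UNIV \<Longrightarrow> dist p (0, 0, 0) < e1 \<Longrightarrow>
        dist ((\<lambda>(a, b, r). \<omega> a b r) p) ((\<lambda>(a, b, r). \<omega> a b r) (0, 0, 0)) < \<delta> / 4"
      using \<omega>(1)[unfolded continuous_on_iff, rule_format, of "(0, 0, 0)" "\<delta> / 4"] \<delta> by auto
    have "\<omega> a b r < \<delta> / 4" if "0 \<le> a" "\<bar>a\<bar> < e1 / 3" "\<bar>b\<bar> < e1 / 3" "\<bar>r\<bar> < e1 / 3" for a b r
    proof -
      have "dist (a, b, r) (0, 0, 0) \<le> \<bar>a\<bar> + (\<bar>b\<bar> + \<bar>r\<bar>)"
        using norm_Pair_le[of a "(b, r)"] norm_Pair_le[of b r] by (simp add: dist_norm)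
      then show ?thesis using e1(2)[of "(a, b, r)"] that \<omega>(2) by (simp add: dist_real_def)
    qed
    then show ?thesis using that[of "e1 / 3"] e1(1) by simp
  qed
  \<comment> \<open>The sum of the time derivatives will lose 4 \<epsilon> \<le> \<delta> / 4, and
    the difference of the dual norms will contain 8 \<epsilon> \<le> e0 / 2.\<close>
  define \<epsilon> where "\<epsilon> = min (\<delta> / 16) (e0 / 16)"
  have \<epsilon>: "0 < \<epsilon>" "\<epsilon> \<le> \<delta> / 16" "\<epsilon> \<le> e0 / 16"
    using \<delta> e0(1) unfolding \<epsilon>_def by (auto intro: min.cobounded1 min.cobounded2 simp del: le_divide_eq_numeral1)
  have lscv: "lsc_on ({0..} \<times> UNIV) (\<lambda>(t, x). v t x)" using v by (simp add: viscosity_supersolution_def)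
  have lscu: "lsc_on ({0..} \<times> UNIV) (\<lambda>(t, x). - u t x)"
  proof -
    have us: "usc_on ({0..} \<times> UNIV) (\<lambda>(t, x). u t x)" using u by (simp add: viscosity_subsolution_def)
    show ?thesis unfolding lsc_on_def
    proof (intro ballI allI impI)
      fix z y assume z: "z \<in> {0..} \<times> UNIV" "y < (case z of (t, x) \<Rightarrow> - u t x)"
      then have "(case z of (t, x) \<Rightarrow> u t x) < - y" by (auto simp: case_prod_unfold)
      then have "\<forall>\<^sub>F w in at z within {0..} \<times> UNIV. (case w of (t, x) \<Rightarrow> u t x) < - y"
        using us z(1) unfolding usc_on_def by blast
      then show "\<forall>\<^sub>F w in at z within {0..} \<times> UNIV. y < (case w of (t, x) \<Rightarrow> - u t x)"
        by eventually_elim (simp add: case_prod_unfold)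
    qed
  qed

  \<comment> \<open>The perturbed minimum on [0,T] x M\<close>
  define f where "f p = v (fst p) (snd p) - u (fst p) (snd p) + \<psi> (fst p)" for p
  have c\<psi>: "continuous_on X \<psi>" for X unfolding \<psi>_def[abs_def] by (intro continuous_intros)
  have lscf: "seq_lsc ({0..T} \<times> UNIV) f"
  proof -
    have id: "continuous_on ({0..T} \<times> (UNIV :: 'm set)) (\<lambda>p. p)" "(\<lambda>p. p) ` ({0..T} \<times> (UNIV :: 'm set)) \<subseteq> {0..} \<times> UNIV"
      by (auto intro: continuous_intros)
    have "seq_lsc ({0..T} \<times> UNIV) (\<lambda>p. (case p of (t, x) \<Rightarrow> v t x) + (case p of (t, x) \<Rightarrow> - u t x) + \<psi> (fst p))"
      by (intro seq_lsc_add seq_lsc_compose[OF seq_lsc_lsc_on[OF lscv] id] seq_lsc_compose[OF seq_lsc_lsc_on[OF lscu] id]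
        seq_lsc_continuous_on continuous_on_compose2[OF c\<psi>[of UNIV]] continuous_intros) auto
    then show ?thesis by (simp add: f_def[abs_def] case_prod_unfold)
  qed
  have low: "- b \<le> v s y - u s y" if "0 \<le> s" "s \<le> T" for s y
    using Bu[OF that, of y] Bv[OF that, of y] unfolding b_def by linarith
  have bddf: "bdd_below (f ` ({0..T} \<times> UNIV))"
  proof (rule bdd_belowI2)
    fix p assume "p \<in> {0..T} \<times> (UNIV :: 'm set)"
    then show "- b \<le> f p" using low[of "fst p" "snd p"] \<psi>pos[of "fst p"] by (auto simp: f_def)
  qed
  obtain g t0 x0 where t0: "t0 \<in> {0..T}" and g0: "\<And>p. 0 \<le> g p" and g1: "\<And>p. g p \<le> \<theta> / 2"
    and glip: "\<And>s y s' y'. \<bar>g (s, y) - g (s', y')\<bar> \<le> \<epsilon> * (\<bar>s - s'\<bar> + d y y')"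
    and gmin: "\<And>s y. s \<in> {0..T} \<Longrightarrow> f (t0, x0) - g (t0, x0) \<le> f (s, y) - g (s, y)"
    using ekeland[OF complete lscf bddf _ \<epsilon>(1), of "\<theta> / 2"] T \<theta> by (metis half_gt_zero less_imp_le)
  have "f (t1, x1) = - \<theta>" using \<psi>1 by (simp add: f_def \<theta>_def field_simps)
  \<comment> \<open>The value -\<theta> at the bad point can be raised by at most \<theta> / 2
    through \<open>g\<close>.\<close>
  then have fneg: "f (t0, x0) < 0"
    using gmin[of t1 x1] g0[of "(t1, x1)"] g1[of "(t0, x0)"] t1 T \<theta> by simp
  have t0T: "0 < t0" "t0 < T"
  proof -
    have "t0 \<noteq> 0" using fneg init[of x0] \<psi>pos[of 0] by (auto simp: f_def)
    then show "0 < t0" using t0 by simp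
    have "t0 \<noteq> T" using fneg low[of T x0] \<psi>T T by (auto simp: f_def)
    then show "t0 < T" using t0 by simp
  qed

  \<comment> \<open>Estimates in a chart at the minimizer\<close>
  obtain c where c: "c \<in> charts_at A x0" using chart_ex by blast
  then have cA: "c \<in> A" "x0 \<in> fst c" by (auto simp: charts_at_iff)
  define y0 where "y0 = snd c x0"
  have iy0: "chart_inv c y0 = x0" unfolding y0_def by (rule chart(5)[OF cA])
  let ?n = "nrm c x0"
  obtain k Kc where k: "0 < k" "0 < Kc" "\<And>y. k * norm y \<le> ?n y" "\<And>y. ?n y \<le> Kc * norm y" using nrm_equiv[OF c] by metis
  have nfs: "norm (fst p) \<le> norm p" "norm (snd p) \<le> norm p" for p :: "real \<times> 'x"
    using norm_fst_le[of "fst p" "snd p"] norm_snd_le[of "snd p" "fst p"] by simp_all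
  \<comment> \<open>A norm on the product built from the Finsler norm at \<open>x0\<close>. Relative
    to it, Lipschitz constants for the distance carry over with a factor 2; the product norm would
    bring in the chart constant \<open>Kc\<close>, on which \<epsilon> may not depend.\<close>
  define q where "q p = \<bar>fst p\<bar> + ?n (snd p)" for p :: "real \<times> 'x"
  define k1 where "k1 = min 1 k"
  have k1: "0 < k1" "k1 \<le> 1" "k1 \<le> k" using k(1) by (auto simp: k1_def)
  have n0: "?n 0 = 0" using nrm_scaleR[OF c, of 0 0] by simp
  have q0: "0 \<le> q p" for p using nrm_nonneg[OF c] by (simp add: q_def)
  have qs: "q (a *\<^sub>R p) = \<bar>a\<bar> * q p" for a p by (simp add: q_def nrm_scaleR[OF c] abs_mult algebra_simps)
  have qadd: "q (p + r) \<le> q p + q r" for p r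
    using nrm_add[OF c, of "snd p" "snd r"] unfolding q_def by simp
  have qge: "k1 * norm p \<le> q p" for p
  proof -
    have "norm p \<le> \<bar>fst p\<bar> + norm (snd p)" using norm_Pair_le[of "fst p" "snd p"] by simp
    then have "k1 * norm p \<le> k1 * (\<bar>fst p\<bar> + norm (snd p))" using k1(1) by (intro mult_left_mono) auto
    also have "\<dots> \<le> 1 * \<bar>fst p\<bar> + k * norm (snd p)"
      unfolding distrib_left using k1 by (intro add_mono mult_right_mono) auto
    finally show ?thesis using k(3)[of "snd p"] by (simp add: q_def)
  qed
  have qle: "q p \<le> (1 + Kc) * norm p" for p
  proof -
    have "\<bar>fst p\<bar> \<le> norm p" "norm (snd p) \<le> norm p" using nfs[of p] by auto
    then have "Kc * norm (snd p) \<le> Kc * norm p" using k(2) by (intro mult_left_mono) auto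
    then show ?thesis using k(4)[of "snd p"] \<open>\<bar>fst p\<bar> \<le> norm p\<close> by (simp add: q_def algebra_simps)
  qed
  have qdiff: "\<bar>q (p - z) - q (r - z)\<bar> \<le> q (p - r)" for p r z
  proof -
    have "q (r - p) = q (p - r)" using qs[of "-1" "p - r"] by simp
    then show ?thesis using qadd[of "p - r" "r - z"] qadd[of "r - p" "p - z"] by simp
  qed
  \<comment> \<open>One predicate for both alternatives, so that the estimates are made once and the
    case distinction is postponed to the fuzzy sum rule.\<close>
  define LW where "LW W L w \<longleftrightarrow> (\<forall>s y s' y'. (s, y) \<in> W \<and> 0 \<le> s \<and> (s', y') \<in> W \<and> 0 \<le> s' \<longrightarrow>
    \<bar>w s y - w s' y'\<bar> \<le> L * (\<bar>s - s'\<bar> + d y y'))" for W L and w :: "real \<Rightarrow> 'm \<Rightarrow> real"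
  obtain W L where W: "open W" "(t0, x0) \<in> W" and L: "0 \<le> L"
    and WL: "LW W L u \<or> LW W L v"
  proof -
    have *: "\<exists>W L. open W \<and> (t0, x0) \<in> W \<and> 0 \<le> L \<and> LW W L w" if lw: "lipschitz_near A N w t0 x0" for w
    proof -
      obtain W L where WL: "open W" "(t0, x0) \<in> W" "\<forall>(s, y)\<in>W \<inter> {0..} \<times> UNIV. \<forall>(s', y')\<in>W \<inter> {0..} \<times> UNIV.
        \<bar>w s y - w s' y'\<bar> \<le> L * (\<bar>s - s'\<bar> + d y y')" using lw unfolding lipschitz_near_def by blast
      have "\<bar>w s y - w s' y'\<bar> \<le> max 0 L * (\<bar>s - s'\<bar> + d y y')"
        if "(s, y) \<in> W \<and> 0 \<le> s \<and> (s', y') \<in> W \<and> 0 \<le> s'" for s y s' y'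
      proof -
        have "\<bar>w s y - w s' y'\<bar> \<le> L * (\<bar>s - s'\<bar> + d y y')" using WL(3) that by fastforce
        also have "\<dots> \<le> max 0 L * (\<bar>s - s'\<bar> + d y y')" by (intro mult_right_mono) (auto simp: d_nonneg)
        finally show ?thesis .
      qed
      then show ?thesis using WL(1,2) by (intro exI[of _ W] exI[of _ "max 0 L"]) (auto simp: LW_def)
    qed
    show ?thesis using lip[OF t0T(1), of x0] *[of u] *[of v] that by metis
  qed
  \<comment> \<open>In the norm at \<open>x0\<close>, the differential of the Lipschitz function is
    at most 2 L and the other one differs from it by at most 4 \<epsilon>. Doubling to \<Lambda>
    accounts for the norms at the nearby points.\<close>
  define \<Lambda>0 where "\<Lambda>0 = 2 * L + 4 * \<epsilon>"
  define \<Lambda> where "\<Lambda> = 2 * \<Lambda>0"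
  have \<Lambda>: "0 \<le> \<Lambda>0" "0 \<le> \<Lambda>" using L \<epsilon> by (auto simp: \<Lambda>0_def \<Lambda>_def)
  \<comment> \<open>A relative distortion \<eta> of the norms becomes an absolute error of up to 3
    \<eta> \<Lambda> in the dual norms, so \<eta> has to be chosen after \<Lambda>.\<close>
  define \<eta> where "\<eta> = min 1 (e0 / (8 * (\<Lambda> + 1)))"
  have \<eta>: "0 < \<eta>" "\<eta> \<le> 1" "3 * \<eta> * \<Lambda> < e0 / 2"
  proof -
    show "0 < \<eta>" using e0(1) \<Lambda> by (simp add: \<eta>_def)
    show "\<eta> \<le> 1" unfolding \<eta>_def by (rule min.cobounded1)
    have "\<eta> * (\<Lambda> + 1) \<le> e0 / (8 * (\<Lambda> + 1)) * (\<Lambda> + 1)" using \<Lambda> by (intro mult_right_mono) (auto simp: \<eta>_def)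
    also have "\<dots> = e0 / 8" using \<Lambda> by (simp add: field_simps)
    finally show "3 * \<eta> * \<Lambda> < e0 / 2" using \<open>0 < \<eta>\<close> e0(1) by (simp add: algebra_simps)
  qed
  obtain \<rho> where \<rho>: "0 < \<rho>" "ball y0 \<rho> \<subseteq> snd c ` fst c"
    "\<And>y v. y \<in> ball y0 \<rho> \<Longrightarrow> ?n v \<le> (1 + \<eta>) * nrm c (chart_inv c y) v"
    "\<And>y v. y \<in> ball y0 \<rho> \<Longrightarrow> nrm c (chart_inv c y) v \<le> (1 + \<eta>) * ?n v"
    and \<rho>d: "\<And>y y'. y \<in> ball y0 \<rho> \<Longrightarrow> y' \<in> ball y0 \<rho> \<Longrightarrow>
      d (chart_inv c y) (chart_inv c y') \<le> (1 + \<eta>) * ?n (y' - y)"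
    using chart_ball[OF c \<eta>(1)] unfolding y0_def by metis
  have d2: "d (chart_inv c y) (chart_inv c y') \<le> 2 * ?n (y - y')" if "y \<in> ball y0 \<rho>" "y' \<in> ball y0 \<rho>" for y y'
  proof -
    have "(1 + \<eta>) * ?n (y' - y) \<le> 2 * ?n (y' - y)" using \<eta>(2) nrm_nonneg[OF c] by (intro mult_right_mono) auto
    then show ?thesis using \<rho>d[OF that] nrm_minus_commute[OF c, of y y'] by simp
  qed
  define z0 where "z0 = (t0, y0)"
  define j where "j p = (fst p, chart_inv c (snd p))" for p :: "real \<times> 'x"
  have jz0: "j z0 = (t0, x0)" by (simp add: j_def z0_def iy0)
  have cj: "continuous_on (UNIV \<times> ball y0 \<rho>) j"
    unfolding j_def[abs_def]
    by (intro continuous_intros continuous_on_compose2[OF chart(4)[OF cA(1)] continuous_on_snd[OF continuous_on_id]]) (use \<rho>(2) in auto)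
  obtain r1 where r1: "0 < r1" "\<And>p. p \<in> cball z0 r1 \<Longrightarrow> fst p \<in> {0<..<T} \<and> snd p \<in> ball y0 \<rho> \<and> j p \<in> W"
  proof -
    have "open ((UNIV \<times> ball y0 \<rho>) \<inter> j -` W)"
      by (rule continuous_open_preimage[OF cj _ W(1)]) (intro open_Times open_UNIV open_ball)
    from open_Int[OF open_Times[OF open_greaterThanLessThan open_UNIV] this]
    have "open (({0<..<T} \<times> UNIV) \<inter> ((UNIV \<times> ball y0 \<rho>) \<inter> j -` W))" .
    moreover have "z0 \<in> ({0<..<T} \<times> UNIV) \<inter> ((UNIV \<times> ball y0 \<rho>) \<inter> j -` W)"
      using t0T \<rho>(1) W(2) jz0 by (simp add: z0_def)
    ultimately obtain r1 where "0 < r1" "cball z0 r1 \<subseteq> ({0<..<T} \<times> UNIV) \<inter> ((UNIV \<times> ball y0 \<rho>) \<inter> j -` W)"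
      using open_contains_cball by blast
    then show ?thesis using that[of r1] by (auto simp: subset_iff mem_Times_iff)
  qed
  define fv where "fv p = v (fst p) (chart_inv c (snd p))" for p
  define fu where "fu p = - u (fst p) (chart_inv c (snd p))" for p
  \<comment> \<open>The added term is what produces the linear growth, with constant
    \<open>\<epsilon> * k1\<close>, that the fuzzy sum rule requires.\<close>
  define gt where "gt p = \<epsilon> * q (p - z0) - g (j p)" for p
  define gh where "gh p = gt p + \<psi> (fst p)" for p
  have dj: "\<bar>fst p - fst r\<bar> + d (chart_inv c (snd p)) (chart_inv c (snd r)) \<le> 2 * q (p - r)"
    if "p \<in> cball z0 r1" "r \<in> cball z0 r1" for p r
    using d2[of "snd p" "snd r"] r1(2)[OF that(1)] r1(2)[OF that(2)] by (simp add: q_def)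
  \<comment> \<open>Two of the three \<epsilon> come from \<open>g\<close>, because the distance is
    at most 2 q, and one from the growth term.\<close>
  have gtlip: "\<bar>gt p - gt r\<bar> \<le> 3 * \<epsilon> * q (p - r)" if "p \<in> cball z0 r1" "r \<in> cball z0 r1" for p r
  proof -
    have "\<bar>g (j p) - g (j r)\<bar> \<le> \<epsilon> * (2 * q (p - r))"
      using glip[of "fst p" "chart_inv c (snd p)" "fst r" "chart_inv c (snd r)"]
        mult_left_mono[OF dj[OF that] less_imp_le[OF \<epsilon>(1)]] unfolding j_def by linarith
    moreover have "\<bar>\<epsilon> * q (p - z0) - \<epsilon> * q (r - z0)\<bar> \<le> \<epsilon> * q (p - r)"
      using mult_left_mono[OF qdiff[of p z0 r], of \<epsilon>] \<epsilon>(1) by (simp add: abs_mult flip: right_diff_distrib)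
    ultimately show ?thesis unfolding gt_def by linarith
  qed
  have lscfv: "seq_lsc (cball z0 r1) fv" and lscfu: "seq_lsc (cball z0 r1) fu"
  proof -
    have 1: "continuous_on (cball z0 r1) j" using cj by (rule continuous_on_subset) (use r1(2) in \<open>auto simp: mem_Times_iff\<close>)
    have 2: "j ` cball z0 r1 \<subseteq> {0..} \<times> UNIV" using r1(2) by (force simp: j_def)
    show "seq_lsc (cball z0 r1) fv"
      using seq_lsc_compose[OF seq_lsc_lsc_on[OF lscv] 1 2] by (simp add: fv_def[abs_def] j_def)
    show "seq_lsc (cball z0 r1) fu"
      using seq_lsc_compose[OF seq_lsc_lsc_on[OF lscu] 1 2] by (simp add: fu_def[abs_def] j_def)
  qed
  have \<psi>lip: "\<bar>\<psi> s - \<psi> s'\<bar> \<le> K * \<psi> T * \<bar>s - s'\<bar>" if "s \<in> {0..T}" "s' \<in> {0..T}" for s s'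
  proof -
    have "norm (\<psi> s - \<psi> s') \<le> K * \<psi> T * norm (s - s')"
    proof (rule field_differentiable_bound[of "{0..T}" \<psi> "\<lambda>s. K * \<psi> s"])
      show "norm (K * \<psi> z) \<le> K * \<psi> T" if "z \<in> {0..T}" for z
        using \<psi>mono[of z T] \<psi>pos[of z] K that by (simp add: abs_mult)
    qed (use that \<psi>d in auto)
    then show ?thesis by simp
  qed
  have ghlip: "((3 * \<epsilon>) * (1 + Kc) + K * \<psi> T)-lipschitz_on (cball z0 r1) gh"
  proof (rule lipschitz_onI)
    show "0 \<le> (3 * \<epsilon>) * (1 + Kc) + K * \<psi> T" using \<epsilon> k K \<psi>pos[of T] by simp
    fix p r assume pr: "p \<in> cball z0 r1" "r \<in> cball z0 r1"
    have "\<bar>gt p - gt r\<bar> \<le> 3 * \<epsilon> * ((1 + Kc) * norm (p - r))"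
      using gtlip[OF pr] mult_left_mono[OF qle[of "p - r"], of "3 * \<epsilon>"] \<epsilon>(1) by linarith
    moreover have "\<bar>\<psi> (fst p) - \<psi> (fst r)\<bar> \<le> K * \<psi> T * norm (p - r)"
    proof -
      have "\<bar>\<psi> (fst p) - \<psi> (fst r)\<bar> \<le> K * \<psi> T * \<bar>fst p - fst r\<bar>"
        using r1(2)[OF pr(1)] r1(2)[OF pr(2)] by (intro \<psi>lip) auto
      also have "\<dots> \<le> K * \<psi> T * norm (p - r)"
        using K \<psi>pos[of T] nfs(1)[of "p - r"] by (intro mult_left_mono) auto
      finally show ?thesis .
    qed
    ultimately show "dist (gh p) (gh r) \<le> ((3 * \<epsilon>) * (1 + Kc) + K * \<psi> T) * dist p r"
      by (simp add: gh_def dist_real_def dist_norm algebra_simps)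
  qed
  have grow: "fv z0 + fu z0 + gh z0 + \<epsilon> * k1 * norm (z - z0) \<le> fv z + fu z + gh z" if z: "z \<in> cball z0 r1" for z
  proof -
    have "f (t0, x0) - g (t0, x0) \<le> f (j z) - g (j z)"
      using gmin[of "fst z" "chart_inv c (snd z)"] r1(2)[OF z] by (simp add: j_def)
    moreover have "\<epsilon> * (k1 * norm (z - z0)) \<le> \<epsilon> * q (z - z0)" using qge \<epsilon>(1) by (intro mult_left_mono) auto
    moreover have "q 0 = 0" by (simp add: q_def n0)
    ultimately show ?thesis
      by (simp add: fv_def fu_def gh_def gt_def f_def j_def z0_def iy0 algebra_simps)
  qed
  \<comment> \<open>Two points within \<open>e\<close> of \<open>z0\<close> are less than 2 e apart
    in the product norm; in time plus Finsler distance this is at most 2 e (1 + 2 Kc) = e M.\<close>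
  define M where "M = 2 + 4 * Kc"
  have M: "0 < M" using k by (simp add: M_def)
  \<comment> \<open>The four bounds absorb the error of the sum rule into \<epsilon> q, keep the
    points in the ball of radius \<open>r1\<close>, make the arguments of \<omega> small, and make
    the term with \<open>C\<close> at most \<delta> / 4.\<close>
  define e where "e = min (min (\<epsilon> * k1) r1) (min (e0 / (2 * M)) (\<delta> / (4 * (C * \<Lambda> + 1) * M)))"
  have CL: "0 \<le> C * \<Lambda>" using C \<Lambda> by simp
  have e: "0 < e" "e \<le> \<epsilon> * k1" "e \<le> r1" "e * M < e0" "C * \<Lambda> * (e * M) \<le> \<delta> / 4"
  proof -
    show e_pos: "0 < e" using \<epsilon> k1 r1 e0 M \<delta> CL by (simp add: e_def)
    show "e \<le> \<epsilon> * k1" "e \<le> r1" unfolding e_def by linarith+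
    have "e * M \<le> e0 / (2 * M) * M" using M by (intro mult_right_mono) (auto simp: e_def)
    also have "\<dots> = e0 / 2" using M by simp
    finally show "e * M < e0" using e0(1) by linarith
    have "(C * \<Lambda> + 1) * M * e \<le> (C * \<Lambda> + 1) * M * (\<delta> / (4 * (C * \<Lambda> + 1) * M))"
      using M CL by (intro mult_left_mono) (auto simp: e_def)
    also have "\<dots> = \<delta> / 4"
    proof -
      have "X * M * (\<delta> / (4 * X * M)) = \<delta> / 4" if "0 < X" for X using that M by simp
      from this[of "C * \<Lambda> + 1"] show ?thesis using CL by simp
    qed
    finally have "C * \<Lambda> * (e * M) + e * M \<le> \<delta> / 4" by (simp add: algebra_simps)
    moreover have "0 < e * M" using e_pos M by simp
    ultimately show "C * \<Lambda> * (e * M) \<le> \<delta> / 4" by linarith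
  qed

  \<comment> \<open>The fuzzy sum rule for v, -u and the perturbation\<close>
  obtain B2 :: "real \<times> 'x \<Rightarrow> real" and R2 where B2: "smooth_bump B2 R2"
    using smooth_bump_real smooth_bump_Pair[OF _ B] by blast
  have \<kappa>: "0 < \<epsilon> * k1" using \<epsilon> k1 by simp
  have liploc: "\<bar>w (fst p) (chart_inv c (snd p)) - w (fst r) (chart_inv c (snd r))\<bar> \<le> 2 * L * q (p - r)"
    if w: "LW W L w"
      and pr: "p \<in> cball z0 r1" "r \<in> cball z0 r1" for w p r
  proof -
    have "\<bar>w (fst p) (chart_inv c (snd p)) - w (fst r) (chart_inv c (snd r))\<bar> \<le>
        L * (\<bar>fst p - fst r\<bar> + d (chart_inv c (snd p)) (chart_inv c (snd r)))"
      using w r1(2)[OF pr(1)] r1(2)[OF pr(2)] by (auto simp: j_def LW_def)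
    also have "\<dots> \<le> L * (2 * q (p - r))" by (rule mult_left_mono[OF dj[OF pr] L])
    finally show ?thesis by simp
  qed
  have lipnorm: "(2 * L * (1 + Kc))-lipschitz_on (cball z0 r1) w"
    if "\<And>p r. p \<in> cball z0 r1 \<Longrightarrow> r \<in> cball z0 r1 \<Longrightarrow> \<bar>w p - w r\<bar> \<le> 2 * L * q (p - r)" for w
  proof (rule lipschitz_onI)
    show "0 \<le> 2 * L * (1 + Kc)" using L k by simp
    fix p r assume "p \<in> cball z0 r1" "r \<in> cball z0 r1"
    then have "\<bar>w p - w r\<bar> \<le> 2 * L * q (p - r)" by (rule that)
    also have "\<dots> \<le> 2 * L * ((1 + Kc) * norm (p - r))" using L qle by (intro mult_left_mono) auto
    finally show "dist (w p) (w r) \<le> 2 * L * (1 + Kc) * dist p r" by (simp add: dist_real_def dist_norm mult.assoc)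
  qed
  have evball: "\<forall>\<^sub>F p in nhds z. p \<in> cball z0 r1" if "z \<in> ball z0 e" for z
    using that e(3) by (intro eventually_nhds[THEN iffD2] exI[of _ "ball z0 e"]) auto
  have subcb: "z \<in> cball z0 r1" if "z \<in> ball z0 e" for z using that e(3) by auto
  have der_bound: "\<bar>P h\<bar> \<le> 2 * L * q h"
    if w: "\<And>p r. p \<in> cball z0 r1 \<Longrightarrow> r \<in> cball z0 r1 \<Longrightarrow> \<bar>w p - w r\<bar> \<le> 2 * L * q (p - r)"
      and z: "z \<in> ball z0 e" and P: "(G has_derivative P) (at z)" and m: "\<forall>\<^sub>F p in nhds z. w z - G z \<le> w p - G p"
    for w G P z h
  proof (rule has_derivative_bound_seminorm[OF P, of "\<lambda>h. 2 * L * q h"])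
    show "\<forall>\<^sub>F y in nhds z. G y - G z \<le> 2 * L * q (y - z)"
      using m evball[OF z]
    proof eventually_elim
      case (elim y)
      then show ?case using w[OF elim(2) subcb[OF z]] by linarith
    qed
  qed (simp add: qs)
  \<comment> \<open>Whichever of \<open>fu\<close> and \<open>fv\<close> is Lipschitz takes the role
    of the first function, and the other enters only as lower semicontinuous. \<open>Lbound\<close>
    records which differential is thereby bounded.\<close>
  obtain zv zu z3 Gv Gu G3 Pv Pu P3 where
    z: "zv \<in> ball z0 e" "zu \<in> ball z0 e" "z3 \<in> ball z0 e"
    and Gv: "C1_on UNIV Gv" "(Gv has_derivative Pv) (at zv)" "\<forall>\<^sub>F p in nhds zv. fv zv - Gv zv \<le> fv p - Gv p"
    and Gu: "C1_on UNIV Gu" "(Gu has_derivative Pu) (at zu)" "\<forall>\<^sub>F p in nhds zu. fu zu - Gu zu \<le> fu p - Gu p"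
    and G3: "(G3 has_derivative P3) (at z3)" "\<forall>\<^sub>F p in nhds z3. gh z3 - G3 z3 \<le> gh p - G3 p"
    and sum: "\<And>h. \<bar>Pv h + Pu h + P3 h\<bar> \<le> e * norm h"
    and Lbound: "(\<forall>h. \<bar>Pv h\<bar> \<le> 2 * L * q h) \<or> (\<forall>h. \<bar>Pu h\<bar> \<le> 2 * L * q h)"
    using WL
  proof
    assume w: "LW W L u"
    have lu: "\<bar>fu p - fu r\<bar> \<le> 2 * L * q (p - r)" if "p \<in> cball z0 r1" "r \<in> cball z0 r1" for p r
      using liploc[OF w that] unfolding fu_def by linarith
    have grow': "fu z0 + fv z0 + gh z0 + \<epsilon> * k1 * norm (z - z0) \<le> fu z + fv z + gh z" if "z \<in> cball z0 r1" for z
      using grow[OF that] by linarith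
    have lipf: "(2 * L * (1 + Kc))-lipschitz_on (cball z0 r1) fu" by (rule lipnorm[OF lu])
    show ?thesis
    proof (rule fuzzy_sum_rule[OF B2 r1(1) \<kappa> e(1) lipf ghlip lscfv], goal_cases)
      case (1 z)
      then show ?case by (rule grow')
    next
      case (2 z1 z2 z3 G1 G2 G3 P1 P2 P3)
      show ?case
        by (rule that[OF 2(2,1,3,5,8,11,4,7,10,9,12)]) (use 2(13) der_bound[OF lu 2(1,7,10)] in \<open>auto simp: add.commute add.left_commute\<close>)
    qed
  next
    assume w: "LW W L v"
    have lv: "\<bar>fv p - fv r\<bar> \<le> 2 * L * q (p - r)" if "p \<in> cball z0 r1" "r \<in> cball z0 r1" for p r
      using liploc[OF w that] unfolding fv_def by linarith
    have lipf: "(2 * L * (1 + Kc))-lipschitz_on (cball z0 r1) fv" by (rule lipnorm[OF lv])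
    show ?thesis
    proof (rule fuzzy_sum_rule[OF B2 r1(1) \<kappa> e(1) lipf ghlip lscfu], goal_cases)
      case (1 z)
      then show ?case by (rule grow)
    next
      case (2 z1 z2 z3 G1 G2 G3 P1 P2 P3)
      show ?case
        by (rule that[OF 2(1,2,3,4,7,10,5,8,11,9,12)]) (use 2(13) der_bound[OF lv 2(1,7,10)] in auto)
    qed
  qed
  interpret Pv: bounded_linear Pv using Gv(2) has_derivative_bounded_linear by blast
  interpret Pu: bounded_linear Pu using Gu(2) has_derivative_bounded_linear by blast
  \<comment> \<open>\<open>G3\<close> touches \<open>gh\<close> from below, so \<open>G3\<close>
    minus \<psi> touches \<open>gt\<close>, whose Lipschitz constant 3 \<epsilon> bounds the
    remaining derivative.\<close>
  have P3: "\<bar>P3 h - K * \<psi> (fst z3) * fst h\<bar> \<le> 3 * \<epsilon> * q h" for h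
  proof -
    have "((\<lambda>p. \<psi> (fst p)) has_derivative (\<lambda>h. K * \<psi> (fst z3) * fst h)) (at z3)"
      using has_derivative_compose[OF has_derivative_fst[OF has_derivative_ident], of \<psi> "(*) (K * \<psi> (fst z3))" z3 UNIV]
        \<psi>d[of "fst z3" UNIV] by (simp add: has_field_derivative_def)
    from has_derivative_diff[OF G3(1) this]
    have D: "((\<lambda>p. G3 p - \<psi> (fst p)) has_derivative (\<lambda>h. P3 h - K * \<psi> (fst z3) * fst h)) (at z3)" .
    show ?thesis
    proof (rule has_derivative_bound_seminorm[OF D, of "\<lambda>h. 3 * \<epsilon> * q h"])
      show "\<forall>\<^sub>F y in nhds z3. G3 y - \<psi> (fst y) - (G3 z3 - \<psi> (fst z3)) \<le> 3 * \<epsilon> * q (y - z3)"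
        using G3(2) evball[OF z(3)]
      proof eventually_elim
        case (elim y)
        then show ?case using gtlip[OF elim(2) subcb[OF z(3)]] unfolding gh_def by linarith
      qed
    qed (simp add: qs)
  qed
  have eq: "e * norm h \<le> \<epsilon> * q h" for h
  proof -
    have "e * norm h \<le> \<epsilon> * k1 * norm h" using e(2) by (intro mult_right_mono) auto
    also have "\<dots> \<le> \<epsilon> * q h" using qge[of h] \<epsilon>(1) by (simp add: mult.assoc)
    finally show ?thesis .
  qed

  \<comment> \<open>The viscosity inequalities at nearby points\<close>
  define tv xv tu xu where "tv = fst zv" and "xv = chart_inv c (snd zv)" and "tu = fst zu" and "xu = chart_inv c (snd zu)"
  have inb: "snd p \<in> ball y0 \<rho>" "0 < fst p" if "p \<in> ball z0 e" for p using r1(2)[OF subcb[OF that]] by auto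
  have ch: "c \<in> charts_at A (chart_inv c (snd p))" "snd c (chart_inv c (snd p)) = snd p" if "p \<in> ball z0 e" for p
  proof -
    have "snd p \<in> snd c ` fst c" using inb(1)[OF that] \<rho>(2) by blast
    then show "c \<in> charts_at A (chart_inv c (snd p))" "snd c (chart_inv c (snd p)) = snd p"
      using chart(6,7)[OF cA(1)] cA(1) by (auto simp: charts_at_iff)
  qed
  have tpos: "0 < tv" "0 < tu" using inb(2) z by (auto simp: tv_def tu_def)
  define Dv Du where "Dv y = Pv (0, y)" and "Du y = - Pu (0, y)" for y
  have blD: "bounded_linear Dv" "bounded_linear Du"
  proof -
    have i: "bounded_linear (\<lambda>y :: 'x. (0 :: real, y))" by (intro bounded_linear_Pair bounded_linear_zero bounded_linear_ident)
    show "bounded_linear Dv" unfolding Dv_def[abs_def] by (rule bounded_linear_compose[OF Pv.bounded_linear_axioms i])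
    show "bounded_linear Du" unfolding Du_def[abs_def] by (intro bounded_linear_minus bounded_linear_compose[OF Pu.bounded_linear_axioms i])
  qed
  define rv ru where "rv = dual_norm A N xv (chart_covector c xv Dv)" and "ru = dual_norm A N xu (chart_covector c xu Du)"
  have zvp: "(tv, snd c xv) = zv" and zup: "(tu, snd c xu) = zu" using ch(2) z by (simp_all add: tv_def xv_def tu_def xu_def)
  have cv: "c \<in> charts_at A xv" and cu: "c \<in> charts_at A xu" using ch(1) z by (auto simp: xv_def xu_def)
  have "(Pv (1, 0), chart_covector c xv (\<lambda>y. Pv (0, y))) \<in> subdifferential A v tv xv"
  proof (rule chart_test_subdifferential[OF cv B Gv(1)])
    show "(Gv has_derivative Pv) (at (tv, snd c xv))" using Gv(2) by (simp only: zvp)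
    show "\<forall>\<^sub>F (s, y) in nhds (tv, snd c xv). v tv xv - Gv (tv, snd c xv) \<le> v s (chart_inv c y) - Gv (s, y)"
      unfolding zvp using Gv(3) by eventually_elim (simp add: fv_def tv_def xv_def case_prod_unfold)
  qed
  then have Hv: "0 \<le> Pv (1, 0) + H tv xv rv"
    using v tpos(1) unfolding viscosity_supersolution_def rv_def Dv_def[abs_def] by fastforce
  \<comment> \<open>\<open>Gu\<close> touches -u from below, so its negative touches u from above;
    hence the signs here and in \<open>Du\<close>.\<close>
  have "(- Pu (1, 0), chart_covector c xu (\<lambda>y. - Pu (0, y))) \<in> superdifferential A u tu xu"
  proof (rule chart_test_superdifferential[OF cu B])
    show "C1_on UNIV (\<lambda>p. - Gu p)" using C1_on_diff[OF C1_on_const[of UNIV 0] Gu(1)] by simp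
    show "((\<lambda>p. - Gu p) has_derivative (\<lambda>h. - Pu h)) (at (tu, snd c xu))"
      using has_derivative_minus[OF Gu(2)] by (simp only: zup)
    show "\<forall>\<^sub>F (s, y) in nhds (tu, snd c xu). u s (chart_inv c y) - - Gu (s, y) \<le> u tu xu - - Gu (tu, snd c xu)"
      unfolding zup using Gu(3) by eventually_elim (simp add: fu_def tu_def xu_def case_prod_unfold)
  qed
  then have Hu: "- Pu (1, 0) + H tu xu ru \<le> 0"
    using u tpos(2) unfolding viscosity_subsolution_def ru_def Du_def[abs_def] by fastforce
  \<comment> \<open>The sum rule costs \<epsilon> and the perturbation 3 \<epsilon>; the derivative
    of \<psi> contributes at least \<delta> with the favourable sign.\<close>
  have time: "Pv (1, 0) + Pu (1, 0) \<le> 4 * \<epsilon> - \<delta>"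
  proof -
    have q1: "q (1, 0) = 1" by (simp add: q_def n0)
    have "Pv (1, 0) + Pu (1, 0) + P3 (1, 0) \<le> \<epsilon>" using sum[of "(1, 0)"] eq[of "(1, 0)"] q1 by simp
    moreover have "K * \<psi> (fst z3) - 3 * \<epsilon> \<le> P3 (1, 0)" using P3[of "(1, 0)"] q1 by simp
    moreover have "\<delta> \<le> K * \<psi> (fst z3)"
      unfolding \<delta>_def using \<psi>mono[of 0 "fst z3"] inb(2)[OF z(3)] K by (intro mult_left_mono) auto
    ultimately show ?thesis by linarith
  qed
  \<comment> \<open>In space directions \<psi> contributes nothing, so only \<epsilon> from the sum
    rule and 3 \<epsilon> from \<open>gt\<close> remain.\<close>
  have Ddiff: "\<bar>Dv y - Du y\<bar> \<le> 4 * \<epsilon> * ?n y" for y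
  proof -
    have qy: "q (0, y) = ?n y" by (simp add: q_def)
    have "\<bar>Pv (0, y) + Pu (0, y) + P3 (0, y)\<bar> \<le> \<epsilon> * ?n y" using sum[of "(0, y)"] eq[of "(0, y)"] qy by simp
    moreover have "\<bar>P3 (0, y)\<bar> \<le> 3 * \<epsilon> * ?n y" using P3[of "(0, y)"] qy by simp
    ultimately show ?thesis unfolding Dv_def Du_def by linarith
  qed
  have Dbound: "\<bar>Dv y\<bar> \<le> \<Lambda>0 * ?n y \<and> \<bar>Du y\<bar> \<le> \<Lambda>0 * ?n y" for y
  proof -
    have "\<bar>Dv y\<bar> \<le> 2 * L * ?n y \<or> \<bar>Du y\<bar> \<le> 2 * L * ?n y"
      using Lbound
    proof
      assume "\<forall>h. \<bar>Pv h\<bar> \<le> 2 * L * q h"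
      from spec[OF this, of "(0, y)"] show ?thesis by (simp add: Dv_def q_def)
    next
      assume "\<forall>h. \<bar>Pu h\<bar> \<le> 2 * L * q h"
      from spec[OF this, of "(0, y)"] show ?thesis by (simp add: Du_def q_def)
    qed
    moreover have "\<Lambda>0 * ?n y = 2 * L * ?n y + 4 * \<epsilon> * ?n y" by (simp add: \<Lambda>0_def algebra_simps)
    moreover have "0 \<le> 4 * \<epsilon> * ?n y" using \<epsilon>(1) nrm_nonneg[OF c] by simp
    ultimately show ?thesis using Ddiff[of y] by linarith
  qed

  \<comment> \<open>Comparison of the dual norms and contradiction\<close>
  have nv: "?n y \<le> (1 + \<eta>) * nrm c xv y" "nrm c xv y \<le> (1 + \<eta>) * ?n y"
    and nu: "?n y \<le> (1 + \<eta>) * nrm c xu y" "nrm c xu y \<le> (1 + \<eta>) * ?n y" for y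
    unfolding xv_def xu_def by (intro \<rho>(3,4) inb z)+
  have rbound: "0 \<le> dual_norm A N x (chart_covector c x D) \<and> dual_norm A N x (chart_covector c x D) \<le> \<Lambda>"
    if cx: "c \<in> charts_at A x" and D: "bounded_linear D" "\<And>y. \<bar>D y\<bar> \<le> \<Lambda>0 * ?n y"
      and nx: "\<And>y. ?n y \<le> (1 + \<eta>) * nrm c x y" for x D
  proof -
    have "\<bar>D y\<bar> \<le> \<Lambda> * nrm c x y" for y
    proof -
      have "(1 + \<eta>) * nrm c x y \<le> 2 * nrm c x y" using \<eta>(2) nrm_nonneg[OF cx] by (intro mult_right_mono) auto
      then have "?n y \<le> 2 * nrm c x y" using nx[of y] by linarith
      then have "\<Lambda>0 * ?n y \<le> \<Lambda>0 * (2 * nrm c x y)" using \<Lambda>(1) by (rule mult_left_mono)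
      then show ?thesis using D(2)[of y] by (simp add: \<Lambda>_def)
    qed
    then show ?thesis using dual_norm_bounds(1)[OF cx D(1)] dual_norm_bounds(3)[OF cx D(1) \<Lambda>(2)] by blast
  qed
  have rv: "0 \<le> rv" "rv \<le> \<Lambda>"
    unfolding rv_def using rbound[OF cv blD(1) _ nv(1)] Dbound by blast+
  have ru: "0 \<le> ru" "ru \<le> \<Lambda>"
    unfolding ru_def using rbound[OF cu blD(2) _ nu(1)] Dbound by blast+
  \<comment> \<open>Expanding the product leaves errors of at most 3 \<eta> \<Lambda> < e0 / 2 and 8
    \<epsilon> \<le> e0 / 2. The bound is used in both directions, with the roles of
    \<open>rv\<close> and \<open>ru\<close> exchanged.\<close>
  have close: "(r * (1 + \<eta>) + 4 * \<epsilon>) * (1 + \<eta>) < r + e0" if "0 \<le> r" "r \<le> \<Lambda>" for r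
  proof -
    have "(r * (1 + \<eta>) + 4 * \<epsilon>) * (1 + \<eta>) = r + r * (2 * \<eta> + \<eta> * \<eta>) + 4 * \<epsilon> * (1 + \<eta>)" by (simp add: algebra_simps)
    also have "r * (2 * \<eta> + \<eta> * \<eta>) \<le> \<Lambda> * (3 * \<eta>)"
    proof (rule mult_mono)
      have "\<eta> * \<eta> \<le> \<eta> * 1" using \<eta> by (intro mult_left_mono) auto
      then show "2 * \<eta> + \<eta> * \<eta> \<le> 3 * \<eta>" by simp
    qed (use that \<Lambda> \<eta> in auto)
    also have "4 * \<epsilon> * (1 + \<eta>) \<le> 4 * \<epsilon> * 2" using \<eta> \<epsilon> by (intro mult_left_mono) auto
    finally show ?thesis using \<eta>(3) \<epsilon>(3) by (simp add: mult_ac)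
  qed
  have "rv \<le> (ru * (1 + \<eta>) + 4 * \<epsilon>) * (1 + \<eta>)"
    unfolding rv_def ru_def
    by (rule dual_norm_compare[where n="?n", OF cv cu _ _ nv(1) nu(2) blD Ddiff]) (use \<eta> \<epsilon> in auto)
  moreover have "ru \<le> (rv * (1 + \<eta>) + 4 * \<epsilon>) * (1 + \<eta>)"
    unfolding rv_def ru_def
    by (rule dual_norm_compare[where n="?n", OF cu cv _ _ nu(1) nv(2) blD(2,1)]) (use \<eta> \<epsilon> Ddiff in \<open>auto simp: abs_minus_commute\<close>)
  ultimately have rdiff: "\<bar>rv - ru\<bar> < e0" using close[OF rv] close[OF ru] by linarith
  have dd: "\<bar>tv - tu\<bar> + d xv xu < e * M"
  proof -
    have "dist zv zu < 2 * e" using z(1,2) dist_triangle3[of zv zu z0] by (simp add: dist_commute)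
    then have n: "norm (zv - zu) < 2 * e" by (simp add: dist_norm)
    have "\<bar>tv - tu\<bar> \<le> norm (zv - zu)"
      using nfs(1)[of "zv - zu"] by (simp add: tv_def tu_def)
    moreover have "d xv xu \<le> 2 * (Kc * norm (zv - zu))"
    proof -
      have "d xv xu \<le> 2 * ?n (snd zv - snd zu)" unfolding xv_def xu_def by (intro d2 inb z)
      also have "?n (snd zv - snd zu) \<le> Kc * norm (snd zv - snd zu)" by (rule k(4))
      also have "norm (snd zv - snd zu) \<le> norm (zv - zu)"
        using nfs(2)[of "zv - zu"] by simp
      finally show ?thesis using k(2) by simp
    qed
    moreover have "norm (zv - zu) * (1 + 2 * Kc) < 2 * e * (1 + 2 * Kc)" using n k(2) by (intro mult_strict_right_mono) auto
    ultimately show ?thesis by (simp add: M_def algebra_simps)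
  qed
  have dn: "0 \<le> d xv xu" by (rule d_nonneg)
  have "\<bar>H tv xv rv - H tu xu ru\<bar> \<le> \<omega> \<bar>tv - tu\<bar> (d xv xu) (rv - ru) + C * max \<bar>rv\<bar> \<bar>ru\<bar> * (\<bar>tv - tu\<bar> + d xv xu)"
    using HA tpos by simp
  also have "\<omega> \<bar>tv - tu\<bar> (d xv xu) (rv - ru) \<le> \<delta> / 4"
    by (rule less_imp_le, rule e0(2)) (use dd dn e(4) rdiff in linarith)+
  also have "C * max \<bar>rv\<bar> \<bar>ru\<bar> * (\<bar>tv - tu\<bar> + d xv xu) \<le> C * \<Lambda> * (e * M)"
    using C rv ru dd dn CL by (intro mult_mono) auto
  also have "\<dots> \<le> \<delta> / 4" by (rule e(5))
  finally have "H tv xv rv - H tu xu ru \<le> \<delta> / 2" by linarith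
  \<comment> \<open>Subtracting the viscosity inequalities gives 0 \<le> (4 \<epsilon> - \<delta>) +
    \<delta> / 2, and 4 \<epsilon> \<le> \<delta> / 4.\<close>
  then show False using Hv Hu time \<epsilon>(2) \<delta> by linarith
qed

end

theorem theorem5p4:
  fixes A :: "('m::t2_space, 'x::banach) chart set"
    and N :: "'m \<Rightarrow> ('m, 'x) tangent \<Rightarrow> real"
    and H :: "real \<Rightarrow> 'm \<Rightarrow> real \<Rightarrow> real"
    and h :: "'m \<Rightarrow> real"
    and u v :: "real \<Rightarrow> 'm \<Rightarrow> real"
  assumes "C1_finsler_manifold A N" and "finsler_complete A N"
    and "\<exists>b :: 'x \<Rightarrow> real. C1_Lipschitz_bump b"
    and "continuous_on ({0..} \<times> UNIV \<times> UNIV) (\<lambda>(t, x, r). H t x r)"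
    and "condition_A A N H"
    and "bounded (range h)" and "continuous_on UNIV h"
    and "viscosity_subsolution A N H h u"
    and "viscosity_supersolution A N H h v"
    and "\<forall>T>0. bounded ((\<lambda>(t, x). u t x) ` ({0..<T} \<times> UNIV)) \<and>
               bounded ((\<lambda>(t, x). v t x) ` ({0..<T} \<times> UNIV))"
    and "\<forall>t>0. \<forall>x. lipschitz_near A N u t x \<or> lipschitz_near A N v t x"
  shows "(INF (t, x)\<in>{0..} \<times> UNIV. ereal (v t x - u t x)) \<ge> 0"
proof -
  interpret finsler A N by unfold_locales (rule assms(1))
  obtain B R where B: "smooth_bump (B :: 'x \<Rightarrow> real) R"
    using assms(3) smooth_bump_if_C1_Lipschitz_bump by blast
  have "u t x \<le> v t x" if "0 \<le> t" for t x
    by (rule comparison[OF assms(2) B assms(5,8,9) _ _ that]) (use assms(10,11) in auto)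
  then show ?thesis by (intro INF_greatest) auto
qed

end
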